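(* Let $m\in\mathbb{R}$ and $A=\begin{pmatrix}\alpha&\beta\\\gamma&\delta\end{pmatrix}\in\mathbb{C}^{2\times2}$. Then $$\sigma(D_A)=(-\infty,-|m|]\cup[|m|,+\infty)\cup\sigma_p(D_A),$$ where $\sigma_p(D_A)\cap((-\infty,-|m|]\cup[|m|,+\infty))=\emptyset$ and $z\in\mathbb{C}\setminus((-\infty,-|m|]\cup[|m|,+\infty))$ is an eigenvalue of $D_A$ iff $\det\big(\sigma_0+\tfrac{i}{2}AZ(z)\big)=0$. In particular: (1) if $m=0$, $\mathrm{Tr}(A)=0$ and $\det(A)=4$, then $\sigma_p(D_A)=\mathbb{C}\setminus\mathbb{R}$; (2) if $m=0$, $\mathrm{Tr}(A)\neq0$ and $\det(A)-4=\pm2i\,\mathrm{Tr}(A)$, then $\sigma_p(D_A)=\{z\in\mathbb{C}:\pm\mathrm{Im}z>0\}$; (3) if $m\neq0$, $\alpha=\delta=0$ and $\det(A)=4$, then $\sigma_p(D_A)=\mathbb{C}\setminus((-\infty,-|m|]\cup[|m|,+\infty))$. In all other cases $D_A$ has at most two eigenvalues. In particular $D_A$ has no eigenvalues if: $m=0$, $\mathrm{Tr}(A)=0$, $\det(A)\neq4$; or $m=0$, $\mathrm{Tr}(A)\neq0$, $\det(A)-4\neq\pm2i\,\mathrm{Tr}(A)$ (for both signs); or $m\neq0$, $\alpha=\delta=0$, $\det(A)\neq4$; or $m\neq0$, $\alpha=0$, $\delta\neq0$, $\det(A)=4$. In all cases, the geometric multiplicity of an eigenvalue $z$ equals $\dim\ker\big(\sigma_0+\tfrac{i}{2}AZ(z)\big)\le2$,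 the algebraic multiplicity of every isolated eigenvalue is finite, and for every $z\notin\sigma(D_A)$ the resolvent $(D_A-z)^{-1}$ is the integral operator with kernel $R_z(x,y)-R_z(x,0)\big(\sigma_0+\tfrac{i}{2}AZ(z)\big)^{-1}AR_z(0,y)$.
   Context: Let $\sigma_0=I_2$, $\sigma_1=\begin{pmatrix}0&1\\1&0\end{pmatrix}$, $\sigma_3=\begin{pmatrix}1&0\\0&-1\end{pmatrix}$. Identify $L^2(\mathbb{R};\mathbb{C}^2)=L^2(\mathbb{R}_-;\mathbb{C}^2)\oplus L^2(\mathbb{R}_+;\mathbb{C}^2)$; for $\psi=\psi_-\oplus\psi_+\in H^1(\mathbb{R}_-;\mathbb{C}^2)\oplus H^1(\mathbb{R}_+;\mathbb{C}^2)$, $\psi(0_\pm)$ are the one-sided traces at $0$. Let $\mathscr{D}=-i\sigma_1\frac{d}{dx}+m\sigma_3$, and let $D_A$ be the operator with domain $\{\psi\in H^1(\mathbb{R}_-;\mathbb{C}^2)\oplus H^1(\mathbb{R}_+;\mathbb{C}^2) : (2i\sigma_1-A)\psi(0_+)=(2i\sigma_1+A)\psi(0_-)\}$ acting as $D_A\psi=\mathscr{D}\psi_-\oplus\mathscr{D}\psi_+$. Branch convention: $\mathrm{Im}\sqrt{w}>0$ for $w\in\mathbb{C}\setminus[0,+\infty)$. For $z\in\mathbb{C}\setminus((-\infty,-|m|]\cup[|m|,+\infty))$ put $k(z)=\sqrt{z^2-m^2}$, $\zeta(z)=\frac{z+m}{k(z)}$, $Z(z)=\mathrm{diag}(\zeta(z),\zeta(z)^{-1})$,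 and $R_z(x,y)=\frac{i}{2}\big(Z(z)+\mathrm{sgn}(x-y)\sigma_1\big)e^{ik(z)|x-y|}$. Algebraic multiplicity and isolated eigenvalues are in the usual sense for closed operators. *)

theory Defs
  imports "HOL-Analysis.Analysis"
begin

type_synonym cvec2 = "complex ^ 2"
type_synonym cmat2 = "complex ^ 2 ^ 2"

definition sigma0 :: cmat2 where "sigma0 = mat 1"
definition sigma1 :: cmat2 where "sigma1 = (\<chi> i j. if i = j then 0 else 1)"
definition sigma3 :: cmat2 where
  "sigma3 = (\<chi> i j. if i \<noteq> j then 0 else if i = 1 then 1 else -1)"

definition cut_set :: "real \<Rightarrow> complex set" where
  "cut_set m = {z. Im z = 0 \<and> \<bar>Re z\<bar> \<ge> \<bar>m\<bar>}"

text \<open>Branch of the square root with Im sqrt w > 0 for w outside [0,+inf)\<close>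
definition bsqrt :: "complex \<Rightarrow> complex" where
  "bsqrt w = (THE s. s ^ 2 = w \<and> Im s > 0)"

definition kk :: "real \<Rightarrow> complex \<Rightarrow> complex" where
  "kk m z = bsqrt (z ^ 2 - (complex_of_real m) ^ 2)"

definition zeta :: "real \<Rightarrow> complex \<Rightarrow> complex" where
  "zeta m z = (z + complex_of_real m) / kk m z"

definition ZZ :: "real \<Rightarrow> complex \<Rightarrow> cmat2" where
  "ZZ m z = (\<chi> i j. if i \<noteq> j then 0 else if i = 1 then zeta m z else inverse (zeta m z))"

definition MM :: "real \<Rightarrow> cmat2 \<Rightarrow> complex \<Rightarrow> cmat2" where
  "MM m A z = sigma0 + mat (\<i> / 2) ** A ** ZZ m z"

text \<open>Free resolvent kernel R_z(x,y)\<close>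
definition RR :: "real \<Rightarrow> complex \<Rightarrow> real \<Rightarrow> real \<Rightarrow> cmat2" where
  "RR m z x y = (\<chi> i j. (\<i> / 2) * ((ZZ m z) $ i $ j + complex_of_real (sgn (x - y)) * sigma1 $ i $ j)
        * exp (\<i> * kk m z * complex_of_real \<bar>x - y\<bar>))"

text \<open>L^2(R; C^2): square-integrable Borel functions (elements considered modulo a.e. equality)\<close>
definition L2 :: "(real \<Rightarrow> cvec2) \<Rightarrow> bool" where
  "L2 f \<longleftrightarrow> f \<in> borel_measurable lborel \<and> integrable lborel (\<lambda>x. (norm (f x))\<^sup>2)"

definition L2norm :: "(real \<Rightarrow> cvec2) \<Rightarrow> real" where
  "L2norm f = sqrt (\<integral>x. (norm (f x))\<^sup>2 \<partial>lborel)"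

text \<open>psi is in H^1(R_-) (+) H^1(R_+): g is a representative of psi which on each open half-line
  is (locally absolutely) continuous with L^2 derivative d\<close>
definition H1_split :: "(real \<Rightarrow> cvec2) \<Rightarrow> (real \<Rightarrow> cvec2) \<Rightarrow> (real \<Rightarrow> cvec2) \<Rightarrow> bool" where
  "H1_split \<psi> g d \<longleftrightarrow> L2 \<psi> \<and> L2 d \<and> (AE x in lborel. \<psi> x = g x)
     \<and> continuous_on {0<..} g \<and> continuous_on {..<0} g
     \<and> (\<forall>a b. 0 < a \<longrightarrow> a \<le> b \<longrightarrow> (d has_integral (g b - g a)) {a..b})
     \<and> (\<forall>a b. a \<le> b \<longrightarrow> b < 0 \<longrightarrow> (d has_integral (g b - g a)) {a..b})"

text \<open>Graph of D_A: dirac_graph m A psi phi means psi \<in> dom(D_A) and D_A psi = phi (a.e.)\<close>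
definition dirac_graph :: "real \<Rightarrow> cmat2 \<Rightarrow> (real \<Rightarrow> cvec2) \<Rightarrow> (real \<Rightarrow> cvec2) \<Rightarrow> bool" where
  "dirac_graph m A \<psi> \<phi> \<longleftrightarrow> (\<exists>g d gp gm. H1_split \<psi> g d
      \<and> (g \<longlongrightarrow> gp) (at_right 0) \<and> (g \<longlongrightarrow> gm) (at_left 0)
      \<and> (mat (2 * \<i>) ** sigma1 - A) *v gp = (mat (2 * \<i>) ** sigma1 + A) *v gm
      \<and> (AE x in lborel. \<phi> x = (mat (- \<i>) ** sigma1) *v d x + (mat (complex_of_real m) ** sigma3) *v \<psi> x))"

text \<open>Resolvent set: D_A - z is a bijection of dom(D_A) onto L^2 with bounded inverse\<close>
definition resolvent_set :: "real \<Rightarrow> cmat2 \<Rightarrow> complex set" where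
  "resolvent_set m A = {z. (\<forall>f. L2 f \<longrightarrow> (\<exists>\<psi>. dirac_graph m A \<psi> (\<lambda>x. f x + z *s \<psi> x)))
       \<and> (\<exists>C. \<forall>f \<psi>. L2 f \<longrightarrow> dirac_graph m A \<psi> (\<lambda>x. f x + z *s \<psi> x) \<longrightarrow> L2norm \<psi> \<le> C * L2norm f)}"

definition spectrum_D :: "real \<Rightarrow> cmat2 \<Rightarrow> complex set" where
  "spectrum_D m A = UNIV - resolvent_set m A"

definition eigenspace_D :: "real \<Rightarrow> cmat2 \<Rightarrow> complex \<Rightarrow> (real \<Rightarrow> cvec2) set" where
  "eigenspace_D m A z = {\<psi>. dirac_graph m A \<psi> (\<lambda>x. z *s \<psi> x)}"

definition point_spectrum :: "real \<Rightarrow> cmat2 \<Rightarrow> complex set" where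
  "point_spectrum m A = {z. \<exists>\<psi>\<in>eigenspace_D m A z. \<not> (AE x in lborel. \<psi> x = 0)}"

text \<open>ker (D_A - z)^k, with psi in L^2\<close>
fun gen_eig :: "real \<Rightarrow> cmat2 \<Rightarrow> complex \<Rightarrow> nat \<Rightarrow> (real \<Rightarrow> cvec2) \<Rightarrow> bool" where
  "gen_eig m A z 0 \<psi> = (L2 \<psi> \<and> (AE x in lborel. \<psi> x = 0))"
| "gen_eig m A z (Suc k) \<psi> = (\<exists>\<phi>. gen_eig m A z k \<phi> \<and> dirac_graph m A \<psi> (\<lambda>x. z *s \<psi> x + \<phi> x))"

definition root_space :: "real \<Rightarrow> cmat2 \<Rightarrow> complex \<Rightarrow> (real \<Rightarrow> cvec2) set" where
  "root_space m A z = {\<psi>. \<exists>k. gen_eig m A z k \<psi>}"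

definition ae_cdim :: "(real \<Rightarrow> cvec2) set \<Rightarrow> nat \<Rightarrow> bool" where
  "ae_cdim V n \<longleftrightarrow> (\<exists>b :: nat \<Rightarrow> real \<Rightarrow> cvec2. (\<forall>i<n. b i \<in> V)
     \<and> (\<forall>c. (AE x in lborel. (\<Sum>i<n. c i *s b i x) = 0) \<longrightarrow> (\<forall>i<n. c i = 0))
     \<and> (\<forall>v\<in>V. \<exists>c. AE x in lborel. v x = (\<Sum>i<n. c i *s b i x)))"

definition vec_cdim :: "cvec2 set \<Rightarrow> nat \<Rightarrow> bool" where
  "vec_cdim V n \<longleftrightarrow> (\<exists>b :: nat \<Rightarrow> cvec2. (\<forall>i<n. b i \<in> V)
     \<and> (\<forall>c. (\<Sum>i<n. c i *s b i) = 0 \<longrightarrow> (\<forall>i<n. c i = 0))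
     \<and> (\<forall>v\<in>V. \<exists>c. v = (\<Sum>i<n. c i *s b i)))"

definition res_kernel :: "real \<Rightarrow> cmat2 \<Rightarrow> complex \<Rightarrow> real \<Rightarrow> real \<Rightarrow> cmat2" where
  "res_kernel m A z x y = RR m z x y - RR m z x 0 ** matrix_inv (MM m A z) ** A ** RR m z 0 y"

end

(*
  Off the cut, the combinations g1 + zeta g2 and g1 - zeta g2 diagonalise the equation (D - z) g = f on
  each half-line into u' = i k u + F and u' = - i k u + G with Im k > 0, so a square-integrable solution
  is the free solution plus Tsol v for some v in C^2, and the transmission condition becomes
  M(z) v = A h, where h is the value of the free solution at 0.  Thus eigenfunctions are the Tsol v with
  M(z) v = 0, and otherwise v = M(z)^{-1} A h gives the resolvent, bounded by Young's inequality.  On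
  the cut k is real (or zero): homogeneous solutions are not square integrable, but their truncations
  form singular sequences.  Multiplicities are finite because zeta det M is quadratic in the local
  coordinate zeta: the resolvent norm grows at most like |w - z|^{-2} near an isolated eigenvalue z, which
  limits the length of Jordan chains to two.
*)
theory Submission
  imports Defs
begin

section \<open>Square-integrable functions and the scalar first-order equation\<close>

text \<open>The right-hand side f is only square integrable, so the differential equations are
  stated in integrated form. Solutions built from convolutions are continuous and defined
  everywhere, hence their traces at 0 are plain limits. The matrix M comes from writing the
  transmission condition as 2i \<sigma>1 (jump) = A (sum of traces). The ansatz free solution plus c
  Tsol v has \<sigma>1 (jump) = 2 c v and sum 2 h + 2 c Z v, which gives 2 i c M v = A h. The
  resolvent takes c = -i/2, so that 2 i c = 1. The truncated waves on the cut live on the right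
  half-line and vanish at 0, so they satisfy the transmission condition for every A. Algebraic
  multiplicity is treated without contour integrals: a chain of length three at z would yield an
  approximate eigenfunction at w with error of order |w - z|^3, too small for a resolvent of order
  at most |w - z|^-2. Matrices for which det M vanishes on an open set are excluded because z is
  isolated in the spectrum.\<close>

definition sqint :: "(real \<Rightarrow> complex) \<Rightarrow> bool" where
  "sqint h \<longleftrightarrow> h \<in> borel_measurable borel \<and> integrable lborel (\<lambda>x. (norm (h x))\<^sup>2)"

text \<open>The squared norm, polymorphic so that it serves scalar components and vector functions
  alike; without the root, the components simply add up (\<open>sqnorm_vec\<close>).\<close>

definition sqnorm :: "(real \<Rightarrow> 'a::real_normed_vector) \<Rightarrow> real" where
  "sqnorm h = (\<integral>x. (norm (h x))\<^sup>2 \<partial>lborel)"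

lemma sqnorm_nonneg: "0 \<le> sqnorm h"
  unfolding sqnorm_def by (simp add: integral_nonneg_AE)

lemma sqint_measurable [measurable_dest]: "sqint h \<Longrightarrow> h \<in> borel_measurable borel"
  by (simp add: sqint_def)

lemma sqint_integrable: "sqint h \<Longrightarrow> integrable lborel (\<lambda>x. (norm (h x))\<^sup>2)"
  by (simp add: sqint_def)

lemma norm_add_sq_le: "(norm (a + b))\<^sup>2 \<le> 2 * (norm a)\<^sup>2 + 2 * (norm (b::'a::real_normed_vector))\<^sup>2"
proof -
  have "(norm (a + b))\<^sup>2 \<le> (norm a + norm b)\<^sup>2"
    by (simp add: norm_triangle_ineq power_mono)
  also have "\<dots> \<le> 2 * (norm a)\<^sup>2 + 2 * (norm b)\<^sup>2"
    using sum_squares_bound[of "norm a" "norm b"] by (simp add: power2_sum)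
  finally show ?thesis .
qed

lemma sqint_add:
  assumes "sqint f" "sqint g"
  shows "sqint (\<lambda>x. f x + g x)"
proof -
  have "integrable lborel (\<lambda>x. (norm (f x + g x))\<^sup>2)"
  proof (rule Bochner_Integration.integrable_bound)
    show "integrable lborel (\<lambda>x. 2 * (norm (f x))\<^sup>2 + 2 * (norm (g x))\<^sup>2)"
      using assms by (auto simp: sqint_def)
  qed (use assms in \<open>auto simp: sqint_def intro!: order_trans[OF norm_add_sq_le]\<close>)
  then show ?thesis using assms by (auto simp: sqint_def)
qed

lemma sqint_mult_const:
  assumes "sqint f"
  shows "sqint (\<lambda>x. c * f x)"
  using assms by (auto simp: sqint_def norm_mult power_mult_distrib)

lemma sqint_bound:
  assumes "sqint f" "g \<in> borel_measurable borel" "\<And>x. norm (g x) \<le> norm (f x)"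
  shows "sqint g"
proof -
  have "integrable lborel (\<lambda>x. (norm (g x))\<^sup>2)"
    by (rule Bochner_Integration.integrable_bound[OF sqint_integrable[OF assms(1)]])
      (use assms in \<open>auto intro!: power_mono\<close>)
  then show ?thesis using assms by (auto simp: sqint_def)
qed

lemma sqint_zero: "sqint (\<lambda>x. 0)"
  by (simp add: sqint_def)

lemma sqint_uminus: "sqint f \<Longrightarrow> sqint (\<lambda>x. - f x)"
  using sqint_mult_const[of f "-1"] by simp

lemma sqint_diff: "sqint f \<Longrightarrow> sqint g \<Longrightarrow> sqint (\<lambda>x. f x - g x)"
  using sqint_add[of f "\<lambda>x. - g x"] sqint_uminus[of g] by simp

lemma sqint_reflect:
  assumes "sqint f"
  shows "sqint (\<lambda>x. f (- x))"
proof -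
  have [measurable]: "f \<in> borel_measurable borel" using assms by (simp add: sqint_def)
  have "integrable lborel (\<lambda>x. (norm (f (0 + (-1) * x)))\<^sup>2)"
    by (rule lborel_integrable_real_affine[OF sqint_integrable[OF assms]]) simp
  then show ?thesis by (auto simp: sqint_def)
qed

lemma sqnorm_reflect:
  fixes f :: "real \<Rightarrow> complex"
  shows "sqnorm (\<lambda>x. f (- x)) = sqnorm f"
  using lborel_integral_real_affine[of "-1" "\<lambda>x. (norm (f x))\<^sup>2" 0]
  by (simp add: sqnorm_def)

lemma AE_lborel_reflect:
  assumes "AE x in lborel. P (x::real)"
  shows "AE x in lborel. P (- x)"
proof -
  have "AE x in distr lborel borel (uminus :: real \<Rightarrow> real). P x"
    unfolding lborel_distr_uminus by (rule assms)
  from AE_distrD[OF _ this] show ?thesis by simp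
qed

section \<open>Convolution with the fundamental solution of \<open>u' = i k u\<close> supported on
  the right half-line\<close>

definition ekern :: "complex \<Rightarrow> real \<Rightarrow> complex" where
  "ekern k t = indicator {0<..} t * exp (\<i> * k * of_real t)"

lemma ekern_measurable [measurable]: "ekern k \<in> borel_measurable borel"
  unfolding ekern_def by measurable

lemma norm_ekern: "norm (ekern k t) = indicator {0<..} t * exp (- Im k * t)"
  by (auto simp: ekern_def indicator_def norm_mult)

lemma norm_ekern_le_1:
  assumes "Im k > 0"
  shows "norm (ekern k t) \<le> 1"
  using assms by (auto simp: norm_ekern indicator_def)

text \<open>The L1 norm of the kernel, which is the constant in Young's inequality for
  \<open>volt\<close>.\<close>

lemma nn_integral_norm_ekern:
  assumes "Im k > 0"
  shows "(\<integral>\<^sup>+t. ennreal (norm (ekern k t)) \<partial>lborel) = ennreal (1 / Im k)"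
proof -
  have lim: "((\<lambda>t. - exp (- Im k * t) / Im k) \<longlongrightarrow> 0) at_top"
  proof -
    have "filterlim (\<lambda>t. Im k * t) at_top at_top"
      using assms by (intro filterlim_tendsto_pos_mult_at_top[OF tendsto_const _ filterlim_ident])
    then have "((\<lambda>t. exp (- (Im k * t))) \<longlongrightarrow> 0) at_top"
      by (intro filterlim_compose[OF exp_at_bot]) (simp add: filterlim_uminus_at_top)
    from tendsto_divide[OF tendsto_minus[OF this] tendsto_const[of "Im k"]] show ?thesis
      using assms by simp
  qed
  have "(\<integral>\<^sup>+t. ennreal (norm (ekern k t)) \<partial>lborel)
      = (\<integral>\<^sup>+t. ennreal (exp (- Im k * t)) * indicator {0..} t \<partial>lborel)"
    by (intro nn_integral_cong_AE, rule AE_mp[OF AE_lborel_singleton[of 0]])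
      (auto simp: norm_ekern indicator_def)
  also have "\<dots> = ennreal (0 - (- exp (- Im k * 0) / Im k))"
    by (rule nn_integral_FTC_atLeast) (use assms lim in \<open>auto intro!: derivative_eq_intros\<close>)
  finally show ?thesis by simp
qed

lemma nn_integral_norm_ekern_left:
  assumes "Im k > 0"
  shows "(\<integral>\<^sup>+x. ennreal (norm (ekern k (x - y))) \<partial>lborel) = ennreal (1 / Im k)"
  using nn_integral_real_affine[of "\<lambda>t. ennreal (norm (ekern k t))" 1 "- y"]
  by (simp add: nn_integral_norm_ekern[OF assms])

lemma nn_integral_norm_ekern_right:
  assumes "Im k > 0"
  shows "(\<integral>\<^sup>+y. ennreal (norm (ekern k (x - y))) \<partial>lborel) = ennreal (1 / Im k)"
  using nn_integral_real_affine[of "\<lambda>t. ennreal (norm (ekern k t))" "-1" "x"]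
  by (simp add: nn_integral_norm_ekern[OF assms])

lemma integrable_norm_ekern_right:
  assumes "Im k > 0"
  shows "integrable lborel (\<lambda>y. norm (ekern k (x - y)))"
    and "(\<integral>y. norm (ekern k (x - y)) \<partial>lborel) = 1 / Im k"
proof -
  have "has_bochner_integral lborel (\<lambda>y. norm (ekern k (x - y))) (1 / Im k)"
    by (rule has_bochner_integral_nn_integral)
      (use assms nn_integral_norm_ekern_right[OF assms, of x] in auto)
  then show "integrable lborel (\<lambda>y. norm (ekern k (x - y)))"
    "(\<integral>y. norm (ekern k (x - y)) \<partial>lborel) = 1 / Im k"
    by (auto simp: has_bochner_integral_iff)
qed

text \<open>The solution of \<open>u' = i k u + F\<close> that stays square integrable at \<open>-\<infinity>\<close>.\<close>
definition volt :: "complex \<Rightarrow> (real \<Rightarrow> complex) \<Rightarrow> real \<Rightarrow> complex" where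
  "volt k F x = (\<integral>y. ekern k (x - y) * F y \<partial>lborel)"

lemma volt_measurable [measurable]:
  assumes [measurable]: "F \<in> borel_measurable borel"
  shows "volt k F \<in> borel_measurable borel"
  unfolding volt_def by measurable

text \<open>Stands in for Cauchy-Schwarz where mere integrability is wanted: |F| is dominated by a
  constant plus |F|^2, on a set of finite measure or under an integrable weight.\<close>

lemma le_half_sq: "(t::real) \<le> (1 + t\<^sup>2) / 2"
  using sum_squares_bound[of t 1] by simp

text \<open>With \<open>e = norm (ekern k (x - y)) \<le> 1\<close>, the splitting
  \<open>e * t \<le> (e + t^2) / 2\<close> dominates the integrand. The third bound is free of x,
  which is what the application of Fubini in \<open>volt_has_integral\<close> needs.\<close>

lemma volt_integrable:
  assumes k: "Im k > 0" and F: "sqint F"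
  shows "integrable lborel (\<lambda>y. norm (ekern k (x - y)) * (norm (F y))\<^sup>2)"
    and "integrable lborel (\<lambda>y. ekern k (x - y) * F y)"
    and "(\<integral>y. norm (ekern k (x - y) * F y) \<partial>lborel) \<le> (1 / Im k + sqnorm F) / 2"
proof -
  note [measurable] = sqint_measurable[OF F]
  have e1: "norm (ekern k t) * s \<le> s" if "s \<ge> 0" for t s
    using norm_ekern_le_1[OF k, of t] that by (simp add: mult_left_le_one_le)
  show *: "integrable lborel (\<lambda>y. norm (ekern k (x - y)) * (norm (F y))\<^sup>2)"
    by (rule Bochner_Integration.integrable_bound[OF sqint_integrable[OF F]]) (auto intro!: e1)
  have b: "norm (ekern k (x - y) * F y)
    \<le> (norm (ekern k (x - y)) + (norm (F y))\<^sup>2) / 2" for y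
  proof -
    have "norm (ekern k (x - y) * F y) \<le> norm (ekern k (x - y)) * ((1 + (norm (F y))\<^sup>2) / 2)"
      unfolding norm_mult by (intro mult_left_mono le_half_sq) auto
    also have "\<dots> = (norm (ekern k (x - y)) + norm (ekern k (x - y)) * (norm (F y))\<^sup>2) / 2"
      by (simp add: algebra_simps)
    finally show ?thesis using e1[of "(norm (F y))\<^sup>2" "x - y"] by simp
  qed
  have i: "integrable lborel (\<lambda>y. (norm (ekern k (x - y)) + (norm (F y))\<^sup>2) / 2)"
    using integrable_norm_ekern_right[OF k] sqint_integrable[OF F] by auto
  show **: "integrable lborel (\<lambda>y. ekern k (x - y) * F y)"
  proof (rule Bochner_Integration.integrable_bound[OF i])
    show "AE y in lborel. norm (ekern k (x - y) * F y)
        \<le> norm ((norm (ekern k (x - y)) + (norm (F y))\<^sup>2) / 2)"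
      by (rule AE_I2, rule order_trans[OF b]) simp
  qed measurable
  have "(\<integral>y. norm (ekern k (x - y) * F y) \<partial>lborel)
      \<le> (\<integral>y. (norm (ekern k (x - y)) + (norm (F y))\<^sup>2) / 2 \<partial>lborel)"
    using b by (intro integral_mono i integrable_norm **) auto
  also have "\<dots> = (1 / Im k + sqnorm F) / 2"
    using integrable_norm_ekern_right[OF k, of x] sqint_integrable[OF F] by (simp add: sqnorm_def)
  finally show "(\<integral>y. norm (ekern k (x - y) * F y) \<partial>lborel) \<le> (1 / Im k + sqnorm F) / 2" .
qed

text \<open>Cauchy-Schwarz against the probability density \<open>\<kappa> |e\<^bsup>ik(x-y)\<^esup>|\<close>, \<open>\<kappa> = Im k\<close>: the variance
  is nonnegative.\<close>
lemma volt_pointwise: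
  assumes k: "Im k > 0" and F: "sqint F"
  shows "(norm (volt k F x))\<^sup>2
    \<le> (\<integral>y. norm (ekern k (x - y)) * (norm (F y))\<^sup>2 \<partial>lborel) / Im k"
proof -
  define I where "I = (\<integral>y. norm (ekern k (x - y)) * norm (F y) \<partial>lborel)"
  define J where "J = (\<integral>y. norm (ekern k (x - y)) * (norm (F y))\<^sup>2 \<partial>lborel)"
  \<comment> \<open>The mean of \<open>norm (F y)\<close> with respect to the probability density
    \<open>Im k * norm (ekern k (x - y))\<close>.\<close>
  define c where "c = Im k * I"
  note i = volt_integrable[OF k F, of x] integrable_norm_ekern_right[OF k, of x]
  have i2: "integrable lborel (\<lambda>y. norm (ekern k (x - y)) * norm (F y))"
    using integrable_norm[OF i(2)] by (simp add: norm_mult)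
  have "0 \<le> (\<integral>y. norm (ekern k (x - y)) * (norm (F y) - c)\<^sup>2 \<partial>lborel)"
    by (intro integral_nonneg_AE) auto
  also have "\<dots> = (\<integral>y. norm (ekern k (x - y)) * (norm (F y))\<^sup>2
      - 2 * c * (norm (ekern k (x - y)) * norm (F y)) + c\<^sup>2 * norm (ekern k (x - y)) \<partial>lborel)"
    by (simp add: power2_diff algebra_simps)
  also have "\<dots> = J - 2 * c * I + c\<^sup>2 * (1 / Im k)"
    using i i2 by (simp add: I_def J_def)
  also have "\<dots> = J - Im k * I\<^sup>2"
    using k by (simp add: c_def power2_eq_square field_simps)
  finally have "I\<^sup>2 \<le> J / Im k" using k by (simp add: field_simps)
  moreover have "norm (volt k F x) \<le> I"
    unfolding volt_def I_def norm_mult[symmetric] by (rule integral_norm_bound)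
  then have "(norm (volt k F x))\<^sup>2 \<le> I\<^sup>2" by (intro power_mono) auto
  ultimately show ?thesis by (simp add: J_def)
qed

text \<open>A pointwise bound is needed besides the norm bound because the coefficient of the
  correction term in the resolvent depends on the value of the free solution at 0.\<close>

lemma volt_bound:
  assumes k: "Im k > 0" and F: "sqint F"
  shows "(norm (volt k F x))\<^sup>2 \<le> sqnorm F / Im k"
proof -
  have "(\<integral>y. norm (ekern k (x - y)) * (norm (F y))\<^sup>2 \<partial>lborel) \<le> sqnorm F"
    unfolding sqnorm_def
    by (intro integral_mono volt_integrable[OF k F] sqint_integrable[OF F])
      (use norm_ekern_le_1[OF k] in \<open>auto intro!: mult_left_le_one_le\<close>)
  then show ?thesis
    using volt_pointwise[OF k F, of x] k by (meson divide_right_mono less_imp_le order_trans)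
qed

text \<open>Young's inequality in squared form: one factor \<open>1 / Im k\<close> comes from
  Cauchy-Schwarz in y (\<open>volt_pointwise\<close>), the other from integrating the kernel in x
  after Tonelli.\<close>

lemma volt_sqint:
  assumes k: "Im k > 0" and F: "sqint F"
  shows "sqint (volt k F)" and "sqnorm (volt k F) \<le> sqnorm F / (Im k)\<^sup>2"
proof -
  note [measurable] = sqint_measurable[OF F]
  have "(\<integral>\<^sup>+x. ennreal ((norm (volt k F x))\<^sup>2) \<partial>lborel)
      \<le> (\<integral>\<^sup>+x. ennreal (1 / Im k) *
          (\<integral>\<^sup>+y. ennreal (norm (ekern k (x - y))) * ennreal ((norm (F y))\<^sup>2) \<partial>lborel) \<partial>lborel)"
  proof (rule nn_integral_mono)
    fix x
    have "ennreal ((norm (volt k F x))\<^sup>2)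
        \<le> ennreal (1 / Im k * (\<integral>y. norm (ekern k (x - y)) * (norm (F y))\<^sup>2 \<partial>lborel))"
      using volt_pointwise[OF k F, of x] by (intro ennreal_leI) simp
    also have "\<dots> = ennreal (1 / Im k) *
        ennreal (\<integral>y. norm (ekern k (x - y)) * (norm (F y))\<^sup>2 \<partial>lborel)"
      using k by (intro ennreal_mult) (auto intro!: integral_nonneg_AE)
    also have "ennreal (\<integral>y. norm (ekern k (x - y)) * (norm (F y))\<^sup>2 \<partial>lborel)
        = (\<integral>\<^sup>+y. ennreal (norm (ekern k (x - y)) * (norm (F y))\<^sup>2) \<partial>lborel)"
      by (rule nn_integral_eq_integral[symmetric, OF volt_integrable(1)[OF k F]]) auto
    finally show "ennreal ((norm (volt k F x))\<^sup>2) \<le> ennreal (1 / Im k) *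
        (\<integral>\<^sup>+y. ennreal (norm (ekern k (x - y))) * ennreal ((norm (F y))\<^sup>2) \<partial>lborel)"
      by (simp add: ennreal_mult)
  qed
  also have "\<dots> = ennreal (1 / Im k) * (\<integral>\<^sup>+x. \<integral>\<^sup>+y. ennreal (norm (ekern k (x - y)))
      * ennreal ((norm (F y))\<^sup>2) \<partial>lborel \<partial>lborel)"
    by (rule nn_integral_cmult) measurable
  also have "(\<integral>\<^sup>+x. \<integral>\<^sup>+y. ennreal (norm (ekern k (x - y))) * ennreal ((norm (F y))\<^sup>2) \<partial>lborel \<partial>lborel)
      = (\<integral>\<^sup>+y. \<integral>\<^sup>+x. ennreal (norm (ekern k (x - y))) * ennreal ((norm (F y))\<^sup>2) \<partial>lborel \<partial>lborel)"
    by (rule lborel_pair.Fubini') measurable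
  also have "\<dots> = (\<integral>\<^sup>+y. ennreal (1 / Im k) * ennreal ((norm (F y))\<^sup>2) \<partial>lborel)"
    by (subst nn_integral_multc) (auto simp: nn_integral_norm_ekern_left[OF k])
  also have "\<dots> = ennreal (1 / Im k) * (\<integral>\<^sup>+y. ennreal ((norm (F y))\<^sup>2) \<partial>lborel)"
    by (rule nn_integral_cmult) measurable
  also have "(\<integral>\<^sup>+y. ennreal ((norm (F y))\<^sup>2) \<partial>lborel) = ennreal (sqnorm F)"
    unfolding sqnorm_def by (rule nn_integral_eq_integral[OF sqint_integrable[OF F]]) auto
  finally have le: "(\<integral>\<^sup>+x. ennreal ((norm (volt k F x))\<^sup>2) \<partial>lborel) \<le> ennreal (sqnorm F / (Im k)\<^sup>2)"
    using k by (simp add: ennreal_mult[symmetric] sqnorm_nonneg power2_eq_square)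
  have "integrable lborel (\<lambda>x. (norm (volt k F x))\<^sup>2)"
    by (rule integrableI_bounded) (use le in \<open>auto simp: order_le_less_trans\<close>)
  then show "sqint (volt k F)" by (simp add: sqint_def)
  have "ennreal (sqnorm (volt k F)) = (\<integral>\<^sup>+x. ennreal ((norm (volt k F x))\<^sup>2) \<partial>lborel)"
    unfolding sqnorm_def
    by (rule nn_integral_eq_integral[symmetric, OF \<open>integrable lborel (\<lambda>x. (norm (volt k F x))\<^sup>2)\<close>]) auto
  with le have "ennreal (sqnorm (volt k F)) \<le> ennreal (sqnorm F / (Im k)\<^sup>2)" by simp
  then show "sqnorm (volt k F) \<le> sqnorm F / (Im k)\<^sup>2"
    by (subst (asm) ennreal_le_iff) (simp_all add: sqnorm_nonneg)
qed

section \<open>The convolution solves the scalar equation in integrated form\<close>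

lemma integrable_indicator_Icc: "integrable lborel (indicat_real {a..b::real})"
  by (intro integrable_real_indicator) (auto simp: emeasure_lborel_Icc_eq)

lemma sqint_set_integrable:
  assumes "sqint F"
  shows "set_integrable lborel {a..b} F"
proof -
  note [measurable] = sqint_measurable[OF assms]
  have i: "integrable lborel (\<lambda>y. (indicator {a..b} y + (norm (F y))\<^sup>2) / 2)"
    using sqint_integrable[OF assms] integrable_indicator_Icc[of a b] by simp
  show ?thesis unfolding set_integrable_def
  proof (rule Bochner_Integration.integrable_bound[OF i])
    show "AE x in lborel. norm (indicat_real {a..b} x *\<^sub>R F x)
        \<le> norm ((indicat_real {a..b} x + (norm (F x))\<^sup>2) / 2)"
      using le_half_sq by (auto simp: indicator_def)
  qed measurable
qed

lemma sqint_has_integral: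
  assumes "sqint F"
  shows "(F has_integral (LINT x:{a..b}|lborel. F x)) {a..b}"
  using set_borel_integral_eq_integral[OF sqint_set_integrable[OF assms, of a b]]
  by (metis integrable_integral)

text \<open>The distributional derivative of \<open>ekern k\<close> is \<open>i k ekern k\<close>
  plus a unit mass at 0. Integrating over \<open>{a..b}\<close> therefore misses 1 exactly when the
  jump point y lies in the interval; the half-open indicator matches the value
  \<open>ekern k 0 = 0\<close>.\<close>

lemma ekern_derivative_integral:
  assumes "a \<le> b"
  shows "(\<integral>x. indicator {a..b} x *\<^sub>R (\<i> * k * ekern k (x - y)) \<partial>lborel)
    = ekern k (b - y) - ekern k (a - y) - indicator {a..<b} y"
proof (cases "y < b")
  case False
  have "(\<integral>x. indicator {a..b} x *\<^sub>R (\<i> * k * ekern k (x - y)) \<partial>lborel) = (\<integral>(x::real). 0 \<partial>lborel)"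
    by (rule Bochner_Integration.integral_cong) (use False in \<open>auto simp: ekern_def indicator_def\<close>)
  then show ?thesis using False assms by (auto simp: ekern_def)
next
  case True
  \<comment> \<open>Only x > y contributes, so the integration effectively starts at the larger of a
    and y, where the integrand is a smooth exponential.\<close>
  define c where "c = max a y"
  have c: "c \<le> b" using True assms by (simp add: c_def)
  have "(\<integral>x. indicator {a..b} x *\<^sub>R (\<i> * k * ekern k (x - y)) \<partial>lborel)
      = (\<integral>x. indicator {c..b} x *\<^sub>R (\<i> * k * exp (\<i> * k * of_real (x - y))) \<partial>lborel)"
  proof (rule integral_cong_AE)
    show "AE x in lborel. indicat_real {a..b} x *\<^sub>R (\<i> * k * ekern k (x - y))
        = indicat_real {c..b} x *\<^sub>R (\<i> * k * exp (\<i> * k * of_real (x - y)))"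
      using AE_lborel_singleton[of y]
      by eventually_elim (auto simp: ekern_def indicator_def c_def)
  qed measurable
  also have "\<dots> = exp (\<i> * k * of_real (b - y)) - exp (\<i> * k * of_real (c - y))"
    by (rule integral_FTC_atLeastAtMost[OF c])
      (auto intro!: derivative_eq_intros continuous_intros has_vector_derivative_real_field
        simp: algebra_simps)
  finally show ?thesis using True assms
    by (auto simp: ekern_def indicator_def c_def max_def split: if_splits)
qed

text \<open>The identity for the kernel is integrated against F and the order of integration
  exchanged; the jump of the kernel becomes the source term, the integral of F over
  \<open>{a..b}\<close>.\<close>

lemma volt_has_integral:
  assumes k: "Im k > 0" and F: "sqint F" and ab: "a \<le> b"
  shows "((\<lambda>x. \<i> * k * volt k F x + F x) has_integral (volt k F b - volt k F a)) {a..b}"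
proof -
  note [measurable] = sqint_measurable[OF F]
  define h where "h = (\<lambda>x y. indicator {a..b} x *\<^sub>R (\<i> * k * ekern k (x - y)) * F y)"
  have h_eq: "h x y = (indicator {a..b} x *\<^sub>R (\<i> * k)) * (ekern k (x - y) * F y)" for x y
    by (simp add: h_def)
  have [measurable]: "case_prod h \<in> borel_measurable (borel \<Otimes>\<^sub>M borel)"
    unfolding h_def by measurable
  have "integrable (lborel \<Otimes>\<^sub>M lborel) (case_prod h)"
  proof (rule lborel_pair.Fubini_integrable)
    show "AE x in lborel. integrable lborel (\<lambda>y. case_prod h (x, y))"
      using volt_integrable(2)[OF k F] by (simp add: h_eq)
    show "integrable lborel (\<lambda>x. \<integral>y. norm (case_prod h (x, y)) \<partial>lborel)"
    proof (rule Bochner_Integration.integrable_bound)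
      show "integrable lborel (\<lambda>x. indicator {a..b} x *\<^sub>R (norm k * ((1 / Im k + sqnorm F) / 2)))"
          by (intro integrable_scaleR_left integrable_indicator_Icc)
      show "AE x in lborel. norm (\<integral>y. norm (case_prod h (x, y)) \<partial>lborel)
        \<le> norm (indicator {a..b} x *\<^sub>R (norm k * ((1 / Im k + sqnorm F) / 2)))"
      proof (rule AE_I2)
        fix x
        have nn: "0 \<le> (\<integral>y. norm (ekern k (x - y) * F y) \<partial>lborel)"
          by (intro integral_nonneg_AE) auto
        have "(\<integral>y. norm (case_prod h (x, y)) \<partial>lborel)
          = indicator {a..b} x * norm k * (\<integral>y. norm (ekern k (x - y) * F y) \<partial>lborel)"
          unfolding integral_mult_right_zero[symmetric]
          by (rule Bochner_Integration.integral_cong) (simp_all add: h_eq norm_mult)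
        then show "norm (\<integral>y. norm (case_prod h (x, y)) \<partial>lborel)
        \<le> norm (indicator {a..b} x *\<^sub>R (norm k * ((1 / Im k + sqnorm F) / 2)))"
          using mult_left_mono[OF volt_integrable(3)[OF k F, of x] norm_ge_zero[of k]] nn
            k sqnorm_nonneg[of F]
          by (auto simp: indicator_def abs_mult abs_of_nonneg[of "1 / Im k + sqnorm F"])
      qed
    qed measurable
  qed measurable
  then have sw: "(\<integral>x. \<integral>y. h x y \<partial>lborel \<partial>lborel) = (\<integral>y. \<integral>x. h x y \<partial>lborel \<partial>lborel)"
    by (rule lborel_pair.Fubini_integral[symmetric])
  have L: "(\<integral>x. \<integral>y. h x y \<partial>lborel \<partial>lborel) = (LINT x:{a..b}|lborel. \<i> * k * volt k F x)"
    unfolding set_lebesgue_integral_def volt_def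
    by (rule Bochner_Integration.integral_cong) (simp_all add: h_eq)
  have "(\<integral>y. \<integral>x. h x y \<partial>lborel \<partial>lborel)
      = (\<integral>y. ekern k (b - y) * F y - ekern k (a - y) * F y - indicator {a..<b} y *\<^sub>R F y \<partial>lborel)"
    unfolding h_def integral_mult_left_zero ekern_derivative_integral[OF ab]
    by (rule Bochner_Integration.integral_cong) (auto simp: algebra_simps indicator_def)
  also have "\<dots> = (\<integral>y. ekern k (b - y) * F y - ekern k (a - y) * F y - indicator {a..b} y *\<^sub>R F y \<partial>lborel)"
  proof (rule integral_cong_AE)
    show "AE y in lborel. ekern k (b - y) * F y - ekern k (a - y) * F y - indicat_real {a..<b} y *\<^sub>R F y
        = ekern k (b - y) * F y - ekern k (a - y) * F y - indicat_real {a..b} y *\<^sub>R F y"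
      using AE_lborel_singleton[of b] by eventually_elim (auto simp: indicator_def)
  qed measurable
  also have "\<dots> = volt k F b - volt k F a - (LINT x:{a..b}|lborel. F x)"
    using volt_integrable(2)[OF k F] sqint_set_integrable[OF F, of a b]
    by (simp add: volt_def set_lebesgue_integral_def set_integrable_def)
  finally have *: "(LINT x:{a..b}|lborel. \<i> * k * volt k F x)
      = volt k F b - volt k F a - (LINT x:{a..b}|lborel. F x)"
    using sw L by simp
  have "((\<lambda>x. \<i> * k * volt k F x + F x) has_integral
      (LINT x:{a..b}|lborel. \<i> * k * volt k F x) + (LINT x:{a..b}|lborel. F x)) {a..b}"
    by (intro has_integral_add sqint_has_integral sqint_mult_const volt_sqint k F)
  then show ?thesis unfolding * diff_add_cancel .
qed

text \<open>Continuity is read off the integral equation: near each point u is a constant plus an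
  indefinite integral.\<close>

lemma continuous_on_if_has_integral:
  fixes u d :: "real \<Rightarrow> complex"
  assumes "\<And>a b. a \<le> b \<Longrightarrow> (d has_integral (u b - u a)) {a..b}"
  shows "continuous_on UNIV u"
proof (rule continuous_on_eq_continuous_at[THEN iffD2, rule_format])
  fix x :: real
  have "continuous_on {x-1..x+1} (\<lambda>t. u (x-1) + integral {x-1..t} d)"
    by (intro continuous_intros indefinite_integral_continuous_1)
      (use assms[of "x-1" "x+1"] in \<open>auto simp: has_integral_integrable\<close>)
  then have "continuous_on {x-1..x+1} u"
    by (rule continuous_on_eq) (use integral_unique[OF assms] in auto)
  then show "isCont u x"
    by (rule continuous_on_interior) auto
qed simp

section \<open>The Dirac system on the half-lines\<close>

lemma norm_vec2_sq: "(norm (v :: cvec2))\<^sup>2 = (norm (v $ 1))\<^sup>2 + (norm (v $ 2))\<^sup>2"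
  by (simp add: norm_vec_def L2_set_def sum_2)

lemma vec2_eq_iff: "(v :: complex ^ 2) = w \<longleftrightarrow> v $ 1 = w $ 1 \<and> v $ 2 = w $ 2"
  by (simp add: vec_eq_iff forall_2)

lemma vec2_axis: "(v :: complex ^ 2) = axis 1 (v $ 1) + axis 2 (v $ 2)"
  by (simp add: vec2_eq_iff axis_def)

lemma bounded_linear_axis: "bounded_linear (axis i :: complex \<Rightarrow> complex ^ 2)"
  by (simp add: linear_conv_bounded_linear[symmetric] linear_iff vec_eq_iff axis_def)

lemma vec2_has_integral_iff:
  fixes d :: "real \<Rightarrow> complex ^ 2"
  shows "(d has_integral I) S \<longleftrightarrow> ((\<lambda>x. d x $ 1) has_integral I $ 1) S \<and> ((\<lambda>x. d x $ 2) has_integral I $ 2) S"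
proof
  assume "(d has_integral I) S"
  then show "((\<lambda>x. d x $ 1) has_integral I $ 1) S \<and> ((\<lambda>x. d x $ 2) has_integral I $ 2) S"
    by (auto dest: has_integral_linear[OF _ bounded_linear_vec_nth, unfolded o_def])
next
  assume "((\<lambda>x. d x $ 1) has_integral I $ 1) S \<and> ((\<lambda>x. d x $ 2) has_integral I $ 2) S"
  then have i: "((\<lambda>x. d x $ 1) has_integral I $ 1) S" "((\<lambda>x. d x $ 2) has_integral I $ 2) S"
    by auto
  have "((\<lambda>x. axis 1 (d x $ 1) + axis 2 (d x $ 2) :: complex ^ 2) has_integral (axis 1 (I $ 1) + axis 2 (I $ 2))) S"
    by (rule has_integral_add[OF has_integral_linear[OF i(1) bounded_linear_axis, unfolded o_def]
          has_integral_linear[OF i(2) bounded_linear_axis, unfolded o_def]])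
  then show "(d has_integral I) S" by (simp flip: vec2_axis)
qed

lemma vec2_tendsto_iff:
  fixes g :: "'a \<Rightarrow> complex ^ 2"
  shows "(g \<longlongrightarrow> l) F \<longleftrightarrow> ((\<lambda>x. g x $ 1) \<longlongrightarrow> l $ 1) F \<and> ((\<lambda>x. g x $ 2) \<longlongrightarrow> l $ 2) F"
proof
  assume "(g \<longlongrightarrow> l) F"
  then show "((\<lambda>x. g x $ 1) \<longlongrightarrow> l $ 1) F \<and> ((\<lambda>x. g x $ 2) \<longlongrightarrow> l $ 2) F"
    by (intro conjI tendsto_vec_nth)
next
  assume *: "((\<lambda>x. g x $ 1) \<longlongrightarrow> l $ 1) F \<and> ((\<lambda>x. g x $ 2) \<longlongrightarrow> l $ 2) F"
  have "((\<lambda>x. g x $ i) \<longlongrightarrow> l $ i) F" for i :: 2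
    using * exhaust_2[of i] by auto
  then show "(g \<longlongrightarrow> l) F" by (rule vec_tendstoI)
qed

lemma vec2_continuous_on_iff:
  fixes g :: "real \<Rightarrow> complex ^ 2"
  shows "continuous_on S g \<longleftrightarrow> continuous_on S (\<lambda>x. g x $ 1) \<and> continuous_on S (\<lambda>x. g x $ 2)"
  unfolding continuous_on_def vec2_tendsto_iff by blast

lemma L2_iff: "L2 f \<longleftrightarrow> sqint (\<lambda>x. f x $ 1) \<and> sqint (\<lambda>x. f x $ 2)"
proof
  assume f: "L2 f"
  have cont: "continuous_on UNIV (\<lambda>v::cvec2. v $ i)" for i
    by (intro continuous_intros)
  have [measurable]: "(\<lambda>x. f x $ i) \<in> borel_measurable borel" for i
    using f measurable_compose[OF _ borel_measurable_continuous_onI[OF cont]] by (auto simp: L2_def)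
  have "integrable lborel (\<lambda>x. (norm (f x $ i))\<^sup>2)" for i
  proof (rule Bochner_Integration.integrable_bound)
    show "integrable lborel (\<lambda>x. (norm (f x))\<^sup>2)" using f by (simp add: L2_def)
    show "AE x in lborel. norm ((norm (f x $ i))\<^sup>2) \<le> norm ((norm (f x))\<^sup>2)"
      by (rule AE_I2) (simp add: power_mono Finite_Cartesian_Product.norm_nth_le)
  qed measurable
  then show "sqint (\<lambda>x. f x $ 1) \<and> sqint (\<lambda>x. f x $ 2)" by (simp add: sqint_def)
next
  assume f: "sqint (\<lambda>x. f x $ 1) \<and> sqint (\<lambda>x. f x $ 2)"
  have cont: "continuous_on UNIV (axis i :: complex \<Rightarrow> complex ^ 2)" for i
    by (rule linear_continuous_on[OF bounded_linear_axis])
  have "(\<lambda>x. axis 1 (f x $ 1) + axis 2 (f x $ 2) :: complex ^ 2) \<in> borel_measurable borel"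
    using f measurable_compose[OF _ borel_measurable_continuous_onI[OF cont[of 1]]]
      measurable_compose[OF _ borel_measurable_continuous_onI[OF cont[of 2]]]
    by (intro borel_measurable_add) (auto simp: sqint_def)
  then have "f \<in> borel_measurable borel" by (simp flip: vec2_axis)
  moreover have "integrable lborel (\<lambda>x. (norm (f x))\<^sup>2)"
    using f unfolding norm_vec2_sq sqint_def by auto
  ultimately show "L2 f" by (simp add: L2_def)
qed

lemma sqnorm_vec:
  assumes "L2 f"
  shows "sqnorm f = sqnorm (\<lambda>x. f x $ 1) + sqnorm (\<lambda>x. f x $ 2)"
  using assms unfolding L2_iff sqint_def sqnorm_def norm_vec2_sq by simp

lemma L2norm_eq: "L2norm f = sqrt (sqnorm f)"
  by (simp add: L2norm_def sqnorm_def)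

section \<open>Linearity of the graph of the operator\<close>

lemma L2_lincomb:
  assumes "L2 f" "L2 g"
  shows "L2 (\<lambda>x. a *s f x + b *s g x)"
  using assms by (auto simp: L2_iff intro!: sqint_add sqint_mult_const)

lemma H1_split_lincomb:
  assumes "H1_split \<psi> g d" "H1_split \<psi>' g' d'"
  shows "H1_split (\<lambda>x. a *s \<psi> x + b *s \<psi>' x) (\<lambda>x. a *s g x + b *s g' x) (\<lambda>x. a *s d x + b *s d' x)"
proof -
  have int: "((\<lambda>x. a *s d x + b *s d' x) has_integral
       (a *s g s + b *s g' s) - (a *s g r + b *s g' r)) {r..s}"
    if "(d has_integral g s - g r) {r..s}" "(d' has_integral g' s - g' r) {r..s}" for r s
  proof -
    have "((\<lambda>x. a * d x $ i + b * d' x $ i) has_integral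
       a * (g s $ i - g r $ i) + b * (g' s $ i - g' r $ i)) {r..s}" if "i = 1 \<or> i = 2" for i
      using \<open>(d has_integral g s - g r) {r..s}\<close> \<open>(d' has_integral g' s - g' r) {r..s}\<close> that
      unfolding vec2_has_integral_iff
      by (intro has_integral_add has_integral_mult_right) auto
    then show ?thesis
      unfolding vec2_has_integral_iff by (simp add: algebra_simps)
  qed
  have "continuous_on S (\<lambda>x. a *s g x + b *s g' x)" if "continuous_on S g" "continuous_on S g'" for S
    using that unfolding vec2_continuous_on_iff by (auto intro!: continuous_intros)
  moreover have "AE x in lborel. a *s \<psi> x + b *s \<psi>' x = a *s g x + b *s g' x"
  proof -
    have "AE x in lborel. \<psi> x = g x" "AE x in lborel. \<psi>' x = g' x"
      using assms by (simp_all add: H1_split_def)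
    then show ?thesis by eventually_elim simp
  qed
  ultimately show ?thesis
    using assms int unfolding H1_split_def by (auto intro!: L2_lincomb)
qed

lemma tendsto_vector_scalar_mult:
  fixes g :: "'a \<Rightarrow> complex ^ 2"
  shows "(g \<longlongrightarrow> l) F \<Longrightarrow> ((\<lambda>x. c *s g x) \<longlongrightarrow> c *s l) F"
  unfolding vec2_tendsto_iff by (auto intro!: tendsto_intros)

lemma matrix_vector_mult_lincomb:
  fixes B :: cmat2
  shows "B *v (a *s v + b *s w) = a *s (B *v v) + b *s (B *v w)"
  by (simp add: vec2_eq_iff matrix_vector_mult_def sum_2 algebra_simps)

lemma dirac_graph_lincomb:
  assumes "dirac_graph m A \<psi> \<phi>" "dirac_graph m A \<psi>' \<phi>'"
  shows "dirac_graph m A (\<lambda>x. a *s \<psi> x + b *s \<psi>' x) (\<lambda>x. a *s \<phi> x + b *s \<phi>' x)"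
proof -
  obtain g d gp gm where 1: "H1_split \<psi> g d"
      "(g \<longlongrightarrow> gp) (at_right 0)" "(g \<longlongrightarrow> gm) (at_left 0)"
      "(mat (2 * \<i>) ** sigma1 - A) *v gp = (mat (2 * \<i>) ** sigma1 + A) *v gm"
      "AE x in lborel. \<phi> x = (mat (- \<i>) ** sigma1) *v d x + (mat (complex_of_real m) ** sigma3) *v \<psi> x"
    using assms(1) unfolding dirac_graph_def by blast
  obtain g' d' gp' gm' where 2: "H1_split \<psi>' g' d'"
      "(g' \<longlongrightarrow> gp') (at_right 0)" "(g' \<longlongrightarrow> gm') (at_left 0)"
      "(mat (2 * \<i>) ** sigma1 - A) *v gp' = (mat (2 * \<i>) ** sigma1 + A) *v gm'"
      "AE x in lborel. \<phi>' x = (mat (- \<i>) ** sigma1) *v d' x + (mat (complex_of_real m) ** sigma3) *v \<psi>' x"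
    using assms(2) unfolding dirac_graph_def by blast
  have "AE x in lborel. a *s \<phi> x + b *s \<phi>' x = (mat (- \<i>) ** sigma1) *v (a *s d x + b *s d' x)
      + (mat (complex_of_real m) ** sigma3) *v (a *s \<psi> x + b *s \<psi>' x)"
    using 1(5) 2(5)
    by eventually_elim (simp add: matrix_vector_mult_lincomb vec.scale_right_distrib)
  then show ?thesis
    unfolding dirac_graph_def
    by (intro exI[of _ "\<lambda>x. a *s g x + b *s g' x"] exI[of _ "\<lambda>x. a *s d x + b *s d' x"]
        exI[of _ "a *s gp + b *s gp'"] exI[of _ "a *s gm + b *s gm'"] conjI
        H1_split_lincomb[OF 1(1) 2(1)] tendsto_add tendsto_vector_scalar_mult 1(2,3) 2(2,3))
      (simp_all only: matrix_vector_mult_lincomb 1(4) 2(4))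
qed

lemma dirac_graph_cong_AE:
  assumes "dirac_graph m A \<psi> \<phi>" "AE x in lborel. \<phi> x = \<phi>' x"
  shows "dirac_graph m A \<psi> \<phi>'"
proof -
  obtain g d gp gm where 1: "H1_split \<psi> g d"
      "(g \<longlongrightarrow> gp) (at_right 0)" "(g \<longlongrightarrow> gm) (at_left 0)"
      "(mat (2 * \<i>) ** sigma1 - A) *v gp = (mat (2 * \<i>) ** sigma1 + A) *v gm"
      "AE x in lborel. \<phi> x = (mat (- \<i>) ** sigma1) *v d x + (mat (complex_of_real m) ** sigma3) *v \<psi> x"
    using assms(1) unfolding dirac_graph_def by blast
  have "AE x in lborel. \<phi>' x = (mat (- \<i>) ** sigma1) *v d x + (mat (complex_of_real m) ** sigma3) *v \<psi> x"
    using 1(5) assms(2) by eventually_elim simp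
  then show ?thesis using 1 unfolding dirac_graph_def by blast
qed

lemma dirac_graph_L2: "dirac_graph m A \<psi> \<phi> \<Longrightarrow> L2 \<psi>"
  by (auto simp: dirac_graph_def H1_split_def)

section \<open>Half-line systems and the transmission condition\<close>

text \<open>The equation \<open>(D - z) g = f\<close> on the interval \<open>S\<close>, solved for the derivatives of the components.\<close>
definition solves :: "real \<Rightarrow> complex \<Rightarrow> real set \<Rightarrow> (real \<Rightarrow> cvec2) \<Rightarrow> (real \<Rightarrow> cvec2) \<Rightarrow> bool" where
  "solves m z S f g \<longleftrightarrow> continuous_on S (\<lambda>x. g x $ 1) \<and> continuous_on S (\<lambda>x. g x $ 2) \<and>
    (\<forall>a b. a \<le> b \<longrightarrow> {a..b} \<subseteq> S \<longrightarrow>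
      ((\<lambda>x. \<i> * (f x $ 2 + (z + m) * g x $ 2)) has_integral g b $ 1 - g a $ 1) {a..b} \<and>
      ((\<lambda>x. \<i> * (f x $ 1 + (z - m) * g x $ 1)) has_integral g b $ 2 - g a $ 2) {a..b})"

text \<open>The transmission condition sorted by jump and sum of the traces, 2i \<sigma>1 (gp - gm)
  = A (gp + gm), written by rows; \<sigma>1 exchanges the components of the jump.\<close>

definition bc :: "cmat2 \<Rightarrow> cvec2 \<Rightarrow> cvec2 \<Rightarrow> bool" where
  "bc A gp gm \<longleftrightarrow>
    2 * \<i> * (gp $ 2 - gm $ 2) = A $ 1 $ 1 * (gp $ 1 + gm $ 1) + A $ 1 $ 2 * (gp $ 2 + gm $ 2) \<and>
    2 * \<i> * (gp $ 1 - gm $ 1) = A $ 2 $ 1 * (gp $ 1 + gm $ 1) + A $ 2 $ 2 * (gp $ 2 + gm $ 2)"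

lemma bc_eq:
  "(mat (2 * \<i>) ** sigma1 - A) *v gp = (mat (2 * \<i>) ** sigma1 + A) *v gm \<longleftrightarrow> bc A gp gm"
proof -
  have aux: "a - b = c + d \<longleftrightarrow> a - c = b + d" for a b c d :: complex
    by (auto simp: algebra_simps)
  have l: "((mat (2 * \<i>) ** sigma1 - A) *v v) $ 1 = 2 * \<i> * v $ 2 - (A $ 1 $ 1 * v $ 1 + A $ 1 $ 2 * v $ 2)"
    "((mat (2 * \<i>) ** sigma1 - A) *v v) $ 2 = 2 * \<i> * v $ 1 - (A $ 2 $ 1 * v $ 1 + A $ 2 $ 2 * v $ 2)"
    "((mat (2 * \<i>) ** sigma1 + A) *v v) $ 1 = 2 * \<i> * v $ 2 + (A $ 1 $ 1 * v $ 1 + A $ 1 $ 2 * v $ 2)"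
    "((mat (2 * \<i>) ** sigma1 + A) *v v) $ 2 = 2 * \<i> * v $ 1 + (A $ 2 $ 1 * v $ 1 + A $ 2 $ 2 * v $ 2)" for v
    by (simp_all add: matrix_vector_mult_def matrix_matrix_mult_def mat_def sigma1_def sum_2 algebra_simps)
  show ?thesis
    unfolding vec2_eq_iff l aux bc_def by (simp add: algebra_simps)
qed

lemma dirac_action_iff:
  fixes f \<psi> d :: cvec2
  shows "f + z *s \<psi> = (mat (- \<i>) ** sigma1) *v d + (mat (complex_of_real m) ** sigma3) *v \<psi> \<longleftrightarrow>
    d $ 1 = \<i> * (f $ 2 + (z + m) * \<psi> $ 2) \<and> d $ 2 = \<i> * (f $ 1 + (z - m) * \<psi> $ 1)"
proof -
  have aux: "a = - (\<i> * c) + e \<longleftrightarrow> c = \<i> * (a - e)" for a c e :: complex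
  proof -
    have "a = - (\<i> * c) + e \<longleftrightarrow> \<i> * (a - e) = \<i> * (- (\<i> * c))"
      unfolding mult_cancel_left by (auto simp: algebra_simps)
    also have "\<dots> \<longleftrightarrow> c = \<i> * (a - e)" by (auto simp flip: mult.assoc)
    finally show ?thesis .
  qed
  have l: "((mat (- \<i>) ** sigma1) *v d + (mat (complex_of_real m) ** sigma3) *v \<psi>) $ 1 = - (\<i> * d $ 2) + m * \<psi> $ 1"
    "((mat (- \<i>) ** sigma1) *v d + (mat (complex_of_real m) ** sigma3) *v \<psi>) $ 2 = - (\<i> * d $ 1) + - (m * \<psi> $ 2)"
    by (simp_all add: matrix_vector_mult_def matrix_matrix_mult_def mat_def sigma1_def sigma3_def sum_2)
  show ?thesis
    unfolding vec2_eq_iff l aux by (auto simp: algebra_simps)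
qed

lemma has_integral_AE_cong:
  fixes d :: "real \<Rightarrow> complex"
  assumes "(d has_integral I) S" "AE x in lborel. d x = e x"
  shows "(e has_integral I) S"
  by (rule has_integral_AE[THEN iffD1, OF _ assms(1)]) (use assms(2) in auto)

lemma Icc_subset_half_line:
  fixes a b :: real
  assumes "a \<le> b"
  shows "{a..b} \<subseteq> {0<..} \<longleftrightarrow> 0 < a" "{a..b} \<subseteq> {..<0} \<longleftrightarrow> b < 0"
  using assms by (auto simp: subset_iff)

text \<open>The derivative in the graph is known only a.e.; it is replaced by the right-hand side of
  the equation evaluated at the representative g, and the exceptional null sets disappear inside the
  integrals.\<close>

lemma dirac_graphE:
  assumes "dirac_graph m A \<psi> (\<lambda>x. f x + z *s \<psi> x)"
  obtains g gp gm where "L2 \<psi>" "AE x in lborel. \<psi> x = g x"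
    "solves m z {0<..} f g" "solves m z {..<0} f g"
    "(g \<longlongrightarrow> gp) (at_right 0)" "(g \<longlongrightarrow> gm) (at_left 0)" "bc A gp gm"
proof -
  obtain g d gp gm where 1: "H1_split \<psi> g d"
      "(g \<longlongrightarrow> gp) (at_right 0)" "(g \<longlongrightarrow> gm) (at_left 0)" "bc A gp gm"
      "AE x in lborel. f x + z *s \<psi> x
        = (mat (- \<i>) ** sigma1) *v d x + (mat (complex_of_real m) ** sigma3) *v \<psi> x"
    using assms unfolding dirac_graph_def bc_eq by blast
  have \<psi>: "L2 \<psi>" "AE x in lborel. \<psi> x = g x" using 1(1) by (auto simp: H1_split_def)
  have d1: "AE x in lborel. d x $ 1 = \<i> * (f x $ 2 + (z + m) * g x $ 2)"
    using 1(5) \<psi>(2) by eventually_elim (simp add: dirac_action_iff)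
  have d2: "AE x in lborel. d x $ 2 = \<i> * (f x $ 1 + (z - m) * g x $ 1)"
    using 1(5) \<psi>(2) by eventually_elim (simp add: dirac_action_iff)
  have i: "((\<lambda>x. \<i> * (f x $ 2 + (z + m) * g x $ 2)) has_integral g b $ 1 - g a $ 1) {a..b} \<and>
      ((\<lambda>x. \<i> * (f x $ 1 + (z - m) * g x $ 1)) has_integral g b $ 2 - g a $ 2) {a..b}"
    if "(d has_integral g b - g a) {a..b}" for a b
    using that has_integral_AE_cong[OF _ d1] has_integral_AE_cong[OF _ d2]
    unfolding vec2_has_integral_iff by simp
  show thesis
  proof (rule that)
    show "solves m z {0<..} f g" "solves m z {..<0} f g"
      using 1(1) i unfolding H1_split_def solves_def
      by (auto simp: Icc_subset_half_line vec2_continuous_on_iff)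
  qed (use \<psi> 1 in auto)
qed

text \<open>Here \<psi> is its own representative and the derivative is the one prescribed by the
  equation, so it is square integrable because f and \<psi> are.\<close>

lemma dirac_graphI:
  assumes "L2 f" "L2 \<psi>"
    "solves m z {0<..} f \<psi>" "solves m z {..<0} f \<psi>"
    "(\<psi> \<longlongrightarrow> gp) (at_right 0)" "(\<psi> \<longlongrightarrow> gm) (at_left 0)" "bc A gp gm"
  shows "dirac_graph m A \<psi> (\<lambda>x. f x + z *s \<psi> x)"
proof -
  define d :: "real \<Rightarrow> cvec2" where
    "d x = vector [\<i> * (f x $ 2 + (z + m) * \<psi> x $ 2), \<i> * (f x $ 1 + (z - m) * \<psi> x $ 1)]" for x
  have "H1_split \<psi> \<psi> d"
    using assms(1-4) unfolding H1_split_def solves_def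
    by (auto simp: Icc_subset_half_line vec2_continuous_on_iff vec2_has_integral_iff d_def L2_iff
        intro!: sqint_add sqint_mult_const)
  then show ?thesis
    unfolding dirac_graph_def bc_eq dirac_action_iff using assms(5-7)
    by (intro exI[of _ \<psi>] exI[of _ d] exI[of _ gp] exI[of _ gm]) (simp add: d_def)
qed

section \<open>Homogeneous solutions\<close>

text \<open>Continuity of u upgrades the integral equation to a genuine derivative, and then
  \<open>exp (- l x) * u x\<close> has derivative zero.\<close>

lemma ode_hom:
  fixes u :: "real \<Rightarrow> complex"
  assumes u: "continuous_on {0<..} u"
    "\<And>a b. 0 < a \<Longrightarrow> a \<le> b \<Longrightarrow> ((\<lambda>x. l * u x) has_integral u b - u a) {a..b}"
  obtains c where "\<And>x. x > 0 \<Longrightarrow> u x = c * exp (l * of_real x)"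
proof -
  have du: "(u has_vector_derivative l * u x) (at x)" if "x > 0" for x
  proof -
    \<comment> \<open>A compact interval inside the open half-line with x in its interior.\<close>
    have "continuous_on {x/2..2*x} (\<lambda>x. l * u x)"
      by (rule continuous_on_mult_left, rule continuous_on_subset[OF u(1)]) (use that in auto)
    then have "((\<lambda>t. integral {x/2..t} (\<lambda>x. l * u x)) has_vector_derivative l * u x) (at x within {x/2..2*x})"
      by (rule integral_has_vector_derivative) (use that in auto)
    then have "((\<lambda>t. u (x/2) + integral {x/2..t} (\<lambda>x. l * u x)) has_vector_derivative l * u x) (at x within {x/2..2*x})"
      by (auto intro: derivative_eq_intros)
    then have "(u has_vector_derivative l * u x) (at x within {x/2..2*x})"
      by (rule has_vector_derivative_transform[rotated 2])
        (use that integral_unique[OF u(2)] in auto)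
    moreover have "at x within {x/2..2*x} = at x"
      using that by (intro at_within_interior) auto
    ultimately show ?thesis by simp
  qed
  have "((\<lambda>x. exp (- l * of_real x) * u x) has_vector_derivative 0) (at x within {0<..})" if "x > 0" for x
  proof -
    have "((\<lambda>x. exp (- l * of_real x)) has_vector_derivative - l * exp (- l * of_real x)) (at x)"
      by (rule has_vector_derivative_real_field) (auto intro!: derivative_eq_intros)
    from has_vector_derivative_mult[OF this du[OF that]]
    show ?thesis by (auto intro: has_vector_derivative_at_within simp: algebra_simps)
  qed
  then obtain c where c: "\<And>x. x \<in> {0<..} \<Longrightarrow> exp (- l * of_real x) * u x = c"
    using has_vector_derivative_zero_constant[of "{0<..}" "\<lambda>x. exp (- l * of_real x) * u x"] by auto
  show thesis
  proof
    fix x :: real assume "x > 0"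
    then show "u x = c * exp (l * of_real x)"
      using c[of x] by (auto simp: exp_minus field_simps)
  qed
qed

lemma not_integrable_half_line:
  fixes h :: "real \<Rightarrow> real"
  assumes h: "integrable lborel h" "\<And>x. 0 \<le> h x" and "AE x in lborel. x > 0 \<longrightarrow> c \<le> h x"
  shows "c \<le> (0::real)"
proof (rule ccontr)
  assume c: "\<not> c \<le> 0"
  \<comment> \<open>Chosen so that \<open>c * n\<close> exceeds the integral of h by exactly
    c.\<close>
  define n where "n = (\<integral>x. h x \<partial>lborel) / c + 1"
  have n: "n > 0" unfolding n_def using c h by (intro add_nonneg_pos divide_nonneg_pos integral_nonneg_AE) auto
  have "(\<integral>x. c * indicator {0..n} x \<partial>lborel) \<le> (\<integral>x. h x \<partial>lborel)"
  proof (rule integral_mono_AE)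
    show "AE x in lborel. c * indicator {0..n} x \<le> h x"
      using assms(3) AE_lborel_singleton[of 0] by eventually_elim (use h(2) in \<open>auto simp: indicator_def\<close>)
  qed (use h integrable_indicator_Icc in auto)
  then have "c * n \<le> (\<integral>x. h x \<partial>lborel)" using n by simp
  then show False using c by (simp add: n_def distrib_left)
qed

lemma sqint_exp_zero:
  assumes "sqint \<psi>" "AE x in lborel. x > 0 \<longrightarrow> \<psi> x = c * exp (l * of_real x)" "Re l \<ge> 0"
  shows "c = 0"
proof -
  have "AE x in lborel. x > 0 \<longrightarrow> (norm c)\<^sup>2 \<le> (norm (\<psi> x))\<^sup>2"
    using assms(2)
  proof eventually_elim
    case (elim x)
    show ?case
    proof
      assume "x > 0"
      then have "norm (\<psi> x) = norm c * exp (Re l * x)" using elim by (simp add: norm_mult)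
      moreover have "1 \<le> exp (Re l * x)" using assms(3) \<open>x > 0\<close> by simp
      ultimately have "norm c \<le> norm (\<psi> x)" by (simp add: mult_left_le_one_le mult_le_cancel_left1)
      then show "(norm c)\<^sup>2 \<le> (norm (\<psi> x))\<^sup>2" by (simp add: power_mono)
    qed
  qed
  from not_integrable_half_line[OF sqint_integrable[OF assms(1)] _ this]
  show ?thesis by simp
qed

text \<open>An exponential that grows or has constant modulus is square integrable on a half-line
  only with coefficient zero. This removes the growing mode off the cut and both oscillating modes
  on it.\<close>

lemma ode_hom_sqint:
  fixes u :: "real \<Rightarrow> complex"
  assumes u: "continuous_on {0<..} u"
    "\<And>a b. 0 < a \<Longrightarrow> a \<le> b \<Longrightarrow> ((\<lambda>x. l * u x) has_integral u b - u a) {a..b}"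
    and "sqint \<psi>" "AE x in lborel. \<psi> x = u x" "Re l \<ge> 0" "x > 0"
  shows "u x = 0"
proof -
  obtain c where c: "\<And>x. x > 0 \<Longrightarrow> u x = c * exp (l * of_real x)"
    using ode_hom[OF u] by blast
  have "AE x in lborel. x > 0 \<longrightarrow> \<psi> x = c * exp (l * of_real x)"
    using assms(4) by eventually_elim (auto simp: c)
  then have "c = 0" by (rule sqint_exp_zero[OF assms(3) _ assms(5)])
  then show ?thesis using c assms(6) by simp
qed

text \<open>For e = 1 and e = -1 the combination \<open>g1 + e \<zeta> g2\<close> solves
  \<open>u' = e i k u\<close>. For e = -1 the exponent has real part \<open>Im k \<ge> 0\<close>, so
  this combination vanishes; for e = 1 it vanishes too when k is real. Here k and \<zeta> are
  parameters tied to z only by the two product relations, so that the lemma applies with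
  \<open>kk\<close> and \<open>zeta\<close> off the cut and with a real k in its interior.\<close>

lemma solves_hom_pos:
  assumes s: "solves m z {0<..} (\<lambda>_. 0) g" and \<psi>: "L2 \<psi>" "AE x in lborel. \<psi> x = g x"
    and k: "k * \<zeta> = z + m" "\<zeta> * (z - m) = k" "\<zeta> \<noteq> 0" "Im k \<ge> 0"
  obtains a where "\<And>x. x > 0 \<Longrightarrow> g x $ 1 = \<zeta> * a * exp (\<i> * k * of_real x)"
    "\<And>x. x > 0 \<Longrightarrow> g x $ 2 = a * exp (\<i> * k * of_real x)" "Im k = 0 \<Longrightarrow> a = 0"
proof -
  have i: "((\<lambda>x. \<i> * ((z + m) * g x $ 2)) has_integral g b $ 1 - g a $ 1) {a..b}"
    "((\<lambda>x. \<i> * ((z - m) * g x $ 1)) has_integral g b $ 2 - g a $ 2) {a..b}"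
    if "0 < a" "a \<le> b" for a b
    using s that unfolding solves_def by (auto simp: Icc_subset_half_line)
  have cont: "continuous_on {0<..} (\<lambda>x. g x $ 1)" "continuous_on {0<..} (\<lambda>x. g x $ 2)"
    using s by (auto simp: solves_def)
  have ip: "((\<lambda>x. e * (\<i> * k) * (g x $ 1 + e * \<zeta> * g x $ 2)) has_integral
      (g b $ 1 + e * \<zeta> * g b $ 2) - (g a $ 1 + e * \<zeta> * g a $ 2)) {a..b}"
    if "0 < a" "a \<le> b" and e: "e * e = 1" for a b e
  proof -
    have eq: "e * (\<i> * k) * (g x $ 1 + e * \<zeta> * g x $ 2) =
      \<i> * ((z + m) * g x $ 2) + e * \<zeta> * (\<i> * ((z - m) * g x $ 1))" for x
    proof -
      have "e * (\<i> * k) * (g x $ 1 + e * \<zeta> * g x $ 2) =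
        \<i> * ((k * \<zeta>) * g x $ 2) * (e * e) + e * \<i> * (k * g x $ 1)"
        by (simp add: algebra_simps)
      also have "\<dots> = \<i> * ((z + m) * g x $ 2) + e * \<i> * ((\<zeta> * (z - m)) * g x $ 1)"
        unfolding e k(1,2) by simp
      finally show ?thesis by (simp add: mult_ac)
    qed
    have eq2: "(g b $ 1 + e * \<zeta> * g b $ 2) - (g a $ 1 + e * \<zeta> * g a $ 2) =
      (g b $ 1 - g a $ 1) + e * \<zeta> * (g b $ 2 - g a $ 2)"
      by (simp add: algebra_simps)
    show ?thesis unfolding eq eq2
      by (intro has_integral_add has_integral_mult_right i that)
  qed
  have L: "sqint (\<lambda>x. \<psi> x $ 1 + e * \<zeta> * \<psi> x $ 2)" for e
    using \<psi>(1) unfolding L2_iff by (intro sqint_add sqint_mult_const) auto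
  have AE: "AE x in lborel. \<psi> x $ 1 + e * \<zeta> * \<psi> x $ 2 = g x $ 1 + e * \<zeta> * g x $ 2" for e
    using \<psi>(2) by eventually_elim simp
  have C: "continuous_on {0<..} (\<lambda>x. g x $ 1 + e * \<zeta> * g x $ 2)" for e
    by (intro continuous_on_add continuous_on_mult_left cont)
  have q: "g x $ 1 - \<zeta> * g x $ 2 = 0" if "x > 0" for x
    using ode_hom_sqint[OF C ip[of _ _ "-1"] L AE, of x] that k(4) by simp
  obtain a where a: "\<And>x. x > 0 \<Longrightarrow> g x $ 1 + \<zeta> * g x $ 2 = a * exp (\<i> * k * of_real x)"
    using ode_hom[OF C ip[of _ _ 1]] by auto
  have z: "a = 0" if "Im k = 0"
  proof -
    have "g 1 $ 1 + \<zeta> * g 1 $ 2 = 0"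
      using ode_hom_sqint[OF C ip[of _ _ "1"] L AE, of 1] that by simp
    then show ?thesis using a[of 1] by simp
  qed
  show thesis
  proof (rule that)
    fix x :: real assume x: "x > 0"
    have 1: "2 * g x $ 1 = a * exp (\<i> * k * of_real x)" using a[OF x] q[OF x] by simp
    have 2: "2 * (\<zeta> * g x $ 2) = a * exp (\<i> * k * of_real x)" using a[OF x] q[OF x] by simp
    show "g x $ 1 = \<zeta> * (a / (2 * \<zeta>)) * exp (\<i> * k * of_real x)"
      using 1 k(3) by (simp add: field_simps)
    show "g x $ 2 = (a / (2 * \<zeta>)) * exp (\<i> * k * of_real x)"
      using 2 k(3) by (simp add: field_simps)
  qed (use z in simp)
qed

text \<open>The parity transform \<open>(\<sigma>\<^sub>3 g)(-x)\<close> exchanges the two half lines.\<close>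
definition parity :: "(real \<Rightarrow> cvec2) \<Rightarrow> real \<Rightarrow> cvec2" where
  "parity g x = vector [g (- x) $ 1, - g (- x) $ 2]"

lemma parity_nth [simp]: "parity g x $ 1 = g (- x) $ 1" "parity g x $ 2 = - g (- x) $ 2"
  by (simp_all add: parity_def)

lemma solves_parity:
  assumes "solves m z {..<0} (\<lambda>_. 0) g"
  shows "solves m z {0<..} (\<lambda>_. 0) (parity g)"
proof -
  have c: "continuous_on {0<..} (\<lambda>x::real. h (- x))" if "continuous_on {..<0} h" for h :: "real \<Rightarrow> complex"
    by (rule continuous_on_compose2[OF that]) (auto intro!: continuous_intros)
  have "((\<lambda>x. \<i> * (0 + (z + m) * parity g x $ 2)) has_integral parity g b $ 1 - parity g a $ 1) {a..b} \<and>
      ((\<lambda>x. \<i> * (0 + (z - m) * parity g x $ 1)) has_integral parity g b $ 2 - parity g a $ 2) {a..b}"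
    if "0 < a" "a \<le> b" for a b
  proof -
    have *: "((\<lambda>x. \<i> * ((z + m) * g x $ 2)) has_integral g (- a) $ 1 - g (- b) $ 1) {- b..- a}"
      "((\<lambda>x. \<i> * ((z - m) * g x $ 1)) has_integral g (- a) $ 2 - g (- b) $ 2) {- b..- a}"
      using assms that unfolding solves_def by (auto simp: Icc_subset_half_line)
    show ?thesis
      using has_integral_neg[OF has_integral_reflect_real[THEN iffD2, OF *(1)]]
        has_integral_reflect_real[THEN iffD2, OF *(2)] that by simp
  qed
  then show ?thesis
    using assms unfolding solves_def
    by (auto simp: Icc_subset_half_line intro!: c continuous_on_minus)
qed

lemma L2_parity: "L2 \<psi> \<Longrightarrow> L2 (parity \<psi>)"
  by (auto simp: L2_iff intro!: sqint_uminus sqint_reflect[of "\<lambda>x. \<psi> x $ i" for i])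

lemma AE_parity:
  assumes "AE x in lborel. \<psi> x = g x"
  shows "AE x in lborel. parity \<psi> x = parity g x"
  using AE_lborel_reflect[OF assms] by eventually_elim (simp add: parity_def)

lemma solves_hom_neg:
  assumes s: "solves m z {..<0} (\<lambda>_. 0) g" and \<psi>: "L2 \<psi>" "AE x in lborel. \<psi> x = g x"
    and k: "k * \<zeta> = z + m" "\<zeta> * (z - m) = k" "\<zeta> \<noteq> 0" "Im k \<ge> 0"
  obtains a where "\<And>x. x < 0 \<Longrightarrow> g x $ 1 = \<zeta> * a * exp (- (\<i> * k * of_real x))"
    "\<And>x. x < 0 \<Longrightarrow> g x $ 2 = - a * exp (- (\<i> * k * of_real x))" "Im k = 0 \<Longrightarrow> a = 0"
proof -
  obtain a where a: "\<And>x. x > 0 \<Longrightarrow> parity g x $ 1 = \<zeta> * a * exp (\<i> * k * of_real x)"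
    "\<And>x. x > 0 \<Longrightarrow> parity g x $ 2 = a * exp (\<i> * k * of_real x)" "Im k = 0 \<Longrightarrow> a = 0"
    using solves_hom_pos[OF solves_parity[OF s] L2_parity[OF \<psi>(1)] AE_parity[OF \<psi>(2)] k] by blast
  show thesis
  proof (rule that)
    fix x :: real assume "x < 0"
    then show "g x $ 1 = \<zeta> * a * exp (- (\<i> * k * of_real x))"
      using a(1)[of "- x"] by simp
    have "- g x $ 2 = a * exp (- (\<i> * k * of_real x))"
      using a(2)[of "- x"] \<open>x < 0\<close> by simp
    then show "g x $ 2 = - a * exp (- (\<i> * k * of_real x))"
      by (metis minus_minus mult_minus_left)
  qed (use a in auto)
qed

text \<open>At the thresholds k = 0 and the diagonalisation breaks down, but the system is
  triangular: one component has derivative zero, hence is constant and by square integrability zero,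
  after which the same argument applies to the other.\<close>

lemma solves_threshold:
  assumes s: "solves m z {0<..} (\<lambda>_. 0) g" and \<psi>: "L2 \<psi>" "AE x in lborel. \<psi> x = g x"
    and z: "z = m \<or> z = - of_real m" and x: "x > 0"
  shows "g x = 0"
proof -
  have i: "((\<lambda>x. \<i> * ((z + m) * g x $ 2)) has_integral g b $ 1 - g a $ 1) {a..b}"
    "((\<lambda>x. \<i> * ((z - m) * g x $ 1)) has_integral g b $ 2 - g a $ 2) {a..b}"
    if "0 < a" "a \<le> b" for a b
    using s that unfolding solves_def by (auto simp: Icc_subset_half_line)
  have cont: "continuous_on {0<..} (\<lambda>x. g x $ 1)" "continuous_on {0<..} (\<lambda>x. g x $ 2)"
    using s by (auto simp: solves_def)
  have L: "sqint (\<lambda>x. \<psi> x $ 1)" "sqint (\<lambda>x. \<psi> x $ 2)" using \<psi>(1) by (auto simp: L2_iff)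
  have AE: "AE x in lborel. \<psi> x $ i = g x $ i" for i
    using \<psi>(2) by eventually_elim simp
  have const1: "g x $ 1 = 0" if "x > 0"
      "\<And>a b. 0 < a \<Longrightarrow> a \<le> b \<Longrightarrow> ((\<lambda>x. 0) has_integral g b $ 1 - g a $ 1) {a..b}" for x
    by (rule ode_hom_sqint[where u="\<lambda>x. g x $ 1" and l=0, OF cont(1) _ L(1) AE])
      (simp_all only: mult_zero_left that, simp)
  have const2: "g x $ 2 = 0" if "x > 0"
      "\<And>a b. 0 < a \<Longrightarrow> a \<le> b \<Longrightarrow> ((\<lambda>x. 0) has_integral g b $ 2 - g a $ 2) {a..b}" for x
    by (rule ode_hom_sqint[where u="\<lambda>x. g x $ 2" and l=0, OF cont(2) _ L(2) AE])
      (simp_all only: mult_zero_left that, simp)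
  have step: "((\<lambda>x. 0) has_integral I) {a..b}"
    if "((\<lambda>x. \<i> * (c * h x)) has_integral I) {a..b}" "c = 0 \<or> (\<forall>x>0. h x = 0)" "0 < a"
    for c I a b and h :: "real \<Rightarrow> complex"
    by (rule has_integral_eq[OF _ that(1)]) (use that(2,3) in auto)
  from z show ?thesis
  proof
    assume "z = m"
    have 2: "g x $ 2 = 0" if "x > 0" for x
      by (rule const2[OF that], rule step[OF i(2)]) (use \<open>z = m\<close> in auto)
    have "g x $ 1 = 0" by (rule const1[OF x], rule step[OF i(1)]) (use 2 in auto)
    then show ?thesis using 2[OF x] by (simp add: vec2_eq_iff)
  next
    assume "z = - of_real m"
    have 1: "g x $ 1 = 0" if "x > 0" for x
      by (rule const1[OF that], rule step[OF i(1)]) (use \<open>z = - of_real m\<close> in auto)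
    have "g x $ 2 = 0" by (rule const2[OF x], rule step[OF i(2)]) (use 1 in auto)
    then show ?thesis using 1[OF x] by (simp add: vec2_eq_iff)
  qed
qed

lemma cut_no_eigenfunction:
  assumes z: "z \<in> cut_set m" and "dirac_graph m A \<psi> (\<lambda>x. z *s \<psi> x)"
  shows "AE x in lborel. \<psi> x = 0"
proof -
  have "dirac_graph m A \<psi> (\<lambda>x. 0 + z *s \<psi> x)" using assms(2) by simp
  then obtain g gp gm where g: "L2 \<psi>" "AE x in lborel. \<psi> x = g x"
    "solves m z {0<..} (\<lambda>_. 0) g" "solves m z {..<0} (\<lambda>_. 0) g"
    by (rule dirac_graphE)
  have zr: "z = of_real (Re z)" "\<bar>m\<bar> \<le> \<bar>Re z\<bar>" using z by (auto simp: cut_set_def complex_eq_iff)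
  have g0: "g x = 0" if "x \<noteq> 0" for x
  proof (cases "\<bar>Re z\<bar> = \<bar>m\<bar>")
    case True
    then have z': "z = m \<or> z = - of_real m" using zr(1) by (metis abs_eq_iff of_real_minus)
    show ?thesis
    proof (cases "x > 0")
      case True
      then show ?thesis using solves_threshold[OF g(3,1,2) z'] by simp
    next
      case False
      then have "parity g (- x) = 0"
        using solves_threshold[OF solves_parity[OF g(4)] L2_parity[OF g(1)] AE_parity[OF g(2)] z', of "- x"] that by simp
      then show ?thesis by (simp add: vec2_eq_iff)
    qed
  next
    case False
    \<comment> \<open>Beyond the thresholds the momentum is a positive real number; used as k it has
      \<open>Im k = 0\<close>, which forces the remaining amplitude on each half-line to
      vanish.\<close>
    define r where "r = sqrt ((Re z)\<^sup>2 - m\<^sup>2)"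
    have pos: "(Re z)\<^sup>2 - m\<^sup>2 > 0" using False zr(2) abs_le_square_iff[of "Re z" m] by auto
    then have r: "r > 0" "r * r = (Re z)\<^sup>2 - m\<^sup>2" by (auto simp: r_def)
    define \<zeta> where "\<zeta> = (z + m) / of_real r"
    have k1: "of_real r * \<zeta> = z + m" using r by (simp add: \<zeta>_def)
    have k2: "\<zeta> * (z - m) = of_real r"
    proof -
      have "(z + m) * (z - m) = of_real ((Re z)\<^sup>2 - m\<^sup>2)"
        by (subst (1 2) zr(1)) (simp add: algebra_simps power2_eq_square)
      also have "\<dots> = of_real r * of_real r" unfolding r(2)[symmetric] by simp
      finally show ?thesis using r(1) by (simp add: \<zeta>_def)
    qed
    have k3: "\<zeta> \<noteq> 0" using k2 r(1) by fastforce
    show ?thesis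
    proof (cases "x > 0")
      case True
      obtain a where "\<And>x. x > 0 \<Longrightarrow> g x $ 1 = \<zeta> * a * exp (\<i> * of_real r * of_real x)"
        "\<And>x. x > 0 \<Longrightarrow> g x $ 2 = a * exp (\<i> * of_real r * of_real x)" "Im (of_real r) = 0 \<Longrightarrow> a = 0"
        by (rule solves_hom_pos[OF g(3,1,2) k1 k2 k3]) auto
      then show ?thesis using True by (simp add: vec2_eq_iff)
    next
      case False
      then have "x < 0" using that by simp
      obtain a where "\<And>x. x < 0 \<Longrightarrow> g x $ 1 = \<zeta> * a * exp (- (\<i> * of_real r * of_real x))"
        "\<And>x. x < 0 \<Longrightarrow> g x $ 2 = - a * exp (- (\<i> * of_real r * of_real x))" "Im (of_real r) = 0 \<Longrightarrow> a = 0"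
        by (rule solves_hom_neg[OF g(4,1,2) k1 k2 k3]) auto
      then show ?thesis using \<open>x < 0\<close> by (simp add: vec2_eq_iff)
    qed
  qed
  show ?thesis using g(2) AE_lborel_singleton[of 0] by eventually_elim (use g0 in auto)
qed

section \<open>The branch of the square root and the relations between k and \<zeta>\<close>

lemma bsqrt_eq:
  assumes "w \<notin> \<real>\<^sub>\<ge>\<^sub>0"
  shows "bsqrt w = \<i> * csqrt (- w)" and "(bsqrt w)\<^sup>2 = w" and "Im (bsqrt w) > 0"
proof -
  \<comment> \<open>The principal root has real part zero only for nonpositive arguments, that is
    for w in \<open>[0, \<infinity>)\<close>. Rotation by i then turns Re > 0 into the required Im >
    0.\<close>
  have re: "Re (csqrt (- w)) > 0"
  proof (rule ccontr)
    define c where "c = csqrt (- w)"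
    assume "\<not> Re (csqrt (- w)) > 0"
    then have "Re c = 0" using csqrt_principal[of "- w"] by (auto simp: c_def)
    moreover have "w = - c\<^sup>2" by (simp add: c_def)
    ultimately have "w = of_real ((Im c)\<^sup>2)" by (simp add: complex_eq_iff power2_eq_square)
    then show False using assms by (metis nonneg_Reals_of_real_iff zero_le_power2)
  qed
  have sq: "(\<i> * csqrt (- w))\<^sup>2 = w" by (simp add: power_mult_distrib)
  show eq: "bsqrt w = \<i> * csqrt (- w)"
    unfolding bsqrt_def
  proof (rule the_equality)
    fix s assume s: "s\<^sup>2 = w \<and> Im s > 0"
    then have "s = \<i> * csqrt (- w) \<or> s = - (\<i> * csqrt (- w))"
      using sq by (metis power2_eq_iff)
    moreover have "s \<noteq> - (\<i> * csqrt (- w))"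
    proof
      assume "s = - (\<i> * csqrt (- w))"
      then have "Im s = - Re (csqrt (- w))" by simp
      then show False using s re by simp
    qed
    ultimately show "s = \<i> * csqrt (- w)" by blast
  qed (use re sq in simp)
  show "(bsqrt w)\<^sup>2 = w" "Im (bsqrt w) > 0" using sq re by (auto simp: eq)
qed

lemma off_cut_nonneg_Reals:
  assumes "z \<notin> cut_set m"
  shows "z\<^sup>2 - (complex_of_real m)\<^sup>2 \<notin> \<real>\<^sub>\<ge>\<^sub>0"
proof
  assume "z\<^sup>2 - (complex_of_real m)\<^sup>2 \<in> \<real>\<^sub>\<ge>\<^sub>0"
  then obtain t where t: "t \<ge> 0" "z\<^sup>2 = of_real (t + m\<^sup>2)"
    by (auto elim!: nonneg_Reals_cases simp: algebra_simps)
  then have "z\<^sup>2 = (of_real (sqrt (t + m\<^sup>2)))\<^sup>2" by (simp flip: of_real_power)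
  then have "z = of_real (sqrt (t + m\<^sup>2)) \<or> z = - of_real (sqrt (t + m\<^sup>2))"
    by (metis power2_eq_iff)
  moreover have "\<bar>m\<bar> \<le> sqrt (t + m\<^sup>2)" using t by (metis real_sqrt_abs real_sqrt_le_iff le_add_same_cancel2)
  ultimately show False using assms by (auto simp: cut_set_def)
qed

text \<open>Exactly the properties of k and \<zeta> that \<open>solves_hom_pos\<close> asks for. The
  third relation holds because k^2 = (z + m)(z - m).\<close>

lemma kk_zeta:
  assumes "z \<notin> cut_set m"
  shows "Im (kk m z) > 0" "kk m z * zeta m z = z + m" "zeta m z * (z - m) = kk m z" "zeta m z \<noteq> 0"
proof -
  note b = bsqrt_eq[OF off_cut_nonneg_Reals[OF assms]]
  show im: "Im (kk m z) > 0" using b(3) by (simp add: kk_def)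
  then have nz: "kk m z \<noteq> 0" by auto
  then show 1: "kk m z * zeta m z = z + m" by (simp add: zeta_def)
  have "kk m z * (zeta m z * (z - m)) = (z + m) * (z - m)"
    by (simp add: 1 flip: mult.assoc)
  also have "\<dots> = (kk m z)\<^sup>2" unfolding kk_def b(2) by (simp add: algebra_simps power2_eq_square)
  finally show "zeta m z * (z - m) = kk m z" using nz by (simp add: power2_eq_square)
  then show "zeta m z \<noteq> 0" using nz by auto
qed

section \<open>Eigenfunctions and the inhomogeneous equation\<close>

lemma MM_nth:
  "MM m A z $ 1 $ 1 = 1 + \<i> / 2 * (A $ 1 $ 1 * zeta m z)"
  "MM m A z $ 1 $ 2 = \<i> / 2 * (A $ 1 $ 2 / zeta m z)"
  "MM m A z $ 2 $ 1 = \<i> / 2 * (A $ 2 $ 1 * zeta m z)"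
  "MM m A z $ 2 $ 2 = 1 + \<i> / 2 * (A $ 2 $ 2 / zeta m z)"
proof -
  have 1: "(mat c ** B) $ i $ j = c * B $ i $ j" for c and B :: cmat2 and i j
    by (simp add: matrix_matrix_mult_def mat_def if_distrib[of "\<lambda>x. x * _"] cong: if_cong)
  have 2: "(B ** C) $ i $ j = B $ i $ 1 * C $ 1 $ j + B $ i $ 2 * C $ 2 $ j" for B C :: cmat2 and i j
    by (simp add: matrix_matrix_mult_def sum_2)
  have 3: "ZZ m z $ 1 $ 1 = zeta m z" "ZZ m z $ 1 $ 2 = 0" "ZZ m z $ 2 $ 1 = 0"
    "ZZ m z $ 2 $ 2 = inverse (zeta m z)"
    by (simp_all add: ZZ_def)
  have 4: "sigma0 $ 1 $ 1 = 1" "sigma0 $ 1 $ 2 = 0" "sigma0 $ 2 $ 1 = 0" "sigma0 $ 2 $ 2 = 1"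
    by (simp_all add: sigma0_def mat_def)
  show "MM m A z $ 1 $ 1 = 1 + \<i> / 2 * (A $ 1 $ 1 * zeta m z)"
    "MM m A z $ 1 $ 2 = \<i> / 2 * (A $ 1 $ 2 / zeta m z)"
    "MM m A z $ 2 $ 1 = \<i> / 2 * (A $ 2 $ 1 * zeta m z)"
    "MM m A z $ 2 $ 2 = 1 + \<i> / 2 * (A $ 2 $ 2 / zeta m z)"
    unfolding MM_def vector_add_component 2[of _ "ZZ m z"] 1 3 4 by (simp_all add: inverse_eq_divide)
qed

lemma mat2_mult_nth:
  fixes B :: cmat2
  shows "(B *v v) $ 1 = B $ 1 $ 1 * v $ 1 + B $ 1 $ 2 * v $ 2"
    "(B *v v) $ 2 = B $ 2 $ 1 * v $ 1 + B $ 2 $ 2 * v $ 2"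
  by (simp_all add: matrix_vector_mult_def sum_2)

text \<open>Up to the factor i/2 this is R_z(x,0) v (\<open>RR_Tsol\<close>), the general decaying
  homogeneous solution on both half-lines. The parameter v encodes the jump at 0, which equals 2
  \<sigma>1 v.\<close>

definition Tsol :: "real \<Rightarrow> complex \<Rightarrow> cvec2 \<Rightarrow> real \<Rightarrow> cvec2" where
  "Tsol m z v x = vector [(zeta m z * v $ 1 + of_real (sgn x) * v $ 2) * exp (\<i> * kk m z * of_real \<bar>x\<bar>),
    (v $ 2 / zeta m z + of_real (sgn x) * v $ 1) * exp (\<i> * kk m z * of_real \<bar>x\<bar>)]"

lemma Tsol_nth:
  "Tsol m z v x $ 1 = (zeta m z * v $ 1 + of_real (sgn x) * v $ 2) * exp (\<i> * kk m z * of_real \<bar>x\<bar>)"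
  "Tsol m z v x $ 2 = (v $ 2 / zeta m z + of_real (sgn x) * v $ 1) * exp (\<i> * kk m z * of_real \<bar>x\<bar>)"
  by (simp_all add: Tsol_def)

lemma Tsol_lincomb: "Tsol m z (a *s v + b *s w) x = a *s Tsol m z v x + b *s Tsol m z w x"
  by (simp add: vec2_eq_iff Tsol_nth algebra_simps add_divide_distrib)

text \<open>The origin of M: the jump is 2 c \<sigma>1 v and the sum of traces is 2 h + 2 c Z v, so
  the condition reads 4 i c v = 2 A h + 2 c A Z v, that is 2 i c (v + (i/2) A Z v) = A h.\<close>

lemma bc_Tsol:
  assumes "zeta m z \<noteq> 0"
  shows "bc A (h + c *s vector [zeta m z * v $ 1 + v $ 2, v $ 2 / zeta m z + v $ 1])
      (h + c *s vector [zeta m z * v $ 1 - v $ 2, v $ 2 / zeta m z - v $ 1])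
    \<longleftrightarrow> (2 * \<i> * c) *s (MM m A z *v v) = A *v h"
proof -
  have aux: "2 * \<i> * (2 * (c * x)) = 2 * s + 2 * (c * t) \<longleftrightarrow> 2 * \<i> * c * (x + \<i> / 2 * t) = s"
    for x s t :: complex
  proof -
    have "2 * \<i> * (2 * (c * x)) - (2 * s + 2 * (c * t)) = 2 * (2 * \<i> * c * (x + \<i> / 2 * t) - s)"
      by (simp add: algebra_simps)
    then show ?thesis by (metis eq_iff_diff_eq_0 mult_eq_0_iff zero_neq_numeral)
  qed
  have 1: "2 * \<i> * ((h $ 2 + c * (v $ 2 / zeta m z + v $ 1)) - (h $ 2 + c * (v $ 2 / zeta m z - v $ 1)))
     = 2 * \<i> * (2 * (c * v $ 1))"
    "2 * \<i> * ((h $ 1 + c * (zeta m z * v $ 1 + v $ 2)) - (h $ 1 + c * (zeta m z * v $ 1 - v $ 2)))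
     = 2 * \<i> * (2 * (c * v $ 2))"
    by (simp_all add: algebra_simps)
  have 2: "p * ((h $ 1 + c * (zeta m z * v $ 1 + v $ 2)) + (h $ 1 + c * (zeta m z * v $ 1 - v $ 2))) +
     q * ((h $ 2 + c * (v $ 2 / zeta m z + v $ 1)) + (h $ 2 + c * (v $ 2 / zeta m z - v $ 1)))
     = 2 * (p * h $ 1 + q * h $ 2) + 2 * (c * (p * zeta m z * v $ 1 + q / zeta m z * v $ 2))" for p q
    by (simp add: algebra_simps)
  have 3: "(MM m A z *v v) $ 1 = v $ 1 + \<i> / 2 * (A $ 1 $ 1 * zeta m z * v $ 1 + A $ 1 $ 2 / zeta m z * v $ 2)"
    "(MM m A z *v v) $ 2 = v $ 2 + \<i> / 2 * (A $ 2 $ 1 * zeta m z * v $ 1 + A $ 2 $ 2 / zeta m z * v $ 2)"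
    unfolding mat2_mult_nth MM_nth by (simp_all add: algebra_simps)
  show ?thesis
    unfolding bc_def vector_add_component vector_smult_component vector_2 1 2 aux
    unfolding vec2_eq_iff vector_smult_component 3 mat2_mult_nth[of A] by blast
qed

lemma eigenfunction_form:
  assumes z: "z \<notin> cut_set m" and "dirac_graph m A \<psi> (\<lambda>x. z *s \<psi> x)"
  obtains v where "MM m A z *v v = 0" "AE x in lborel. \<psi> x = Tsol m z v x"
proof -
  note k = kk_zeta[OF z]
  have "dirac_graph m A \<psi> (\<lambda>x. 0 + z *s \<psi> x)" using assms(2) by simp
  then obtain g gp gm where g: "L2 \<psi>" "AE x in lborel. \<psi> x = g x"
    "solves m z {0<..} (\<lambda>_. 0) g" "solves m z {..<0} (\<lambda>_. 0) g"
    "(g \<longlongrightarrow> gp) (at_right 0)" "(g \<longlongrightarrow> gm) (at_left 0)" "bc A gp gm"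
    by (rule dirac_graphE)
  obtain a where a: "\<And>x. x > 0 \<Longrightarrow> g x $ 1 = zeta m z * a * exp (\<i> * kk m z * of_real x)"
    "\<And>x. x > 0 \<Longrightarrow> g x $ 2 = a * exp (\<i> * kk m z * of_real x)" "Im (kk m z) = 0 \<Longrightarrow> a = 0"
    by (rule solves_hom_pos[OF g(3,1,2) k(2,3,4) less_imp_le[OF k(1)]]) auto
  obtain b where b: "\<And>x. x < 0 \<Longrightarrow> g x $ 1 = zeta m z * b * exp (- (\<i> * kk m z * of_real x))"
    "\<And>x. x < 0 \<Longrightarrow> g x $ 2 = - b * exp (- (\<i> * kk m z * of_real x))" "Im (kk m z) = 0 \<Longrightarrow> b = 0"
    by (rule solves_hom_neg[OF g(4,1,2) k(2,3,4) less_imp_le[OF k(1)]]) auto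
  \<comment> \<open>The solution of v1 + v2 / \<zeta> = a and v1 - v2 / \<zeta> = b, which matches
    the amplitudes on the right and on the left.\<close>
  define v :: cvec2 where "v = vector [(a + b) / 2, zeta m z * (a - b) / 2]"
  have v: "zeta m z * v $ 1 + v $ 2 = zeta m z * a" "v $ 2 / zeta m z + v $ 1 = a"
    "zeta m z * v $ 1 - v $ 2 = zeta m z * b" "v $ 2 / zeta m z - v $ 1 = - b"
    using k(4) by (simp_all add: v_def field_simps)
  have gT: "g x = Tsol m z v x" if "x \<noteq> 0" for x
  proof (cases "x > 0")
    case True
    then show ?thesis using a(1,2)[OF True] v by (simp add: vec2_eq_iff Tsol_nth)
  next
    case False
    then have "x < 0" using that by simp
    then show ?thesis using b(1,2)[OF \<open>x < 0\<close>] v by (simp add: vec2_eq_iff Tsol_nth)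
  qed
  have lim: "((\<lambda>x. a * exp (c * of_real x)) \<longlongrightarrow> a) (at (0::real) within S)" for a c :: complex and S
  proof -
    have "((\<lambda>x. a * exp (c * of_real x)) \<longlongrightarrow> a * exp (c * of_real 0)) (at (0::real) within S)"
      by (intro tendsto_intros)
    then show ?thesis by simp
  qed
  have gp: "gp = vector [zeta m z * a, a]"
  proof (rule tendsto_unique[OF _ g(5)])
    have "((\<lambda>x. vector [zeta m z * a * exp (\<i> * kk m z * of_real x), a * exp (\<i> * kk m z * of_real x)] :: cvec2)
        \<longlongrightarrow> vector [zeta m z * a, a]) (at_right 0)"
      unfolding vec2_tendsto_iff vector_2 by (intro conjI lim)
    then show "(g \<longlongrightarrow> vector [zeta m z * a, a]) (at_right 0)"
      by (rule Lim_transform_eventually)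
        (use a(1,2) in \<open>auto simp: eventually_at_right_less vec2_eq_iff eventually_at_filter\<close>)
  qed simp
  have gm: "gm = vector [zeta m z * b, - b]"
  proof (rule tendsto_unique[OF _ g(6)])
    have "((\<lambda>x. vector [zeta m z * b * exp (- (\<i> * kk m z) * of_real x), - b * exp (- (\<i> * kk m z) * of_real x)] :: cvec2)
        \<longlongrightarrow> vector [zeta m z * b, - b]) (at_left 0)"
      unfolding vec2_tendsto_iff vector_2 by (intro conjI lim)
    then show "(g \<longlongrightarrow> vector [zeta m z * b, - b]) (at_left 0)"
      by (rule Lim_transform_eventually)
        (use b(1,2) in \<open>auto simp: vec2_eq_iff eventually_at_filter\<close>)
  qed simp
  \<comment> \<open>The transmission condition with c = 1 and no free part, h = 0.\<close>
  have "(2 * \<i> * 1) *s (MM m A z *v v) = A *v 0"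
    using g(7) unfolding gp gm by (subst bc_Tsol[OF k(4), symmetric]) (simp add: v)
  then have "MM m A z *v v = 0" by (simp add: vec2_eq_iff mat2_mult_nth)
  moreover have "AE x in lborel. \<psi> x = Tsol m z v x"
    using g(2) AE_lborel_singleton[of 0] by eventually_elim (simp add: gT)
  ultimately show thesis by (rule that)
qed

section \<open>Square integrability and differential equation of the decaying solutions\<close>

lemma exp_abs_sqint:
  assumes k: "Im k > 0"
  shows "sqint (\<lambda>x. exp (\<i> * k * of_real \<bar>x\<bar>))"
    and "sqnorm (\<lambda>x. exp (\<i> * k * of_real \<bar>x\<bar>)) = 1 / Im k"
proof -
  have k2: "Im (2 * k) > 0" using k by simp
  note i = integrable_norm_ekern_right[OF k2, of 0]
  have i1: "integrable lborel (\<lambda>y. norm (ekern (2 * k) y))"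
    using lborel_integrable_real_affine[OF i(1), of "-1" 0] by simp
  have i2: "(\<integral>y. norm (ekern (2 * k) y) \<partial>lborel) = 1 / Im (2 * k)"
    using i(2) lborel_integral_real_affine[of "-1" "\<lambda>y. norm (ekern (2 * k) (0 - y))" 0] by simp
  \<comment> \<open>The squared modulus is the modulus of the kernel at 2k plus its reflection, so
    both claims follow from the L1 norm of \<open>ekern (2 * k)\<close>.\<close>
  have ae: "AE x in lborel. (norm (exp (\<i> * k * of_real \<bar>x\<bar>)))\<^sup>2 = norm (ekern (2 * k) x) + norm (ekern (2 * k) (0 - x))"
    using AE_lborel_singleton[of 0]
  proof eventually_elim
    case (elim x)
    have "(exp (- (Im k * \<bar>x\<bar>)))\<^sup>2 = exp (- (Im k * \<bar>x\<bar>) + - (Im k * \<bar>x\<bar>))"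
      by (simp only: exp_add power2_eq_square)
    then show ?case using elim by (auto simp: norm_ekern indicator_def)
  qed
  have m1: "(\<lambda>x::real. exp (\<i> * k * of_real \<bar>x\<bar>)) \<in> borel_measurable borel"
    by (intro borel_measurable_continuous_onI continuous_intros)
  have "integrable lborel (\<lambda>x. (norm (exp (\<i> * k * of_real \<bar>x\<bar>)))\<^sup>2)"
    by (subst integrable_cong_AE[OF _ _ ae]) (use i i1 m1 in auto)
  with m1 show "sqint (\<lambda>x. exp (\<i> * k * of_real \<bar>x\<bar>))" unfolding sqint_def by blast
  have "sqnorm (\<lambda>x. exp (\<i> * k * of_real \<bar>x\<bar>))
      = (\<integral>x. norm (ekern (2 * k) x) + norm (ekern (2 * k) (0 - x)) \<partial>lborel)"
    unfolding sqnorm_def by (rule integral_cong_AE[OF _ _ ae]) (use m1 in auto)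
  also have "\<dots> = 1 / Im (2 * k) + 1 / Im (2 * k)"
    using i i1 i2 by (subst Bochner_Integration.integral_add) auto
  finally show "sqnorm (\<lambda>x. exp (\<i> * k * of_real \<bar>x\<bar>)) = 1 / Im k" by simp
qed

lemma sqint_Tsol_comp:
  assumes k: "Im k > 0"
  shows "sqint (\<lambda>x. (a + of_real (sgn x) * b) * exp (\<i> * k * of_real \<bar>x\<bar>))"
    and "sqnorm (\<lambda>x. (a + of_real (sgn x) * b) * exp (\<i> * k * of_real \<bar>x\<bar>)) \<le> (norm a + norm b)\<^sup>2 / Im k"
proof -
  note e = exp_abs_sqint[OF k]
  note [measurable] = sqint_measurable[OF e(1)]
  have b: "norm ((a + of_real (sgn x) * b) * exp (\<i> * k * of_real \<bar>x\<bar>))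
      \<le> norm (of_real (norm a + norm b) * exp (\<i> * k * of_real \<bar>x\<bar>))" for x
  proof -
    have "norm (a + of_real (sgn x) * b) \<le> norm a + norm (of_real (sgn x) * b)" by (rule norm_triangle_ineq)
    also have "\<dots> \<le> norm a + norm b" by (simp add: norm_mult sgn_real_def)
    also have "\<dots> = norm (of_real (norm a + norm b) :: complex)" by (subst norm_of_real) simp
    finally show ?thesis unfolding norm_mult by (rule mult_right_mono) simp
  qed
  have s: "sqint (\<lambda>x. of_real (norm a + norm b) * exp (\<i> * k * of_real \<bar>x\<bar>))"
    by (rule sqint_mult_const[OF e(1)])
  show *: "sqint (\<lambda>x. (a + of_real (sgn x) * b) * exp (\<i> * k * of_real \<bar>x\<bar>))"
    by (rule sqint_bound[OF s _ b]) measurable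
  have "sqnorm (\<lambda>x. (a + of_real (sgn x) * b) * exp (\<i> * k * of_real \<bar>x\<bar>))
      \<le> sqnorm (\<lambda>x. of_real (norm a + norm b) * exp (\<i> * k * of_real \<bar>x\<bar>))"
    unfolding sqnorm_def by (intro integral_mono sqint_integrable[OF s] sqint_integrable[OF *] power_mono b) auto
  also have "\<dots> = (norm a + norm b)\<^sup>2 * sqnorm (\<lambda>x. exp (\<i> * k * of_real \<bar>x\<bar>))"
  proof -
    have n: "norm (of_real (norm a + norm b) :: complex) = norm a + norm b" by (subst norm_of_real) simp
    show ?thesis unfolding sqnorm_def norm_mult n power_mult_distrib by simp
  qed
  finally show "sqnorm (\<lambda>x. (a + of_real (sgn x) * b) * exp (\<i> * k * of_real \<bar>x\<bar>)) \<le> (norm a + norm b)\<^sup>2 / Im k"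
    by (simp add: e(2))
qed

lemma L2_Tsol:
  assumes "z \<notin> cut_set m"
  shows "L2 (Tsol m z v)"
  unfolding L2_iff Tsol_nth using sqint_Tsol_comp(1)[OF kk_zeta(1)[OF assms]] by blast

lemma exp_has_integral:
  fixes l c :: complex
  assumes "a \<le> b"
  shows "((\<lambda>x. l * (c * exp (l * of_real x))) has_integral c * exp (l * of_real b) - c * exp (l * of_real a)) {a..b}"
proof (rule fundamental_theorem_of_calculus[OF assms])
  fix x
  have "((\<lambda>w. c * exp (l * w)) has_field_derivative l * (c * exp (l * of_real x))) (at (of_real x))"
    by (auto intro!: derivative_eq_intros)
  then show "((\<lambda>x. c * exp (l * of_real x)) has_vector_derivative l * (c * exp (l * of_real x))) (at x within {a..b})"
    by (rule has_vector_derivative_real_field)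
qed

lemma solves_cong:
  assumes s: "solves m z S f g" and eq: "\<And>x. x \<in> S \<Longrightarrow> g x = g' x"
  shows "solves m z S f g'"
proof -
  have "((\<lambda>x. \<i> * (f x $ 2 + (z + m) * g' x $ 2)) has_integral g' b $ 1 - g' a $ 1) {a..b} \<and>
      ((\<lambda>x. \<i> * (f x $ 1 + (z - m) * g' x $ 1)) has_integral g' b $ 2 - g' a $ 2) {a..b}"
    if ab: "a \<le> b" "{a..b} \<subseteq> S" for a b
  proof -
    have mem: "x \<in> S" if "x \<in> {a..b}" for x using subsetD[OF ab(2) that] .
    have "a \<in> S" "b \<in> S" using ab(1) by (auto intro!: mem)
    then have ends: "g' a = g a" "g' b = g b" using eq by simp_all
    have i: "((\<lambda>x. \<i> * (f x $ 2 + (z + m) * g x $ 2)) has_integral g b $ 1 - g a $ 1) {a..b}"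
      "((\<lambda>x. \<i> * (f x $ 1 + (z - m) * g x $ 1)) has_integral g b $ 2 - g a $ 2) {a..b}"
      using s ab unfolding solves_def by blast+
    show ?thesis unfolding ends
      by (intro conjI has_integral_eq[OF _ i(1)] has_integral_eq[OF _ i(2)]) (simp_all only: eq[OF mem])
  qed
  moreover have "continuous_on S (\<lambda>x. g' x $ 1)"
    by (rule continuous_on_eq[of _ "\<lambda>x. g x $ 1"]) (use s eq in \<open>auto simp: solves_def\<close>)
  moreover have "continuous_on S (\<lambda>x. g' x $ 2)"
    by (rule continuous_on_eq[of _ "\<lambda>x. g x $ 2"]) (use s eq in \<open>auto simp: solves_def\<close>)
  ultimately show ?thesis unfolding solves_def by blast
qed

lemma solves_Tsol:
  assumes z: "z \<notin> cut_set m"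
  shows "solves m z {0<..} (\<lambda>_. 0) (Tsol m z v)" "solves m z {..<0} (\<lambda>_. 0) (Tsol m z v)"
proof -
  note k = kk_zeta[OF z]
  \<comment> \<open>The sign e treats both half-lines at once: e = 1 is the wave decaying to the
    right, e = -1 the one decaying to the left.\<close>
  have *: "solves m z S (\<lambda>_. 0) (\<lambda>x. vector [(zeta m z * a) * exp (e * \<i> * kk m z * of_real x),
      e * a * exp (e * \<i> * kk m z * of_real x)])" if e: "e * e = 1" for e a S
  proof -
    have i: "((\<lambda>x. e * \<i> * kk m z * (zeta m z * a * exp (e * \<i> * kk m z * of_real x))) has_integral
        zeta m z * a * exp (e * \<i> * kk m z * of_real t) - zeta m z * a * exp (e * \<i> * kk m z * of_real s)) {s..t}"
       "((\<lambda>x. e * \<i> * kk m z * (e * a * exp (e * \<i> * kk m z * of_real x))) has_integral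
        e * a * exp (e * \<i> * kk m z * of_real t) - e * a * exp (e * \<i> * kk m z * of_real s)) {s..t}"
      if "s \<le> t" for s t by (intro exp_has_integral that)+
    have eq1: "\<i> * ((z + m) * (e * a * E)) = e * \<i> * kk m z * (zeta m z * a * E)" for E
      unfolding k(2)[symmetric] by (simp only: mult_ac)
    have eq2: "e * \<i> * kk m z * (e * a * E) = \<i> * ((z - m) * (zeta m z * a * E))" for E
    proof -
      have "e * \<i> * kk m z * (e * a * E) = (e * e) * (\<i> * (kk m z * (a * E)))" by (simp only: mult_ac)
      also have "\<dots> = \<i> * ((z - m) * (zeta m z * a * E))"
        unfolding e k(3)[symmetric] by (simp only: mult_ac mult_1_left)
      finally show ?thesis .
    qed
    show ?thesis
      unfolding solves_def vector_2 zero_index add_0 eq1 eq2[symmetric]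
      by (intro conjI allI impI i continuous_intros)
  qed
  show "solves m z {0<..} (\<lambda>_. 0) (Tsol m z v)"
    by (rule solves_cong[OF *[of 1 _ "v $ 2 / zeta m z + v $ 1"]])
      (use k(4) in \<open>auto simp: vec2_eq_iff Tsol_nth distrib_left\<close>)
  show "solves m z {..<0} (\<lambda>_. 0) (Tsol m z v)"
    by (rule solves_cong[OF *[of "-1" _ "v $ 1 - v $ 2 / zeta m z"]])
      (use k(4) in \<open>auto simp: vec2_eq_iff Tsol_nth right_diff_distrib\<close>)
qed

lemma solves_add_hom:
  assumes "solves m z S f g" "solves m z S (\<lambda>_. 0) h"
  shows "solves m z S f (\<lambda>x. g x + c *s h x)"
proof -
  have "((\<lambda>x. \<i> * (f x $ i + d * (g x + c *s h x) $ j)) has_integral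
     (g b + c *s h b) $ l - (g a + c *s h a) $ l) {a..b}"
    if "((\<lambda>x. \<i> * (f x $ i + d * g x $ j)) has_integral g b $ l - g a $ l) {a..b}"
      "((\<lambda>x. \<i> * (0 $ i + d * h x $ j)) has_integral h b $ l - h a $ l) {a..b}" for a b i j d l
  proof -
    have "((\<lambda>x. \<i> * (f x $ i + d * g x $ j) + c * (\<i> * (0 $ i + d * h x $ j))) has_integral
      (g b $ l - g a $ l) + c * (h b $ l - h a $ l)) {a..b}"
      by (intro has_integral_add has_integral_mult_right that)
    then show ?thesis by (simp add: algebra_simps)
  qed
  moreover have "continuous_on S (\<lambda>x. (g x + c *s h x) $ i)"
    if "continuous_on S (\<lambda>x. g x $ i)" "continuous_on S (\<lambda>x. h x $ i)" for i
    using that by (auto intro!: continuous_on_add continuous_on_mult_left)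
  ultimately show ?thesis using assms unfolding solves_def by blast
qed

section \<open>The free resolvent: source terms and solutions of the two scalar equations\<close>

definition Fp :: "real \<Rightarrow> complex \<Rightarrow> (real \<Rightarrow> cvec2) \<Rightarrow> real \<Rightarrow> complex" where
  "Fp m z f y = \<i> * (f y $ 2 + zeta m z * f y $ 1)"

definition Fm :: "real \<Rightarrow> complex \<Rightarrow> (real \<Rightarrow> cvec2) \<Rightarrow> real \<Rightarrow> complex" where
  "Fm m z f y = \<i> * (f y $ 2 - zeta m z * f y $ 1)"

definition Pv :: "real \<Rightarrow> complex \<Rightarrow> (real \<Rightarrow> cvec2) \<Rightarrow> real \<Rightarrow> complex" where
  "Pv m z f x = volt (kk m z) (Fp m z f) x"

text \<open>The equation \<open>u' = - i k u + F\<close> has its square-integrable solution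
  determined from \<open>+\<infinity>\<close>; reflection reduces it to \<open>volt\<close>, and the
  outer minus sign compensates the sign that reflection gives to the derivative.\<close>

definition Qv :: "real \<Rightarrow> complex \<Rightarrow> (real \<Rightarrow> cvec2) \<Rightarrow> real \<Rightarrow> complex" where
  "Qv m z f x = - volt (kk m z) (\<lambda>y. Fm m z f (- y)) (- x)"

text \<open>The free resolvent: \<open>g\<^sub>1 \<plusminus> \<zeta> g\<^sub>2\<close> solve decoupled scalar equations.\<close>
definition Rsol :: "real \<Rightarrow> complex \<Rightarrow> (real \<Rightarrow> cvec2) \<Rightarrow> real \<Rightarrow> cvec2" where
  "Rsol m z f x = vector [(Pv m z f x + Qv m z f x) / 2, (Pv m z f x - Qv m z f x) / (2 * zeta m z)]"

lemma Rsol_nth: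
  "Rsol m z f x $ 1 = (Pv m z f x + Qv m z f x) / 2"
  "Rsol m z f x $ 2 = (Pv m z f x - Qv m z f x) / (2 * zeta m z)"
  by (simp_all add: Rsol_def)

lemma sqint_F:
  assumes "L2 f"
  shows "sqint (Fp m z f)" "sqint (Fm m z f)" "sqint (\<lambda>y. Fm m z f (- y))"
proof -
  show "sqint (Fp m z f)" and *: "sqint (Fm m z f)"
    using assms unfolding L2_iff Fp_def Fm_def
    by (auto intro!: sqint_mult_const sqint_add sqint_diff)
  show "sqint (\<lambda>y. Fm m z f (- y))" by (rule sqint_reflect[OF *])
qed

lemma PQ_has_integral:
  assumes z: "z \<notin> cut_set m" and f: "L2 f" and ab: "a \<le> b"
  shows "((\<lambda>x. \<i> * kk m z * Pv m z f x + Fp m z f x) has_integral Pv m z f b - Pv m z f a) {a..b}"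
    "((\<lambda>x. - (\<i> * kk m z * Qv m z f x) + Fm m z f x) has_integral Qv m z f b - Qv m z f a) {a..b}"
proof -
  note k = kk_zeta[OF z]
  show "((\<lambda>x. \<i> * kk m z * Pv m z f x + Fp m z f x) has_integral Pv m z f b - Pv m z f a) {a..b}"
    unfolding Pv_def by (rule volt_has_integral[OF k(1) sqint_F(1)[OF f] ab])
  have "((\<lambda>x. \<i> * kk m z * volt (kk m z) (\<lambda>y. Fm m z f (- y)) x + Fm m z f (- x)) has_integral
     volt (kk m z) (\<lambda>y. Fm m z f (- y)) (- a) - volt (kk m z) (\<lambda>y. Fm m z f (- y)) (- b)) {- b..- a}"
    by (rule volt_has_integral[OF k(1) sqint_F(3)[OF f]]) (use ab in simp)
  from has_integral_reflect_real[THEN iffD2, OF this]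
  show "((\<lambda>x. - (\<i> * kk m z * Qv m z f x) + Fm m z f x) has_integral Qv m z f b - Qv m z f a) {a..b}"
    by (simp add: Qv_def)
qed

lemma PQ_continuous:
  assumes "z \<notin> cut_set m" "L2 f"
  shows "continuous_on UNIV (Pv m z f)" "continuous_on UNIV (Qv m z f)"
  by (rule continuous_on_if_has_integral, rule PQ_has_integral[OF assms], assumption)+

lemma solves_Rsol:
  assumes z: "z \<notin> cut_set m" and f: "L2 f"
  shows "solves m z S f (Rsol m z f)"
proof -
  note k = kk_zeta[OF z]
  note c = PQ_continuous[OF z f, THEN continuous_on_subset, OF subset_UNIV]
  let ?P = "Pv m z f" and ?Q = "Qv m z f"
  have "((\<lambda>x. \<i> * (f x $ 2 + (z + m) * Rsol m z f x $ 2)) has_integral Rsol m z f b $ 1 - Rsol m z f a $ 1) {a..b} \<and>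
      ((\<lambda>x. \<i> * (f x $ 1 + (z - m) * Rsol m z f x $ 1)) has_integral Rsol m z f b $ 2 - Rsol m z f a $ 2) {a..b}"
    if "a \<le> b" for a b
  proof
    note i = PQ_has_integral[OF z f that]
    have "\<i> * (f x $ 2 + (z + m) * Rsol m z f x $ 2)
      = ((\<i> * kk m z * ?P x + Fp m z f x) + (- (\<i> * kk m z * ?Q x) + Fm m z f x)) * (1 / 2)" for x
      unfolding Rsol_nth Fp_def Fm_def k(2)[symmetric] using k(4) by (simp add: field_simps)
    moreover have "Rsol m z f b $ 1 - Rsol m z f a $ 1 = ((?P b - ?P a) + (?Q b - ?Q a)) * (1 / 2)"
      by (simp add: Rsol_nth diff_divide_distrib add_divide_distrib)
    ultimately show "((\<lambda>x. \<i> * (f x $ 2 + (z + m) * Rsol m z f x $ 2)) has_integral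
        Rsol m z f b $ 1 - Rsol m z f a $ 1) {a..b}"
      using has_integral_mult_left[OF has_integral_add[OF i], of "1/2"] by (simp only:)
    have "\<i> * (f x $ 1 + (z - m) * Rsol m z f x $ 1)
      = ((\<i> * kk m z * ?P x + Fp m z f x) - (- (\<i> * kk m z * ?Q x) + Fm m z f x)) * (1 / (2 * zeta m z))" for x
      unfolding Rsol_nth Fp_def Fm_def k(3)[symmetric] using k(4) by (simp add: field_simps)
    moreover have "Rsol m z f b $ 2 - Rsol m z f a $ 2 = ((?P b - ?P a) - (?Q b - ?Q a)) * (1 / (2 * zeta m z))"
      by (simp add: Rsol_nth diff_divide_distrib)
    ultimately show "((\<lambda>x. \<i> * (f x $ 1 + (z - m) * Rsol m z f x $ 1)) has_integral
        Rsol m z f b $ 2 - Rsol m z f a $ 2) {a..b}"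
      using has_integral_mult_left[OF has_integral_diff[OF i], of "1 / (2 * zeta m z)"] by simp
  qed
  moreover have "continuous_on S (\<lambda>x. Rsol m z f x $ 1)" "continuous_on S (\<lambda>x. Rsol m z f x $ 2)"
    unfolding Rsol_nth using k(4) by (auto intro!: continuous_intros c)
  ultimately show ?thesis unfolding solves_def by blast
qed

lemma sqint_PQ:
  assumes z: "z \<notin> cut_set m" and f: "L2 f"
  shows "sqint (Pv m z f)" "sqint (Qv m z f)"
proof -
  note k = kk_zeta[OF z]
  show "sqint (Pv m z f)"
    using volt_sqint(1)[OF k(1) sqint_F(1)[OF f]] by (simp add: Pv_def[abs_def])
  show "sqint (Qv m z f)"
    using sqint_uminus[OF sqint_reflect[OF volt_sqint(1)[OF k(1) sqint_F(3)[OF f]]]]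
    by (simp add: Qv_def[abs_def])
qed

lemma L2_Rsol:
  assumes z: "z \<notin> cut_set m" and f: "L2 f"
  shows "L2 (Rsol m z f)"
proof -
  have "sqint (\<lambda>x. (1 / 2) * (Pv m z f x + Qv m z f x))"
    "sqint (\<lambda>x. 1 / (2 * zeta m z) * (Pv m z f x - Qv m z f x))"
    using sqint_PQ[OF z f] by (auto intro!: sqint_mult_const sqint_add sqint_diff simp del: times_divide_eq_left)
  then show ?thesis unfolding L2_iff Rsol_nth by simp
qed

text \<open>The free constant c allows two uses: f = 0 with c = 1 produces eigenfunctions, and c =
  -i/2, where 2 i c = 1, produces the resolvent.\<close>

lemma dirac_solution:
  assumes z: "z \<notin> cut_set m" and f: "L2 f" and v: "(2 * \<i> * c) *s (MM m A z *v v) = A *v Rsol m z f 0"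
  defines "\<psi> \<equiv> (\<lambda>x. Rsol m z f x + c *s Tsol m z v x)"
  shows "dirac_graph m A \<psi> (\<lambda>x. f x + z *s \<psi> x)"
proof -
  note k = kk_zeta[OF z]
  have limR: "(Rsol m z f \<longlongrightarrow> Rsol m z f 0) (at 0 within S)" for S
    using solves_Rsol[OF z f, of UNIV] unfolding solves_def vec2_tendsto_iff
    by (meson UNIV_I continuous_on_def tendsto_within_subset subset_UNIV)
  have limE: "((\<lambda>x. exp (\<i> * kk m z * of_real \<bar>x\<bar>)) \<longlongrightarrow> 1) (at (0::real) within S)" for S
  proof -
    have "((\<lambda>x. exp (\<i> * kk m z * of_real \<bar>x\<bar>)) \<longlongrightarrow> exp (\<i> * kk m z * of_real \<bar>0\<bar>)) (at (0::real) within S)"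
      by (intro tendsto_intros)
    then show ?thesis by simp
  qed
  have sp: "((\<lambda>x. of_real (sgn x)) \<longlongrightarrow> (1::complex)) (at_right (0::real))"
    by (rule tendsto_eventually) (auto simp: eventually_at_filter)
  have sm: "((\<lambda>x. of_real (sgn x)) \<longlongrightarrow> (-1::complex)) (at_left (0::real))"
    by (rule tendsto_eventually) (auto simp: eventually_at_filter)
  have T: "((\<lambda>x. (a + of_real (sgn x) * b) * exp (\<i> * kk m z * of_real \<bar>x\<bar>)) \<longlongrightarrow> a + b) (at_right (0::real))"
    "((\<lambda>x. (a + of_real (sgn x) * b) * exp (\<i> * kk m z * of_real \<bar>x\<bar>)) \<longlongrightarrow> a - b) (at_left (0::real))" for a b
    using tendsto_mult[OF tendsto_add[OF tendsto_const tendsto_mult[OF sp tendsto_const]] limE]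
      tendsto_mult[OF tendsto_add[OF tendsto_const tendsto_mult[OF sm tendsto_const]] limE]
    by (auto simp: )
  show ?thesis unfolding \<psi>_def
  proof (rule dirac_graphI[OF f])
    show "L2 (\<lambda>x. Rsol m z f x + c *s Tsol m z v x)"
      using L2_lincomb[OF L2_Rsol[OF z f] L2_Tsol[OF z], of 1 c] by simp
    show "bc A (Rsol m z f 0 + c *s vector [zeta m z * v $ 1 + v $ 2, v $ 2 / zeta m z + v $ 1])
      (Rsol m z f 0 + c *s vector [zeta m z * v $ 1 - v $ 2, v $ 2 / zeta m z - v $ 1])"
      unfolding bc_Tsol[OF k(4)] by (rule v)
    show "((\<lambda>x. Rsol m z f x + c *s Tsol m z v x) \<longlongrightarrow>
       Rsol m z f 0 + c *s vector [zeta m z * v $ 1 + v $ 2, v $ 2 / zeta m z + v $ 1]) (at_right 0)"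
      by (intro tendsto_add limR tendsto_vector_scalar_mult)
        (simp add: vec2_tendsto_iff Tsol_nth T)
    show "((\<lambda>x. Rsol m z f x + c *s Tsol m z v x) \<longlongrightarrow>
       Rsol m z f 0 + c *s vector [zeta m z * v $ 1 - v $ 2, v $ 2 / zeta m z - v $ 1]) (at_left 0)"
      by (intro tendsto_add limR tendsto_vector_scalar_mult)
        (simp add: vec2_tendsto_iff Tsol_nth T)
  qed (intro solves_add_hom solves_Rsol z f solves_Tsol)+
qed

section \<open>The resolvent kernel\<close>

lemma Rsol_zero: "Rsol m z (\<lambda>_. 0) x = 0"
  by (simp add: vec2_eq_iff Rsol_nth Pv_def Qv_def Fp_def Fm_def volt_def)

lemma L2_zero: "L2 (\<lambda>_. 0)"
  by (simp add: L2_iff sqint_zero)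

lemma Tsol_eigenfunction:
  assumes "z \<notin> cut_set m" "MM m A z *v v = 0"
  shows "dirac_graph m A (Tsol m z v) (\<lambda>x. z *s Tsol m z v x)"
  using dirac_solution[OF assms(1) L2_zero, where c=1 and v=v and A=A] assms(2)
  by (simp add: Rsol_zero)

lemma AE_lborel_ex:
  assumes "AE x in lborel. P (x::real)" "a < b"
  obtains x where "a < x" "x < b" "P x"
proof -
  have "\<not> (AE x in lborel. x \<notin> {a<..<b})"
  proof
    assume "AE x in lborel. x \<notin> {a<..<b}"
    then have "emeasure lborel {a<..<b} = 0"
      by (subst (asm) AE_iff_measurable[of "{a<..<b}"]) auto
    then show False using assms(2) by simp
  qed
  then have "\<exists>x. x \<in> {a<..<b} \<and> P x"
    using assms(1) by (metis (mono_tags, lifting) AE_mp AE_I2)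
  then show thesis using that by auto
qed

text \<open>The exponential factor never vanishes, so one good point on each side of 0 yields the
  two equations v2 / \<zeta> + v1 = 0 and v2 / \<zeta> - v1 = 0.\<close>

lemma Tsol_AE_zero:
  assumes z: "z \<notin> cut_set m" and T: "AE x in lborel. Tsol m z v x = 0"
  shows "v = 0"
proof -
  note k = kk_zeta[OF z]
  obtain x where x: "0 < x" "Tsol m z v x = 0" by (rule AE_lborel_ex[OF T, of 0 1]) auto
  obtain y where y: "y < 0" "Tsol m z v y = 0" by (rule AE_lborel_ex[OF T, of "-1" 0]) auto
  have "v $ 2 / zeta m z + v $ 1 = 0" using x by (simp add: vec2_eq_iff Tsol_nth)
  moreover have "v $ 2 / zeta m z - v $ 1 = 0" using y by (simp add: vec2_eq_iff Tsol_nth)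
  ultimately have "2 * v $ 1 = 0" "2 * (v $ 2 / zeta m z) = 0" by algebra+
  then show ?thesis using k(4) by (simp add: vec2_eq_iff)
qed

lemma MM_kernel_trivial:
  fixes M :: cmat2
  assumes "det M \<noteq> 0" "M *v v = 0"
  shows "v = 0"
  using assms by (metis invertible_det_nz matrix_left_invertible_ker invertible_def)

lemma dirac_unique:
  assumes z: "z \<notin> cut_set m" and d: "det (MM m A z) \<noteq> 0"
    and "dirac_graph m A \<psi> (\<lambda>x. f x + z *s \<psi> x)" "dirac_graph m A \<psi>' (\<lambda>x. f x + z *s \<psi>' x)"
  shows "AE x in lborel. \<psi> x = \<psi>' x"
proof -
  have "dirac_graph m A (\<lambda>x. 1 *s \<psi> x + (-1) *s \<psi>' x)
     (\<lambda>x. 1 *s (f x + z *s \<psi> x) + (-1) *s (f x + z *s \<psi>' x))"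
    by (rule dirac_graph_lincomb[OF assms(3,4)])
  then have "dirac_graph m A (\<lambda>x. \<psi> x - \<psi>' x) (\<lambda>x. z *s (\<psi> x - \<psi>' x))"
    by (simp add: vec.scale_right_diff_distrib vec.scale_minus_left)
  then obtain v where v: "MM m A z *v v = 0" "AE x in lborel. \<psi> x - \<psi>' x = Tsol m z v x"
    by (rule eigenfunction_form[OF z])
  have "v = 0" by (rule MM_kernel_trivial[OF d v(1)])
  show ?thesis using v(2) by eventually_elim (simp add: \<open>v = 0\<close> Tsol_def vec2_eq_iff)
qed

lemma MM_inv:
  fixes M :: cmat2
  assumes "det M \<noteq> 0"
  shows "M *v (matrix_inv M *v w) = w"
proof -
  obtain B where "M ** B = mat 1 \<and> B ** M = mat 1"
    using assms unfolding invertible_det_nz[symmetric] invertible_def by blast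
  then have "M ** matrix_inv M = mat 1 \<and> matrix_inv M ** M = mat 1"
    unfolding matrix_inv_def by (rule someI)
  then show ?thesis by (simp add: matrix_vector_mul_assoc)
qed

text \<open>Krein's resolvent formula applied to f. The coefficient -i/2 solves 2 i c = 1 and at the
  same time turns \<open>Tsol\<close> into minus the kernel R_z(x,0).\<close>

definition res_sol :: "real \<Rightarrow> cmat2 \<Rightarrow> complex \<Rightarrow> (real \<Rightarrow> cvec2) \<Rightarrow> real \<Rightarrow> cvec2" where
  "res_sol m A z f x =
    Rsol m z f x + (- \<i> / 2) *s Tsol m z (matrix_inv (MM m A z) *v (A *v Rsol m z f 0)) x"

lemma dirac_graph_res_sol:
  assumes z: "z \<notin> cut_set m" and d: "det (MM m A z) \<noteq> 0" and f: "L2 f"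
  shows "dirac_graph m A (res_sol m A z f) (\<lambda>x. f x + z *s res_sol m A z f x)"
proof -
  have "dirac_graph m A (\<lambda>x. res_sol m A z f x) (\<lambda>x. f x + z *s res_sol m A z f x)"
    unfolding res_sol_def
    by (rule dirac_solution[OF z f]) (simp add: MM_inv[OF d] vec.scale_one)
  then show ?thesis .
qed

lemma ekern_reflect_integral:
  assumes k: "Im k > 0" and G: "sqint G"
  shows "integrable lborel (\<lambda>y. ekern k (y - x) * G y)"
    and "(\<integral>y. ekern k (y - x) * G y \<partial>lborel) = volt k (\<lambda>y. G (- y)) (- x)"
proof -
  note i = volt_integrable(2)[OF k sqint_reflect[OF G], of "- x"]
  show "integrable lborel (\<lambda>y. ekern k (y - x) * G y)"
    using lborel_integrable_real_affine[OF i, of "-1" 0] by (simp add: algebra_simps)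
  show "(\<integral>y. ekern k (y - x) * G y \<partial>lborel) = volt k (\<lambda>y. G (- y)) (- x)"
    using lborel_integral_real_affine[of "-1" "\<lambda>y. ekern k (- x - y) * G (- y)" 0]
    by (simp add: volt_def algebra_simps)
qed

lemma RR_nth:
  "(RR m z x y *v w) $ 1 = \<i> / 2 * (zeta m z * w $ 1 + of_real (sgn (x - y)) * w $ 2) * exp (\<i> * kk m z * of_real \<bar>x - y\<bar>)"
  "(RR m z x y *v w) $ 2 = \<i> / 2 * (w $ 2 / zeta m z + of_real (sgn (x - y)) * w $ 1) * exp (\<i> * kk m z * of_real \<bar>x - y\<bar>)"
  by (simp_all add: mat2_mult_nth RR_def ZZ_def sigma1_def inverse_eq_divide algebra_simps)

lemma RR_Tsol: "RR m z x 0 *v w = (\<i> / 2) *s Tsol m z w x"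
  by (simp add: vec2_eq_iff RR_nth Tsol_nth mult.assoc)

text \<open>The sign in the kernel selects one scalar equation on each side: for y < x only the
  \<open>Fp\<close> term is present, for y > x only the \<open>Fm\<close> term, and y = x is a null
  set.\<close>

lemma RR_integral_comp:
  assumes z: "z \<notin> cut_set m" and f: "L2 f"
  shows "has_bochner_integral lborel (\<lambda>y. (RR m z x y *v f y) $ 1) (Rsol m z f x $ 1)"
    and "has_bochner_integral lborel (\<lambda>y. (RR m z x y *v f y) $ 2) (Rsol m z f x $ 2)"
proof -
  note k = kk_zeta[OF z]
  let ?p = "\<lambda>y. ekern (kk m z) (x - y) * Fp m z f y" and ?q = "\<lambda>y. ekern (kk m z) (y - x) * Fm m z f y"
  have p: "has_bochner_integral lborel ?p (Pv m z f x)"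
    unfolding has_bochner_integral_iff Pv_def volt_def
    using volt_integrable(2)[OF k(1) sqint_F(1)[OF f]] by simp
  have q: "has_bochner_integral lborel ?q (- Qv m z f x)"
    unfolding has_bochner_integral_iff Qv_def
    using ekern_reflect_integral[OF k(1) sqint_F(2)[OF f]] by simp
  have [measurable]: "(\<lambda>y. f y $ 1) \<in> borel_measurable borel" "(\<lambda>y. f y $ 2) \<in> borel_measurable borel"
    "Fp m z f \<in> borel_measurable borel" "Fm m z f \<in> borel_measurable borel"
    using f sqint_F[OF f] by (auto simp: L2_iff sqint_def)
  have [measurable]: "(\<lambda>y::real. exp (\<i> * kk m z * of_real \<bar>x - y\<bar>)) \<in> borel_measurable borel"
    by (intro borel_measurable_continuous_onI continuous_intros)
  have 1: "AE y in lborel. (?p y - ?q y) * (1 / 2) = (RR m z x y *v f y) $ 1"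
    using AE_lborel_singleton[of x]
  proof eventually_elim
    case (elim y)
    then consider "x < y" | "y < x" by fastforce
    then show ?case
      by cases (simp_all add: RR_nth ekern_def Fp_def Fm_def algebra_simps)
  qed
  have 2: "AE y in lborel. (?p y + ?q y) * (1 / (2 * zeta m z)) = (RR m z x y *v f y) $ 2"
    using AE_lborel_singleton[of x]
  proof eventually_elim
    case (elim y)
    then consider "x < y" | "y < x" by fastforce
    then show ?case
      using k(4) by cases (simp_all add: RR_nth ekern_def Fp_def Fm_def field_simps)
  qed
  have "has_bochner_integral lborel (\<lambda>y. (?p y - ?q y) * (1 / 2)) (Rsol m z f x $ 1)"
    using has_bochner_integral_mult_left[OF has_bochner_integral_diff[OF p q], of "1 / 2"]
    by (simp add: Rsol_nth)
  then show "has_bochner_integral lborel (\<lambda>y. (RR m z x y *v f y) $ 1) (Rsol m z f x $ 1)"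
    by (subst (asm) has_bochner_integral_cong_AE[OF _ _ 1]) (simp_all add: RR_nth)
  have "has_bochner_integral lborel (\<lambda>y. (?p y + ?q y) * (1 / (2 * zeta m z))) (Rsol m z f x $ 2)"
    using has_bochner_integral_mult_left[OF has_bochner_integral_add[OF p q], of "1 / (2 * zeta m z)"]
    by (simp add: Rsol_nth)
  then show "has_bochner_integral lborel (\<lambda>y. (RR m z x y *v f y) $ 2) (Rsol m z f x $ 2)"
    by (subst (asm) has_bochner_integral_cong_AE[OF _ _ 2]) (simp_all add: RR_nth)
qed

lemma RR_integral:
  assumes z: "z \<notin> cut_set m" and f: "L2 f"
  shows "has_bochner_integral lborel (\<lambda>y. RR m z x y *v f y) (Rsol m z f x)"
proof -
  have "has_bochner_integral lborel
      (\<lambda>y. axis 1 ((RR m z x y *v f y) $ 1) + axis 2 ((RR m z x y *v f y) $ 2) :: cvec2)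
      (axis 1 (Rsol m z f x $ 1) + axis 2 (Rsol m z f x $ 2))"
    by (intro has_bochner_integral_add has_bochner_integral_bounded_linear[OF bounded_linear_axis]
        RR_integral_comp[OF z f])
  then show ?thesis by (simp only: vec2_axis[symmetric])
qed

lemma res_kernel_integral:
  assumes z: "z \<notin> cut_set m" and f: "L2 f"
  shows "has_bochner_integral lborel (\<lambda>y. res_kernel m A z x y *v f y) (res_sol m A z f x)"
proof -
  \<comment> \<open>For fixed x a constant matrix, so it passes through the integral of R_z(0,y)
    f(y), which is the value of the free solution at 0.\<close>
  define B where "B = RR m z x 0 ** matrix_inv (MM m A z) ** A"
  have "has_bochner_integral lborel (\<lambda>y. RR m z x y *v f y - B *v (RR m z 0 y *v f y))
      (Rsol m z f x - B *v Rsol m z f 0)"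
    by (intro has_bochner_integral_diff RR_integral[OF z f]
        has_bochner_integral_bounded_linear[OF matrix_vector_mul_bounded_linear])
  moreover have "res_kernel m A z x y *v f y = RR m z x y *v f y - B *v (RR m z 0 y *v f y)" for y
    by (simp add: res_kernel_def B_def matrix_vector_mult_diff_rdistrib matrix_vector_mul_assoc)
  moreover have "B *v Rsol m z f 0 = (\<i> / 2) *s Tsol m z (matrix_inv (MM m A z) *v (A *v Rsol m z f 0)) x"
    unfolding B_def RR_Tsol[symmetric] by (simp add: matrix_vector_mul_assoc matrix_mul_assoc)
  ultimately show ?thesis
    by (simp add: res_sol_def vec.scale_minus_left)
qed

section \<open>Resolvent bounds and singular sequences on the continuous spectrum\<close>

lemma sqnorm_le:
  fixes g :: "real \<Rightarrow> 'a::real_normed_vector" and f :: "real \<Rightarrow> 'b::real_normed_vector"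
  assumes "integrable lborel (\<lambda>x. (norm (g x))\<^sup>2)" "integrable lborel (\<lambda>x. (norm (f x))\<^sup>2)"
    and "\<And>x. (norm (g x))\<^sup>2 \<le> c * (norm (f x))\<^sup>2"
  shows "sqnorm g \<le> c * sqnorm f"
proof -
  have "sqnorm g \<le> (\<integral>x. c * (norm (f x))\<^sup>2 \<partial>lborel)"
    unfolding sqnorm_def using assms by (intro integral_mono) auto
  then show ?thesis by (simp add: sqnorm_def)
qed

lemma sqnorm_add_le:
  fixes g h :: "real \<Rightarrow> 'a::real_normed_vector"
  assumes "integrable lborel (\<lambda>x. (norm (g x + h x))\<^sup>2)"
    "integrable lborel (\<lambda>x. (norm (g x))\<^sup>2)" "integrable lborel (\<lambda>x. (norm (h x))\<^sup>2)"
  shows "sqnorm (\<lambda>x. g x + h x) \<le> 2 * sqnorm g + 2 * sqnorm h"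
proof -
  have "sqnorm (\<lambda>x. g x + h x) \<le> (\<integral>x. 2 * (norm (g x))\<^sup>2 + 2 * (norm (h x))\<^sup>2 \<partial>lborel)"
    unfolding sqnorm_def using assms by (intro integral_mono norm_add_sq_le) auto
  then show ?thesis using assms by (simp add: sqnorm_def)
qed

lemma L2_integrable: "L2 f \<Longrightarrow> integrable lborel (\<lambda>x. (norm (f x))\<^sup>2)"
  by (simp add: L2_def)

lemma norm_vec_smult: "norm (c *s (v::cvec2)) = norm c * norm v"
proof -
  have "(norm (c *s v))\<^sup>2 = (norm c * norm v)\<^sup>2"
    by (simp add: norm_vec2_sq norm_mult power_mult_distrib algebra_simps)
  then show ?thesis by (simp add: power2_eq_iff_nonneg)
qed

lemma sqnorm_smult: "sqnorm (\<lambda>x. c *s (f x :: cvec2)) = (norm c)\<^sup>2 * sqnorm f"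
  by (simp add: sqnorm_def norm_vec_smult power_mult_distrib)

lemma L2_smult: "L2 f \<Longrightarrow> L2 (\<lambda>x. c *s f x)"
  by (auto simp: L2_iff intro: sqint_mult_const)

lemma sqnorm_cong_AE:
  assumes "L2 f" "L2 g" "AE x in lborel. f x = g x"
  shows "sqnorm f = sqnorm g"
  unfolding sqnorm_def
proof (rule integral_cong_AE)
  show "AE x in lborel. (norm (f x))\<^sup>2 = (norm (g x))\<^sup>2" using assms(3) by eventually_elim simp
qed (use assms in \<open>auto simp: L2_def\<close>)

lemma sum_sq_le: "(a + b)\<^sup>2 \<le> 2 * a\<^sup>2 + 2 * (b::real)\<^sup>2"
  using sum_squares_bound[of a b] by (simp add: power2_sum)

text \<open>The constant is explicit so that it depends on z only through N and the determinant. At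
  a single point any N will do; near an eigenvalue N can be kept fixed, which isolates the growth of
  the resolvent in the factor with det M.\<close>

lemma res_sol_bound:
  fixes A :: cmat2 and N :: real
  assumes z: "z \<notin> cut_set m" and N: "1 \<le> N" "norm (zeta m z) \<le> N" "norm (1 / zeta m z) \<le> N"
      "1 / Im (kk m z) \<le> N" and d: "det (MM m A z) \<noteq> 0" and f: "L2 f"
    and a: "\<And>i j. norm (A $ i $ j) \<le> a"
  shows "sqnorm (res_sol m A z f)
    \<le> (8 * N ^ 6 + 128 * (1 + a * N)\<^sup>2 * a\<^sup>2 * N ^ 8) * (1 + 1 / (norm (det (MM m A z)))\<^sup>2) * sqnorm f"
proof -
  note k = kk_zeta[OF z]
  define S where "S = sqnorm f"
  define D where "D = det (MM m A z)"
  define h where "h = Rsol m z f 0"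
  define w where "w = A *v h"
  define v where "v = matrix_inv (MM m A z) *v w"
  define \<mu> where "\<mu> = 1 + a * N"
  \<comment> \<open>Bounds each squared component of h: N^2 from the sources, N from
    \<open>1 / Im k\<close>, and another N^2 from the division by \<zeta> in the second
    component.\<close>
  define H where "H = 2 * N ^ 5 * S"
  \<comment> \<open>Bounds each squared component of v: a factor 4 a^2 for the product with A and a
    factor 4 \<mu>^2 / |D|^2 for the inverse of M, whose entries have modulus at most \<mu> /
    |D|.\<close>
  define V where "V = 16 * \<mu>\<^sup>2 * a\<^sup>2 * H / (norm D)\<^sup>2"
  have S: "S \<ge> 0" by (simp add: S_def sqnorm_nonneg)
  have a0: "a \<ge> 0" using a[of 1 1] norm_ge_zero order_trans by blast
  have Npow: "N ^ i \<le> N ^ j" if "i \<le> j" for i j using N(1) that by (rule power_increasing[rotated])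
  have \<zeta>2: "(norm (zeta m z))\<^sup>2 \<le> N\<^sup>2" "(norm (1 / zeta m z))\<^sup>2 \<le> N\<^sup>2"
    using N by (auto intro!: power_mono)
  have F: "sqnorm g \<le> 2 * N\<^sup>2 * S" if "g = Fp m z f \<or> g = Fm m z f" for g
    unfolding S_def
  proof (rule sqnorm_le[OF _ L2_integrable[OF f]])
    show "integrable lborel (\<lambda>x. (norm (g x))\<^sup>2)" using that sqint_F[OF f] by (auto simp: sqint_def)
    fix x
    have "norm (g x) \<le> norm (f x $ 2) + norm (zeta m z) * norm (f x $ 1)"
      using that norm_triangle_ineq[of "f x $ 2" "zeta m z * f x $ 1"]
        norm_triangle_ineq4[of "f x $ 2" "zeta m z * f x $ 1"]
      by (auto simp: Fp_def Fm_def norm_mult)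
    then have "(norm (g x))\<^sup>2 \<le> (norm (f x $ 2) + norm (zeta m z) * norm (f x $ 1))\<^sup>2"
      by (intro power_mono) auto
    also have "\<dots> \<le> 2 * (norm (f x $ 2))\<^sup>2 + 2 * (norm (zeta m z) * norm (f x $ 1))\<^sup>2" by (rule sum_sq_le)
    also have "\<dots> \<le> 2 * (N\<^sup>2 * (norm (f x $ 2))\<^sup>2) + 2 * (N\<^sup>2 * (norm (f x $ 1))\<^sup>2)"
      unfolding power_mult_distrib using \<zeta>2(1) Npow[of 0 2]
      by (intro add_mono mult_left_mono mult_right_mono) (auto intro!: mult_right_mono[of 1 "N\<^sup>2", simplified])
    finally show "(norm (g x))\<^sup>2 \<le> 2 * N\<^sup>2 * (norm (f x))\<^sup>2"
      by (simp add: norm_vec2_sq algebra_simps)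
  qed
  have ik: "0 < 1 / Im (kk m z)" using k(1) by simp
  have Q_eq: "sqnorm (Qv m z f) = sqnorm (volt (kk m z) (\<lambda>y. Fm m z f (- y)))"
    using sqnorm_reflect[of "volt (kk m z) (\<lambda>y. Fm m z f (- y))"]
    by (simp add: Qv_def[abs_def] sqnorm_def)
  have F': "sqnorm (\<lambda>y. Fm m z f (- y)) \<le> 2 * N\<^sup>2 * S"
    using F[of "Fm m z f"] by (simp add: sqnorm_reflect)
  have vb: "sqnorm (volt (kk m z) G) \<le> 2 * N ^ 4 * S" "(norm (volt (kk m z) G 0))\<^sup>2 \<le> 2 * N ^ 3 * S"
    if "sqint G" "sqnorm G \<le> 2 * N\<^sup>2 * S" for G
  proof -
    have "sqnorm (volt (kk m z) G) \<le> (1 / Im (kk m z))\<^sup>2 * sqnorm G"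
      using volt_sqint(2)[OF k(1) that(1)] by (simp add: power_divide)
    also have "\<dots> \<le> N\<^sup>2 * (2 * N\<^sup>2 * S)"
      using that(2) ik N(4) by (intro mult_mono power_mono) (auto simp: sqnorm_nonneg)
    finally show "sqnorm (volt (kk m z) G) \<le> 2 * N ^ 4 * S" by (simp add: power2_eq_square power4_eq_xxxx)
    have "(norm (volt (kk m z) G 0))\<^sup>2 \<le> 1 / Im (kk m z) * sqnorm G"
      using volt_bound[OF k(1) that(1), of 0] by simp
    also have "\<dots> \<le> N * (2 * N\<^sup>2 * S)"
      using that(2) ik N(1,4) by (intro mult_mono) (auto simp: sqnorm_nonneg)
    finally show "(norm (volt (kk m z) G 0))\<^sup>2 \<le> 2 * N ^ 3 * S" by (simp add: power2_eq_square power3_eq_cube)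
  qed
  have P: "sqnorm (Pv m z f) \<le> 2 * N ^ 4 * S" "(norm (Pv m z f 0))\<^sup>2 \<le> 2 * N ^ 3 * S"
    using vb[OF sqint_F(1)[OF f] F] by (simp_all add: Pv_def[abs_def])
  have Q: "sqnorm (Qv m z f) \<le> 2 * N ^ 4 * S" "(norm (Qv m z f 0))\<^sup>2 \<le> 2 * N ^ 3 * S"
    using vb[OF sqint_F(3)[OF f] F'] unfolding Q_eq by (simp_all add: Qv_def)
  have half: "(norm ((p + q) / 2))\<^sup>2 \<le> ((norm p)\<^sup>2 + (norm q)\<^sup>2) / 2"
    "(norm ((p - q) / (2 * zeta m z)))\<^sup>2 \<le> N\<^sup>2 * (((norm p)\<^sup>2 + (norm q)\<^sup>2) / 2)" for p q :: complex
  proof -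
    show 1: "(norm ((p + q) / 2))\<^sup>2 \<le> ((norm p)\<^sup>2 + (norm q)\<^sup>2) / 2" for p q :: complex
      using norm_add_sq_le[of p q] by (simp add: norm_divide power_divide)
    have "(p - q) / (2 * zeta m z) = 1 / zeta m z * ((p + - q) / 2)" by simp
    then have "(norm ((p - q) / (2 * zeta m z)))\<^sup>2 = (norm (1 / zeta m z))\<^sup>2 * (norm ((p + - q) / 2))\<^sup>2"
      by (simp only: norm_mult power_mult_distrib)
    also have "\<dots> \<le> N\<^sup>2 * (((norm p)\<^sup>2 + (norm (- q))\<^sup>2) / 2)"
      by (intro mult_mono \<zeta>2 1) auto
    finally show "(norm ((p - q) / (2 * zeta m z)))\<^sup>2 \<le> N\<^sup>2 * (((norm p)\<^sup>2 + (norm q)\<^sup>2) / 2)" by simp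
  qed
  have Rint: "integrable lborel (\<lambda>x. (norm (Pv m z f x))\<^sup>2)" "integrable lborel (\<lambda>x. (norm (Qv m z f x))\<^sup>2)"
    using sqint_PQ[OF z f] by (auto simp: sqint_def)
  have R: "sqnorm (Rsol m z f) \<le> 4 * N ^ 6 * S"
  proof -
    have "sqnorm (Rsol m z f) \<le> (\<integral>x. (1 + N\<^sup>2) / 2 * ((norm (Pv m z f x))\<^sup>2 + (norm (Qv m z f x))\<^sup>2) \<partial>lborel)"
      unfolding sqnorm_def
    proof (rule integral_mono)
      fix x show "(norm (Rsol m z f x))\<^sup>2 \<le> (1 + N\<^sup>2) / 2 * ((norm (Pv m z f x))\<^sup>2 + (norm (Qv m z f x))\<^sup>2)"
      proof -
        note half[of "Pv m z f x" "Qv m z f x", folded Rsol_nth]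
        then show ?thesis unfolding norm_vec2_sq by (simp add: algebra_simps add_divide_distrib)
      qed
    qed (use Rint L2_integrable[OF L2_Rsol[OF z f]] in auto)
    also have "\<dots> = (1 + N\<^sup>2) / 2 * (sqnorm (Pv m z f) + sqnorm (Qv m z f))"
      using Rint by (simp add: sqnorm_def)
    also have "\<dots> \<le> N\<^sup>2 * (2 * N ^ 4 * S + 2 * N ^ 4 * S)"
      using P Q Npow[of 0 2] by (intro mult_mono add_mono) (auto simp: sqnorm_nonneg)
    finally show ?thesis by (simp add: power2_eq_square numeral_eq_Suc algebra_simps)
  qed
  have h: "(norm (h $ 1))\<^sup>2 \<le> H" "(norm (h $ 2))\<^sup>2 \<le> H"
  proof -
    have b: "((norm (Pv m z f 0))\<^sup>2 + (norm (Qv m z f 0))\<^sup>2) / 2 \<le> 2 * N ^ 3 * S"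
      using P Q by simp
    have "(norm (h $ 1))\<^sup>2 \<le> 2 * N ^ 3 * S"
      using half(1)[of "Pv m z f 0" "Qv m z f 0"] b by (simp add: h_def Rsol_nth)
    also have "\<dots> \<le> H" unfolding H_def using S Npow[of 3 5] by (intro mult_right_mono) auto
    finally show "(norm (h $ 1))\<^sup>2 \<le> H" .
    have "(norm (h $ 2))\<^sup>2 \<le> N\<^sup>2 * (((norm (Pv m z f 0))\<^sup>2 + (norm (Qv m z f 0))\<^sup>2) / 2)"
      using half(2)[of "Pv m z f 0" "Qv m z f 0"] by (simp add: h_def Rsol_nth)
    also have "\<dots> \<le> N\<^sup>2 * (2 * N ^ 3 * S)" by (intro mult_left_mono b) auto
    finally show "(norm (h $ 2))\<^sup>2 \<le> H" by (simp add: H_def numeral_eq_Suc algebra_simps)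
  qed
  have H0: "0 \<le> H" using h(1) zero_le_power2 order_trans by blast
  have two: "(norm (p * x + q * y))\<^sup>2 \<le> 4 * c\<^sup>2 * B"
    if "norm p \<le> c" "norm q \<le> c" "(norm x)\<^sup>2 \<le> B" "(norm y)\<^sup>2 \<le> B" for p q x y :: complex and c B
  proof -
    have "(norm (p * x + q * y))\<^sup>2 \<le> 2 * (norm (p * x))\<^sup>2 + 2 * (norm (q * y))\<^sup>2" by (rule norm_add_sq_le)
    also have "\<dots> \<le> 2 * (c\<^sup>2 * B) + 2 * (c\<^sup>2 * B)"
      unfolding norm_mult power_mult_distrib using that
      by (intro add_mono mult_left_mono mult_mono power_mono) auto
    finally show ?thesis by (simp add: mult_ac)
  qed
  have w: "(norm (w $ 1))\<^sup>2 \<le> 4 * a\<^sup>2 * H" "(norm (w $ 2))\<^sup>2 \<le> 4 * a\<^sup>2 * H"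
    unfolding w_def mat2_mult_nth by (intro two a h)+
  have M: "norm (MM m A z $ i $ j) \<le> \<mu>" for i j
  proof -
    have "norm (\<i> / 2 * (A $ i' $ j' * c)) \<le> a * N" if "norm c \<le> N" for i' j' c
    proof -
      have "norm (A $ i' $ j') * norm c \<le> a * N" using a that a0 by (intro mult_mono) auto
      moreover have "0 \<le> a * N" using a0 N(1) by simp
      ultimately show ?thesis by (simp add: norm_mult norm_divide)
    qed
    from this[OF N(2)] this[OF N(3)]
    have b: "norm (\<i> / 2 * (A $ i' $ j' * zeta m z)) \<le> a * N" "norm (\<i> / 2 * (A $ i' $ j' / zeta m z)) \<le> a * N" for i' j'
      by auto
    have aN: "0 \<le> a * N" using a0 N(1) by simp
    have "norm (1 + c) \<le> \<mu>" if "norm c \<le> a * N" for c :: complex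
      using norm_triangle_ineq[of 1 c] that by (simp add: \<mu>_def)
    then show ?thesis
      using exhaust_2[of i] exhaust_2[of j] b[of 1 1] b[of 1 2] b[of 2 1] b[of 2 2] aN
      by (elim disjE) (simp_all only: MM_nth, auto simp: \<mu>_def)
  qed
  have Mv: "MM m A z *v v = w" unfolding v_def by (rule MM_inv[OF d])
  have D: "D = MM m A z $ 1 $ 1 * MM m A z $ 2 $ 2 - MM m A z $ 1 $ 2 * MM m A z $ 2 $ 1"
    by (simp add: D_def det_2)
  have D0: "norm D > 0" using d by (simp add: D_def)
  \<comment> \<open>Cramer's rule, which makes the dependence of v on the determinant
    explicit.\<close>
  have cr: "D * v $ 1 = MM m A z $ 2 $ 2 * w $ 1 + (- MM m A z $ 1 $ 2) * w $ 2"
    "D * v $ 2 = (- MM m A z $ 2 $ 1) * w $ 1 + MM m A z $ 1 $ 1 * w $ 2"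
    unfolding Mv[symmetric] mat2_mult_nth D by (simp_all add: algebra_simps)
  have v: "(norm (v $ 1))\<^sup>2 \<le> V" "(norm (v $ 2))\<^sup>2 \<le> V"
  proof -
    have "(norm (D * v $ 1))\<^sup>2 \<le> 4 * \<mu>\<^sup>2 * (4 * a\<^sup>2 * H)" "(norm (D * v $ 2))\<^sup>2 \<le> 4 * \<mu>\<^sup>2 * (4 * a\<^sup>2 * H)"
      unfolding cr by (intro two w; simp add: M)+
    then show "(norm (v $ 1))\<^sup>2 \<le> V" "(norm (v $ 2))\<^sup>2 \<le> V"
      using D0 by (simp_all add: V_def norm_mult power_mult_distrib field_simps)
  qed
  have V0: "0 \<le> V" using v(1) zero_le_power2 order_trans by blast
  have T: "sqnorm (Tsol m z v) \<le> 8 * N ^ 3 * V"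
  proof -
    have c: "(norm p + norm q)\<^sup>2 / Im (kk m z) \<le> 4 * N ^ 3 * V"
      if "(norm p)\<^sup>2 \<le> N\<^sup>2 * V" "(norm q)\<^sup>2 \<le> V" for p q :: complex
    proof -
      have "(norm p + norm q)\<^sup>2 \<le> 2 * (norm p)\<^sup>2 + 2 * (norm q)\<^sup>2" by (rule sum_sq_le)
      also have "\<dots> \<le> 2 * (N\<^sup>2 * V) + 2 * (N\<^sup>2 * V)"
      proof -
        have "V \<le> N\<^sup>2 * V" using mult_right_mono[OF Npow[of 0 2] V0] by simp
        then show ?thesis using that by linarith
      qed
      finally have "1 / Im (kk m z) * (norm p + norm q)\<^sup>2 \<le> N * (4 * (N\<^sup>2 * V))"
        using ik N V0 by (intro mult_mono) (simp_all add: mult_ac)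
      then show ?thesis by (simp add: power3_eq_cube power2_eq_square mult_ac)
    qed
    have "sqnorm (Tsol m z v) = sqnorm (\<lambda>x. Tsol m z v x $ 1) + sqnorm (\<lambda>x. Tsol m z v x $ 2)"
      by (rule sqnorm_vec[OF L2_Tsol[OF z]])
    also have "\<dots> \<le> (norm (zeta m z * v $ 1) + norm (v $ 2))\<^sup>2 / Im (kk m z)
        + (norm (v $ 2 / zeta m z) + norm (v $ 1))\<^sup>2 / Im (kk m z)"
      unfolding Tsol_nth by (intro add_mono sqint_Tsol_comp(2) k(1))
    also have "\<dots> \<le> 4 * N ^ 3 * V + 4 * N ^ 3 * V"
    proof (intro add_mono c v)
      show "(norm (zeta m z * v $ 1))\<^sup>2 \<le> N\<^sup>2 * V"
        unfolding norm_mult power_mult_distrib by (intro mult_mono \<zeta>2 v) auto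
      have "(norm (1 / zeta m z * v $ 2))\<^sup>2 \<le> N\<^sup>2 * V"
        unfolding norm_mult power_mult_distrib by (intro mult_mono \<zeta>2 v) auto
      then show "(norm (v $ 2 / zeta m z))\<^sup>2 \<le> N\<^sup>2 * V" by simp
    qed
    finally show ?thesis by (simp add: mult_ac)
  qed
  have "sqnorm (res_sol m A z f) \<le> 2 * sqnorm (Rsol m z f) + 2 * sqnorm (\<lambda>x. (- \<i> / 2) *s Tsol m z v x)"
    unfolding res_sol_def[abs_def] h_def[symmetric] w_def[symmetric] v_def[symmetric]
    using L2_Rsol[OF z f] L2_Tsol[OF z, of v] L2_lincomb[OF L2_Rsol[OF z f] L2_Tsol[OF z], of 1 "- \<i> / 2" v]
    by (intro sqnorm_add_le L2_integrable L2_smult) (auto simp: vec.scale_one)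
  also have "\<dots> = 2 * sqnorm (Rsol m z f) + sqnorm (Tsol m z v) / 2"
    unfolding sqnorm_smult by (simp add: norm_divide power_divide)
  also have "\<dots> \<le> 8 * N ^ 6 * S + 4 * N ^ 3 * V" using R T by simp
  also have "4 * N ^ 3 * V = 128 * \<mu>\<^sup>2 * a\<^sup>2 * N ^ 8 * (1 / (norm D)\<^sup>2) * S"
    by (simp add: V_def H_def numeral_eq_Suc algebra_simps)
  also have "8 * N ^ 6 * S + \<dots> \<le> (8 * N ^ 6 + 128 * \<mu>\<^sup>2 * a\<^sup>2 * N ^ 8) * (1 + 1 / (norm D)\<^sup>2) * S"
  proof -
    have "0 \<le> 8 * N ^ 6 * (1 / (norm D)\<^sup>2) * S" "0 \<le> 128 * \<mu>\<^sup>2 * a\<^sup>2 * N ^ 8 * S"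
      using S N(1) by auto
    then show ?thesis by (simp add: algebra_simps)
  qed
  finally show ?thesis by (simp add: \<mu>_def D_def S_def)
qed

section \<open>Singular sequences on the cut\<close>

text \<open>Truncated generalised eigenfunctions \<open>x(n-x) e\<^bsup>ikx\<^esup> v\<close>: the derivative of the cut-off is of lower
  order in \<open>n\<close>.\<close>
definition hat :: "real \<Rightarrow> real \<Rightarrow> real" where
  "hat n x = max 0 (x * (n - x))"

definition hat' :: "real \<Rightarrow> real \<Rightarrow> real" where
  "hat' n x = (if 0 < x \<and> x < n then n - 2 * x else 0)"

lemma hat_deriv:
  assumes "n > 0" "x \<noteq> 0" "x \<noteq> n"
  shows "(hat n has_field_derivative hat' n x) (at x)"
proof -
  consider "x < 0" | "0 < x" "x < n" | "n < x" using assms by linarith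
  then show ?thesis
  proof cases
    case 1
    have h: "hat n t = 0" if "t \<in> {..<0}" for t
      using that assms(1) mult_neg_pos[of t "n - t"] by (auto simp: hat_def)
    have d: "((\<lambda>_. 0) has_field_derivative hat' n x) (at x)" using 1 by (simp add: hat'_def)
    show ?thesis
      by (rule has_field_derivative_transform_within_open[OF d, of "{..<0}"]) (use 1 h in auto)
  next
    case 2
    have h: "hat n t = t * (n - t)" if "t \<in> {0<..<n}" for t
      using that by (auto simp: hat_def)
    have d: "((\<lambda>t. t * (n - t)) has_field_derivative hat' n x) (at x)"
      using 2 by (auto intro!: derivative_eq_intros simp: hat'_def)
    show ?thesis
      by (rule has_field_derivative_transform_within_open[OF d, of "{0<..<n}"]) (use 2 h in auto)
  next
    case 3
    have h: "hat n t = 0" if "t \<in> {n<..}" for t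
      using that assms(1) mult_pos_neg[of t "n - t"] by (auto simp: hat_def)
    have d: "((\<lambda>_. 0) has_field_derivative hat' n x) (at x)" using 3 assms(1) by (simp add: hat'_def)
    show ?thesis
      by (rule has_field_derivative_transform_within_open[OF d, of "{n<..}"]) (use 3 h in auto)
  qed
qed

lemma hat'_bound: "n > 0 \<Longrightarrow> (hat' n x)\<^sup>2 \<le> n\<^sup>2 * indicator {0..n} x"
  by (auto simp: hat'_def abs_le_square_iff[symmetric])

text \<open>On the middle half of \<open>{0..n}\<close> the parabola x (n - x) is at least its value
  3 n^2 / 16 at n/4 and 3n/4; the square of 3/16 is 9/256.\<close>

lemma hat_bounds:
  assumes "n > 0"
  shows "(hat n x)\<^sup>2 \<le> n ^ 4 * indicator {0..n} x" "9 / 256 * n ^ 4 * indicator {n / 4..3 * n / 4} x \<le> (hat n x)\<^sup>2"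
proof -
  have "hat n x \<le> n\<^sup>2 * indicator {0..n} x"
  proof (cases "0 \<le> x \<and> x \<le> n")
    case True
    then have "x * (n - x) \<le> n * n" by (intro mult_mono) auto
    then show ?thesis using True by (auto simp: hat_def power2_eq_square)
  next
    case False
    then have "x * (n - x) \<le> 0" using assms by (auto simp: mult_le_0_iff)
    then show ?thesis using False by (auto simp: hat_def)
  qed
  then have "(hat n x)\<^sup>2 \<le> (n\<^sup>2 * indicator {0..n} x)\<^sup>2" by (intro power_mono) (auto simp: hat_def)
  then show "(hat n x)\<^sup>2 \<le> n ^ 4 * indicator {0..n} x"
    by (cases "x \<in> {0..n}") (simp_all add: power_mult_distrib)
  show "9 / 256 * n ^ 4 * indicator {n / 4..3 * n / 4} x \<le> (hat n x)\<^sup>2"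
  proof (cases "x \<in> {n / 4..3 * n / 4}")
    case True
    have "x * (n - x) - 3 / 16 * n\<^sup>2 = (x - n / 4) * (3 * n / 4 - x)"
      by (simp add: power2_eq_square field_simps)
    also have "\<dots> \<ge> 0" using True by auto
    finally have "3 / 16 * n\<^sup>2 \<le> hat n x" by (simp add: hat_def)
    then have "(3 / 16 * n\<^sup>2)\<^sup>2 \<le> (hat n x)\<^sup>2" by (intro power_mono) auto
    then show ?thesis using True by (simp add: power_mult_distrib power_divide)
  qed auto
qed

text \<open>The test function is the cut-off times a plane wave with constant spinor v. Since the
  plane wave solves the homogeneous system, only the derivative of the cut-off survives in f = (D -
  z) \<psi>. Relative to |v|^2 the squared norms are at least 9/512 n^5 for \<psi> and at most n^3
  for f, which contradicts a resolvent bound C once n is large.\<close>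

lemma cut_not_resolvent:
  assumes z: "z \<in> cut_set m"
  shows "z \<notin> resolvent_set m A"
proof
  assume "z \<in> resolvent_set m A"
  then obtain C where C: "\<And>f \<psi>. L2 f \<Longrightarrow> dirac_graph m A \<psi> (\<lambda>x. f x + z *s \<psi> x) \<Longrightarrow> L2norm \<psi> \<le> C * L2norm f"
    unfolding resolvent_set_def by blast
  have zr: "z = of_real (Re z)" "\<bar>m\<bar> \<le> \<bar>Re z\<bar>" using z by (auto simp: cut_set_def complex_eq_iff)
  define r where "r = sqrt ((Re z)\<^sup>2 - m\<^sup>2)"
  have rr: "r * r = (Re z)\<^sup>2 - m\<^sup>2" using zr(2) abs_le_square_iff[of m "Re z"] by (simp add: r_def)
  have "(z + m) * (z - m) = of_real ((Re z)\<^sup>2 - m\<^sup>2)"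
    by (subst (1 2) zr(1)) (simp add: algebra_simps power2_eq_square)
  then have r: "of_real r * of_real r = (z + m) * (z - m)" unfolding rr[symmetric] by simp
  \<comment> \<open>A null vector of a singular 2 by 2 system, since r^2 = (z + m)(z - m). The
    generic choice (z + m, r) degenerates to zero at z = -m, where r = 0 as well and a coordinate
    vector is taken instead.\<close>
  obtain v :: cvec2 where v: "v \<noteq> 0" "of_real r * v $ 2 = (z - m) * v $ 1" "of_real r * v $ 1 = (z + m) * v $ 2"
  proof (cases "z + m = 0")
    case False
    show thesis
      by (rule that[of "vector [z + m, of_real r]"]) (use False r in \<open>auto simp: vec2_eq_iff mult.commute\<close>)
  next
    case True
    show thesis
    proof (cases "m = 0")
      case True
      with \<open>z + m = 0\<close> have "z = 0" by simp
      then show thesis using True by (intro that[of "vector [1, 0]"]) (auto simp: vec2_eq_iff r_def)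
    next
      case False
      have r0: "complex_of_real r = 0" using r \<open>z + m = 0\<close> by simp
      show thesis
        by (rule that[of "vector [0, 1]"]) (use r0 \<open>z + m = 0\<close> in \<open>auto simp: vec2_eq_iff\<close>)
    qed
  qed
  \<comment> \<open>Then 9/512 n^2 = 9/8 (|C| + 1)^2, which is larger than C^2.\<close>
  define n where "n = 8 * (\<bar>C\<bar> + 1)"
  have n: "n > 0" by (simp add: n_def)
  define e where "e = (\<lambda>x::real. exp (\<i> * of_real r * of_real x))"
  have ne: "norm (e x) = 1" for x by (simp add: e_def)
  define \<psi> where "\<psi> x = (of_real (hat n x) * e x) *s v" for x
  define f :: "real \<Rightarrow> cvec2" where "f x = (- \<i> * of_real (hat' n x) * e x) *s vector [v $ 2, v $ 1]" for x
  have hatc: "continuous_on S (hat n)" for S unfolding hat_def by (intro continuous_intros)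
  have ec: "continuous_on S e" for S unfolding e_def by (intro continuous_intros)
  have [measurable]: "hat n \<in> borel_measurable borel" "e \<in> borel_measurable borel"
    by (intro borel_measurable_continuous_onI hatc ec)+
  have [measurable]: "hat' n \<in> borel_measurable borel" unfolding hat'_def by measurable
  have bi: "integrable lborel (\<lambda>x. c * indicat_real {0..n} x)" for c
    by (intro integrable_mult_right integrable_indicator_Icc)
  have ih: "integrable lborel (\<lambda>x. (hat n x)\<^sup>2)"
    by (rule Bochner_Integration.integrable_bound[OF bi[of "n ^ 4"]]) (use hat_bounds(1)[OF n] in auto)
  have ih': "integrable lborel (\<lambda>x. (hat' n x)\<^sup>2)"
    by (rule Bochner_Integration.integrable_bound[OF bi[of "n\<^sup>2"]]) (use hat'_bound[OF n] in auto)
  have nv: "(norm (vector [v $ 2, v $ 1] :: cvec2))\<^sup>2 = (norm v)\<^sup>2" by (simp add: norm_vec2_sq)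
  have n\<psi>: "(norm (\<psi> x))\<^sup>2 = (hat n x)\<^sup>2 * (norm v)\<^sup>2" for x
    by (simp add: \<psi>_def norm_vec_smult norm_mult ne power_mult_distrib)
  have nf: "(norm (f x))\<^sup>2 = (hat' n x)\<^sup>2 * (norm v)\<^sup>2" for x
    by (simp add: f_def norm_vec_smult norm_mult ne power_mult_distrib nv)
  have sq\<psi>: "sqint (\<lambda>x. of_real (hat n x) * e x * c)" for c
    using ih by (simp add: sqint_def norm_mult ne power_mult_distrib)
  have sqf: "sqint (\<lambda>x. of_real (hat' n x) * e x * c)" for c
    using ih' by (simp add: sqint_def norm_mult ne power_mult_distrib)
  have L\<psi>: "L2 \<psi>" using sq\<psi> by (simp add: L2_iff \<psi>_def)
  have "f x $ 1 = of_real (hat' n x) * e x * (- \<i> * v $ 2)" "f x $ 2 = of_real (hat' n x) * e x * (- \<i> * v $ 1)" for x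
    by (simp_all add: f_def)
  then have Lf: "L2 f" using sqf[of "- \<i> * v $ 2"] sqf[of "- \<i> * v $ 1"] by (simp only: L2_iff)
  have der: "((\<lambda>x. of_real (hat n x) * e x * c) has_vector_derivative
      (of_real (hat' n x) * e x + \<i> * of_real r * of_real (hat n x) * e x) * c) (at x)"
    if "x \<noteq> 0" "x \<noteq> n" for x c
  proof -
    have "(hat n has_vector_derivative hat' n x) (at x)"
      using hat_deriv[OF n that] by (simp add: has_real_derivative_iff_has_vector_derivative)
    then have "((\<lambda>x. complex_of_real (hat n x)) has_vector_derivative of_real (hat' n x)) (at x)"
      by (rule bounded_linear.has_vector_derivative[OF bounded_linear_of_real])
    moreover have "(e has_vector_derivative \<i> * of_real r * e x) (at x)"
      unfolding e_def by (rule has_vector_derivative_real_field) (auto intro!: derivative_eq_intros)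
    ultimately have "((\<lambda>x. of_real (hat n x) * e x) has_vector_derivative
       of_real (hat n x) * (\<i> * of_real r * e x) + of_real (hat' n x) * e x) (at x)"
      by (rule has_vector_derivative_mult)
    then show ?thesis
      by (rule has_vector_derivative_eq_rhs[OF has_vector_derivative_mult_left]) (simp add: algebra_simps)
  qed
  \<comment> \<open>The cut-off is continuous but has corners at 0 and n, so the fundamental theorem
    is used with these two exceptional points.\<close>
  have int: "((\<lambda>x. (of_real (hat' n x) * e x + \<i> * of_real r * of_real (hat n x) * e x) * c) has_integral
      of_real (hat n b) * e b * c - of_real (hat n a) * e a * c) {a..b}" if "a \<le> b" for a b c
    by (rule fundamental_theorem_of_calculus_interior_strong[of "{0, n}"])
      (use that der in \<open>auto intro!: continuous_intros continuous_on_of_real hatc ec\<close>)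
  have s: "solves m z S f \<psi>" for S
  proof -
    have e1: "\<i> * (f x $ 2 + (z + m) * \<psi> x $ 2)
        = (of_real (hat' n x) * e x + \<i> * of_real r * of_real (hat n x) * e x) * v $ 1" for x
    proof -
      have "\<i> * (f x $ 2 + (z + m) * \<psi> x $ 2) =
        of_real (hat' n x) * e x * v $ 1 + \<i> * of_real (hat n x) * e x * ((z + m) * v $ 2)"
        by (simp add: f_def \<psi>_def algebra_simps)
      then show ?thesis unfolding v(3)[symmetric] by (simp add: algebra_simps)
    qed
    have e2: "\<i> * (f x $ 1 + (z - m) * \<psi> x $ 1)
        = (of_real (hat' n x) * e x + \<i> * of_real r * of_real (hat n x) * e x) * v $ 2" for x
    proof -
      have "\<i> * (f x $ 1 + (z - m) * \<psi> x $ 1) =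
        of_real (hat' n x) * e x * v $ 2 + \<i> * of_real (hat n x) * e x * ((z - m) * v $ 1)"
        by (simp add: f_def \<psi>_def algebra_simps)
      then show ?thesis unfolding v(2)[symmetric] by (simp add: algebra_simps)
    qed
    show ?thesis unfolding solves_def e1 e2
      unfolding \<psi>_def vector_smult_component
      by (intro conjI allI impI int continuous_intros continuous_on_of_real hatc ec)
  qed
  have lim: "(\<psi> \<longlongrightarrow> 0) (at 0 within S)" for S
  proof -
    have "continuous_on UNIV \<psi>" using s[of UNIV] by (simp add: solves_def vec2_continuous_on_iff)
    then have "(\<psi> \<longlongrightarrow> \<psi> 0) (at 0)" by (simp add: continuous_on_def)
    moreover have "\<psi> 0 = 0" by (simp add: \<psi>_def hat_def)
    ultimately show ?thesis by (metis tendsto_within_subset subset_UNIV)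
  qed
  have "dirac_graph m A \<psi> (\<lambda>x. f x + z *s \<psi> x)"
    by (rule dirac_graphI[OF Lf L\<psi> s s lim lim]) (simp add: bc_def)
  then have "L2norm \<psi> \<le> C * L2norm f" by (rule C[OF Lf])
  then have "(L2norm \<psi>)\<^sup>2 \<le> (C * L2norm f)\<^sup>2" by (rule power_mono) (simp add: L2norm_eq sqnorm_nonneg)
  then have "sqnorm \<psi> \<le> C\<^sup>2 * sqnorm f" by (simp add: L2norm_eq power_mult_distrib sqnorm_nonneg)
  moreover have "sqnorm \<psi> = (\<integral>x. (hat n x)\<^sup>2 \<partial>lborel) * (norm v)\<^sup>2" by (simp add: sqnorm_def n\<psi>)
  moreover have "sqnorm f = (\<integral>x. (hat' n x)\<^sup>2 \<partial>lborel) * (norm v)\<^sup>2" by (simp add: sqnorm_def nf)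
  ultimately have le: "(\<integral>x. (hat n x)\<^sup>2 \<partial>lborel) \<le> C\<^sup>2 * (\<integral>x. (hat' n x)\<^sup>2 \<partial>lborel)"
    using v(1) by simp
  \<comment> \<open>The middle half has length n/2, which turns 9/256 n^4 into 9/512 n^5.\<close>
  have "9 / 512 * n\<^sup>2 * n ^ 3 = (\<integral>x. 9 / 256 * n ^ 4 * indicat_real {n / 4..3 * n / 4} x \<partial>lborel)"
    using n by (simp add: numeral_eq_Suc)
  also have "\<dots> \<le> (\<integral>x. (hat n x)\<^sup>2 \<partial>lborel)"
    by (intro integral_mono ih integrable_mult_right integrable_indicator_Icc hat_bounds(2)[OF n])
  also note le
  also have "C\<^sup>2 * (\<integral>x. (hat' n x)\<^sup>2 \<partial>lborel) \<le> C\<^sup>2 * n ^ 3"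
  proof (rule mult_left_mono)
    have "(\<integral>x. (hat' n x)\<^sup>2 \<partial>lborel) \<le> (\<integral>x. n\<^sup>2 * indicat_real {0..n} x \<partial>lborel)"
      by (intro integral_mono ih' bi hat'_bound[OF n])
    also have "\<dots> = n ^ 3" using n by (simp add: power2_eq_square power3_eq_cube)
    finally show "(\<integral>x. (hat' n x)\<^sup>2 \<partial>lborel) \<le> n ^ 3" .
  qed simp
  finally have "9 / 512 * n\<^sup>2 * n ^ 3 \<le> C\<^sup>2 * n ^ 3" .
  then have "9 / 512 * n\<^sup>2 \<le> C\<^sup>2" using n by (simp only: mult_le_cancel_right_pos zero_less_power)
  moreover have "n\<^sup>2 = 64 * (\<bar>C\<bar> + 1)\<^sup>2" unfolding n_def power_mult_distrib by simp
  moreover have "(\<bar>C\<bar> + 1)\<^sup>2 > C\<^sup>2" by (simp add: power2_sum)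
  ultimately show False using zero_le_power2[of C] by linarith
qed

section \<open>Spectrum and eigenspaces\<close>

text \<open>The expansion 1 + s tr(A Z) + s^2 det(A Z) with s = i/2, where det Z = 1 because the
  diagonal entries of Z are inverse to each other.\<close>

lemma det_MM:
  assumes "z \<notin> cut_set m"
  shows "det (MM m A z) = 1 + \<i> / 2 * (A $ 1 $ 1 * zeta m z + A $ 2 $ 2 / zeta m z) - det A / 4"
  using kk_zeta(4)[OF assms] by (simp add: det_2 MM_nth field_simps)

lemma det_zero_kernel:
  fixes M :: cmat2
  assumes "det M = 0"
  obtains v where "v \<noteq> 0" "M *v v = 0"
  using assms by (metis invertible_det_nz matrix_left_invertible_ker invertible_left_inverse)

lemma point_spectrum_cut: "point_spectrum m A \<inter> cut_set m = {}"
  using cut_no_eigenfunction by (fastforce simp: point_spectrum_def eigenspace_D_def)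

lemma point_spectrum_iff:
  assumes z: "z \<notin> cut_set m"
  shows "z \<in> point_spectrum m A \<longleftrightarrow> det (MM m A z) = 0"
proof
  assume "z \<in> point_spectrum m A"
  then obtain \<psi> where \<psi>: "dirac_graph m A \<psi> (\<lambda>x. z *s \<psi> x)" "\<not> (AE x in lborel. \<psi> x = 0)"
    unfolding point_spectrum_def eigenspace_D_def by blast
  obtain v where v: "MM m A z *v v = 0" "AE x in lborel. \<psi> x = Tsol m z v x"
    by (rule eigenfunction_form[OF z \<psi>(1)])
  show "det (MM m A z) = 0"
  proof (rule ccontr)
    assume "det (MM m A z) \<noteq> 0"
    then have "v = 0" using v(1) by (rule MM_kernel_trivial)
    have "AE x in lborel. \<psi> x = 0"
      using v(2) by eventually_elim (simp add: \<open>v = 0\<close> vec2_eq_iff Tsol_nth)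
    then show False using \<psi>(2) by blast
  qed
next
  assume "det (MM m A z) = 0"
  then obtain v where v: "v \<noteq> 0" "MM m A z *v v = 0" by (rule det_zero_kernel)
  have "\<not> (AE x in lborel. Tsol m z v x = 0)" using Tsol_AE_zero[OF z] v(1) by blast
  then show "z \<in> point_spectrum m A"
    using Tsol_eigenfunction[OF z v(2)] unfolding point_spectrum_def eigenspace_D_def by blast
qed

lemma matrix_entries_bounded:
  fixes A :: cmat2
  obtains a where "\<And>i j. norm (A $ i $ j) \<le> a"
proof
  fix i j
  show "norm (A $ i $ j) \<le> (\<Sum>i\<in>UNIV. \<Sum>j\<in>UNIV. norm (A $ i $ j))"
    by (rule order_trans[OF member_le_sum[of j UNIV "\<lambda>j. norm (A $ i $ j)"] member_le_sum[of i UNIV "\<lambda>i. \<Sum>j\<in>UNIV. norm (A $ i $ j)"]])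
      (auto intro: sum_nonneg)
qed

lemma sqnorm_zero_AE:
  assumes "L2 \<psi>" "sqnorm \<psi> = 0"
  shows "AE x in lborel. \<psi> x = 0"
proof -
  have "AE x in lborel. (norm (\<psi> x))\<^sup>2 = 0"
    by (rule integral_nonneg_eq_0_iff_AE[OF L2_integrable[OF assms(1)], THEN iffD1])
      (use assms(2) in \<open>simp_all add: sqnorm_def\<close>)
  then show ?thesis by simp
qed

lemma resolvent_setI:
  assumes z: "z \<notin> cut_set m" and d: "det (MM m A z) \<noteq> 0"
  shows "z \<in> resolvent_set m A"
proof -
  obtain a where a: "\<And>i j. norm (A $ i $ j) \<le> a" using matrix_entries_bounded[of A] by blast
  define N where "N = 1 + norm (zeta m z) + norm (1 / zeta m z) + 1 / Im (kk m z)"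
  have N: "1 \<le> N" "norm (zeta m z) \<le> N" "norm (1 / zeta m z) \<le> N" "1 / Im (kk m z) \<le> N"
    using kk_zeta(1)[OF z] by (auto simp: N_def intro!: add_nonneg_nonneg add_increasing)
  obtain K where K: "\<And>f. L2 f \<Longrightarrow> sqnorm (res_sol m A z f) \<le> K * sqnorm f"
    using res_sol_bound[OF z N d _ a] by blast
  have "L2norm \<psi> \<le> sqrt K * L2norm f" if f: "L2 f" and \<psi>: "dirac_graph m A \<psi> (\<lambda>x. f x + z *s \<psi> x)" for f \<psi>
  proof -
    note r = dirac_graph_res_sol[OF z d f]
    have "sqnorm \<psi> = sqnorm (res_sol m A z f)"
      by (rule sqnorm_cong_AE[OF dirac_graph_L2[OF \<psi>] dirac_graph_L2[OF r] dirac_unique[OF z d \<psi> r]])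
    then have "sqnorm \<psi> \<le> K * sqnorm f" using K[OF f] by simp
    then have "sqrt (sqnorm \<psi>) \<le> sqrt (K * sqnorm f)" by (rule real_sqrt_le_mono)
    then show ?thesis by (simp add: L2norm_eq real_sqrt_mult)
  qed
  then show ?thesis
    unfolding resolvent_set_def using dirac_graph_res_sol[OF z d] by blast
qed

lemma spectrum_eq: "spectrum_D m A = cut_set m \<union> point_spectrum m A"
proof -
  have "z \<notin> resolvent_set m A" if pt: "z \<in> point_spectrum m A" for z
  proof
    assume "z \<in> resolvent_set m A"
    then obtain C where C: "\<And>f \<psi>. L2 f \<Longrightarrow> dirac_graph m A \<psi> (\<lambda>x. f x + z *s \<psi> x) \<Longrightarrow> L2norm \<psi> \<le> C * L2norm f"
      unfolding resolvent_set_def by blast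
    obtain \<psi> where \<psi>: "dirac_graph m A \<psi> (\<lambda>x. z *s \<psi> x)" "\<not> (AE x in lborel. \<psi> x = 0)"
      using pt unfolding point_spectrum_def eigenspace_D_def by blast
    \<comment> \<open>An eigenfunction is a solution with right-hand side f = 0, so a bounded
      inverse would force its norm to be zero.\<close>
    have "L2norm \<psi> \<le> C * L2norm (\<lambda>_. 0)" by (rule C[OF L2_zero]) (use \<psi>(1) in simp)
    moreover have "sqnorm (\<lambda>_::real. 0 :: cvec2) = 0" by (simp add: sqnorm_def)
    ultimately have "sqnorm \<psi> = 0" using sqnorm_nonneg[of \<psi>] by (simp add: L2norm_eq)
    then show False using sqnorm_zero_AE[OF dirac_graph_L2[OF \<psi>(1)]] \<psi>(2) by blast
  qed
  moreover have "z \<in> resolvent_set m A" if "z \<notin> cut_set m" "z \<notin> point_spectrum m A" for z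
    using resolvent_setI point_spectrum_iff that by blast
  ultimately show ?thesis
    unfolding spectrum_D_def using cut_not_resolvent by blast
qed

section \<open>Eigenvalues in the massless case\<close>

lemma bsqrt_unique:
  assumes "s\<^sup>2 = w" "Im s > 0"
  shows "bsqrt w = s"
  unfolding bsqrt_def
proof (rule the_equality)
  fix t assume t: "t\<^sup>2 = w \<and> Im t > 0"
  then have "t = s \<or> t = - s" using assms(1) by (metis power2_eq_iff)
  then show "t = s" using t assms(2) by auto
qed (use assms in simp)

lemma cut_set_0: "z \<in> cut_set 0 \<longleftrightarrow> Im z = 0"
  by (simp add: cut_set_def)

lemma zeta_0:
  assumes "Im z \<noteq> 0"
  shows "zeta 0 z = (if Im z > 0 then 1 else -1)"
proof -
  have "z \<noteq> 0" using assms by auto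
  have "kk 0 z = (if Im z > 0 then z else - z)"
    using assms by (auto simp: kk_def intro!: bsqrt_unique)
  then show ?thesis using \<open>z \<noteq> 0\<close> by (simp add: zeta_def)
qed

text \<open>For m = 0 the branch convention makes k equal to z or -z, so \<zeta> is 1 on the upper
  and -1 on the lower half-plane. The eigenvalue condition is therefore constant on each half-plane:
  all of it or nothing.\<close>

lemma point_spectrum_0:
  "z \<in> point_spectrum 0 A \<longleftrightarrow> (Im z > 0 \<and> det A - 4 = 2 * \<i> * trace A) \<or> (Im z < 0 \<and> det A - 4 = - 2 * \<i> * trace A)"
proof (cases "Im z = 0")
  case True
  then show ?thesis using point_spectrum_cut[of 0 A] by (auto simp: cut_set_0)
next
  case False
  then have z: "z \<notin> cut_set 0" by (simp add: cut_set_0)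
  have tr: "trace A = A $ 1 $ 1 + A $ 2 $ 2" by (simp add: trace_def sum_2)
  have 1: "1 + c - d / 4 = 0 \<longleftrightarrow> d - 4 = 4 * c" for c d :: complex
    by (auto simp: field_simps)
  show ?thesis
  proof (cases "Im z > 0")
    case True
    then show ?thesis
      unfolding point_spectrum_iff[OF z] det_MM[OF z] zeta_0[OF False] 1 by (simp add: tr mult.assoc)
  next
    case neg: False
    have "4 * (\<i> / 2 * (A $ 1 $ 1 * - 1 + A $ 2 $ 2 / - 1)) = - 2 * \<i> * trace A"
      by (simp add: tr algebra_simps)
    then show ?thesis
      unfolding point_spectrum_iff[OF z] det_MM[OF z] zeta_0[OF False] 1 using neg False by (simp add: mult.assoc)
  qed
qed

section \<open>Eigenvalues in the massive case: \<zeta> as a coordinate\<close>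

lemma zeta_sq:
  assumes "z \<notin> cut_set m"
  shows "(zeta m z)\<^sup>2 * (z - m) = z + m"
  using kk_zeta(2,3)[OF assms] by (metis mult.assoc mult.commute power2_eq_square)

text \<open>The square of \<zeta> is the Moebius image (z + m) / (z - m), which determines z as soon
  as m is nonzero: the value t = 1 is then not attained and the linear equation for z is uniquely
  solvable.\<close>

lemma zeta_inj:
  assumes "m \<noteq> 0"
  shows "inj_on (zeta m) (- cut_set m)"
proof (rule inj_onI)
  fix z w assume zw: "z \<in> - cut_set m" "w \<in> - cut_set m" "zeta m z = zeta m w"
  define t where "t = (zeta m z)\<^sup>2"
  have 1: "t * (z - m) = z + m" "t * (w - m) = w + m"
    using zeta_sq[of z m] zeta_sq[of w m] zw by (auto simp: t_def)
  then have "(t - 1) * (z - w) = 0" by (simp add: algebra_simps)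
  moreover have "t \<noteq> 1" using 1(1) assms by auto
  ultimately show "z = w" by simp
qed

lemma point_spectrum_quadratic:
  assumes "z \<in> point_spectrum m A"
  shows "\<i> / 2 * A $ 1 $ 1 * (zeta m z)\<^sup>2 + (1 - det A / 4) * zeta m z + \<i> / 2 * A $ 2 $ 2 = 0"
proof -
  have z: "z \<notin> cut_set m" using assms point_spectrum_cut by blast
  have "\<i> / 2 * A $ 1 $ 1 * (zeta m z)\<^sup>2 + (1 - det A / 4) * zeta m z + \<i> / 2 * A $ 2 $ 2
     = det (MM m A z) * zeta m z"
    unfolding det_MM[OF z] using kk_zeta(4)[OF z] by (simp add: field_simps power2_eq_square)
  then show ?thesis using assms point_spectrum_iff[OF z] by simp
qed

text \<open>Injectivity of \<zeta> sends distinct eigenvalues to distinct roots of a polynomial of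
  degree at most two; its coefficients vanish together only in the excluded case.\<close>

lemma point_spectrum_finite:
  assumes m: "m \<noteq> 0" and "\<not> (A $ 1 $ 1 = 0 \<and> A $ 2 $ 2 = 0 \<and> det A = 4)"
  shows "finite (point_spectrum m A) \<and> card (point_spectrum m A) \<le> 2"
proof -
  define p where "p = [: \<i> / 2 * A $ 2 $ 2, 1 - det A / 4, \<i> / 2 * A $ 1 $ 1 :]"
  have p0: "p \<noteq> 0" using assms(2) by (auto simp: p_def)
  have sub: "zeta m ` point_spectrum m A \<subseteq> {x. poly p x = 0}"
    using point_spectrum_quadratic by (auto simp: p_def power2_eq_square algebra_simps)
  have inj: "inj_on (zeta m) (point_spectrum m A)"
    by (rule inj_on_subset[OF zeta_inj[OF m]]) (use point_spectrum_cut[of m A] in auto)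
  have fin: "finite {x. poly p x = 0}" by (rule poly_roots_finite[OF p0])
  have "card (point_spectrum m A) \<le> card {x. poly p x = 0}"
    by (rule card_inj_on_le[OF inj sub fin])
  also have "\<dots> \<le> degree p" by (rule card_poly_roots_bound[OF p0])
  also have "\<dots> \<le> 2" by (simp add: p_def)
  finally show ?thesis using inj_on_finite[OF inj sub fin] by simp
qed

section \<open>Geometric multiplicity\<close>

lemma subspace_basis:
  fixes V :: "cvec2 set"
  assumes V: "vec.subspace V"
  obtains n and b :: "nat \<Rightarrow> cvec2" where "n \<le> 2" "\<forall>i<n. b i \<in> V"
    "\<forall>c. (\<Sum>i<n. c i *s b i) = 0 \<longrightarrow> (\<forall>i<n. c i = 0)" "\<forall>v\<in>V. \<exists>c. v = (\<Sum>i<n. c i *s b i)"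
proof -
  obtain B where B: "B \<subseteq> V" "vec.independent B" "V \<subseteq> vec.span B" "card B = vec.dim V"
    by (rule vec.basis_exists)
  have fin: "finite B" using B(2) by (rule vec.finiteI_independent)
  obtain b where b: "bij_betw b {0..<card B} B" using ex_bij_betw_nat_finite[OF fin] by blast
  have inj: "inj_on b {..<card B}" and im: "b ` {..<card B} = B"
    using b by (auto simp: bij_betw_def lessThan_atLeast0)
  have sum: "(\<Sum>i<card B. g (b i)) = (\<Sum>v\<in>B. g v)" for g :: "cvec2 \<Rightarrow> cvec2"
    using sum.reindex[OF inj, of g] im by (simp add: o_def)
  show thesis
  proof (rule that)
    have "vec.dim V \<le> vec.dim (UNIV :: cvec2 set)" by (rule vec.dim_subset) simp
    then show "card B \<le> 2" using B(4) by (simp add: card_cart_basis)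
    show "\<forall>i<card B. b i \<in> V" using im B(1) by auto
    have "\<forall>i<card B. c i = 0" if c: "(\<Sum>i<card B. c i *s b i) = 0" for c
    proof -
      \<comment> \<open>Transports coefficients from the enumeration b to the basis vectors, where
        the independence of B applies.\<close>
      define u where "u v = c (the_inv_into {..<card B} b v)" for v
      have u: "u (b i) = c i" if "i < card B" for i
        using that by (simp add: u_def the_inv_into_f_f[OF inj])
      have "(\<Sum>i<card B. c i *s b i) = (\<Sum>i<card B. u (b i) *s b i)" by (rule sum.cong) (auto simp: u)
      then have "(\<Sum>v\<in>B. u v *s v) = 0" using c sum[of "\<lambda>v. u v *s v"] by simp
      then have "\<forall>v\<in>B. u v = 0" using B(2) vec.dependent_finite[OF fin] by blast
      then show ?thesis using u im by (metis imageI lessThan_iff)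
    qed
    then show "\<forall>c. (\<Sum>i<card B. c i *s b i) = 0 \<longrightarrow> (\<forall>i<card B. c i = 0)" by blast
    have "\<exists>c. v = (\<Sum>i<card B. c i *s b i)" if "v \<in> V" for v
    proof -
      have "v \<in> range (\<lambda>u. \<Sum>v\<in>B. u v *s v)" using that B(3) vec.span_finite[OF fin] by blast
      then obtain u where "v = (\<Sum>v\<in>B. u v *s v)" by blast
      then have "v = (\<Sum>i<card B. u (b i) *s b i)" using sum[of "\<lambda>v. u v *s v"] by simp
      then show ?thesis by (intro exI[of _ "\<lambda>i. u (b i)"])
    qed
    then show "\<forall>v\<in>V. \<exists>c. v = (\<Sum>i<card B. c i *s b i)" by blast
  qed
qed

lemma Tsol_zero: "Tsol m z 0 x = 0"
  by (simp add: vec2_eq_iff Tsol_nth)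

lemma Tsol_sum: "Tsol m z (\<Sum>i<(n::nat). c i *s b i) x = (\<Sum>i<n. c i *s Tsol m z (b i) x)"
proof (induction n)
  case (Suc n)
  have "Tsol m z ((\<Sum>i<n. c i *s b i) + c n *s b n) x = Tsol m z (\<Sum>i<n. c i *s b i) x + c n *s Tsol m z (b n) x"
    using Tsol_lincomb[of m z 1 "\<Sum>i<n. c i *s b i" "c n" "b n" x] by simp
  then show ?case using Suc by simp
qed (simp add: Tsol_zero)

lemma subspace_kernel:
  fixes M :: cmat2
  shows "vec.subspace {v. M *v v = 0}"
  unfolding vec.subspace_def
proof (intro conjI ballI allI)
  fix v w :: cvec2 and c assume v: "v \<in> {v. M *v v = 0}" and w: "w \<in> {v. M *v v = 0}"
  show "v + w \<in> {v. M *v v = 0}"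
    using v w matrix_vector_mult_lincomb[of M 1 v 1 w] by simp
  show "c *s v \<in> {v. M *v v = 0}"
    using v matrix_vector_mult_lincomb[of M c v 0 v] by simp
qed simp

text \<open>The map from v to \<open>Tsol m z v\<close> is a linear isomorphism from the kernel of M
  onto the eigenspace modulo null sets: injective by \<open>Tsol_AE_zero\<close>, onto by
  \<open>eigenfunction_form\<close>. It carries a basis to a basis.\<close>

lemma eigenspace_dimension:
  assumes z: "z \<notin> cut_set m"
  shows "\<exists>n\<le>2. ae_cdim (eigenspace_D m A z) n \<and> vec_cdim {v. MM m A z *v v = 0} n"
proof -
  obtain n and b :: "nat \<Rightarrow> cvec2" where n: "n \<le> 2" and b: "\<forall>i<n. b i \<in> {v. MM m A z *v v = 0}"
    "\<forall>c. (\<Sum>i<n. c i *s b i) = 0 \<longrightarrow> (\<forall>i<n. c i = 0)"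
    "\<forall>v\<in>{v. MM m A z *v v = 0}. \<exists>c. v = (\<Sum>i<n. c i *s b i)"
    by (rule subspace_basis[OF subspace_kernel[of "MM m A z"]]) blast
  have "vec_cdim {v. MM m A z *v v = 0} n"
    unfolding vec_cdim_def using b by blast
  moreover have "ae_cdim (eigenspace_D m A z) n"
    unfolding ae_cdim_def
  proof (intro exI[of _ "\<lambda>i. Tsol m z (b i)"] conjI allI impI ballI)
    show "Tsol m z (b i) \<in> eigenspace_D m A z" if "i < n" for i
      using Tsol_eigenfunction[OF z] b(1) that by (simp add: eigenspace_D_def)
    show "c i = 0" if "AE x in lborel. (\<Sum>i<n. c i *s Tsol m z (b i) x) = 0" "i < n" for c i
      using that b(2) Tsol_AE_zero[OF z] unfolding Tsol_sum[symmetric] by blast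
    show "\<exists>c. AE x in lborel. \<psi> x = (\<Sum>i<n. c i *s Tsol m z (b i) x)"
      if \<psi>: "\<psi> \<in> eigenspace_D m A z" for \<psi>
    proof -
      have "dirac_graph m A \<psi> (\<lambda>x. z *s \<psi> x)" using \<psi> by (simp add: eigenspace_D_def)
      then obtain v where v: "MM m A z *v v = 0" "AE x in lborel. \<psi> x = Tsol m z v x"
        by (rule eigenfunction_form[OF z])
      obtain c where "v = (\<Sum>i<n. c i *s b i)" using b(3) v(1) by blast
      then show ?thesis using v(2) by (auto simp: Tsol_sum)
    qed
  qed
  ultimately show ?thesis using n by blast
qed

section \<open>Root spaces\<close>

lemma open_off_cut: "open (- cut_set m)"
proof -
  have "cut_set m = {z. Im z = 0} \<inter> {z. \<bar>m\<bar> \<le> \<bar>Re z\<bar>}" by (auto simp: cut_set_def)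
  moreover have "closed {z. Im z = 0}" "closed {z. \<bar>m\<bar> \<le> \<bar>Re z\<bar>}"
    by (intro closed_Collect_eq closed_Collect_le continuous_intros)+
  ultimately show ?thesis by (metis closed_Int open_Compl)
qed

lemma eventually_off_cut: "z \<notin> cut_set m \<Longrightarrow> \<forall>\<^sub>F w in at z. w \<notin> cut_set m"
  using eventually_at_in_open'[OF open_off_cut, of z m] by (auto elim: eventually_mono)

text \<open>Off the cut, -(z^2 - m^2) avoids the half-line where the principal root is
  discontinuous, so the rotated form of the branch is continuous.\<close>

lemma kk_tendsto:
  assumes z: "z \<notin> cut_set m"
  shows "(kk m \<longlongrightarrow> kk m z) (at z)"
proof -
  have eq: "kk m w = \<i> * csqrt (- (w\<^sup>2 - (complex_of_real m)\<^sup>2))" if "w \<notin> cut_set m" for w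
    unfolding kk_def using bsqrt_eq(1)[OF off_cut_nonneg_Reals[OF that]] .
  have "- (z\<^sup>2 - (complex_of_real m)\<^sup>2) \<notin> \<real>\<^sub>\<le>\<^sub>0"
    using off_cut_nonneg_Reals[OF z] by (metis minus_minus uminus_nonneg_Reals_iff)
  then have "isCont csqrt (- (z\<^sup>2 - (complex_of_real m)\<^sup>2))" by (rule continuous_at_csqrt)
  then have "((\<lambda>w. \<i> * csqrt (- (w\<^sup>2 - (complex_of_real m)\<^sup>2))) \<longlongrightarrow> \<i> * csqrt (- (z\<^sup>2 - (complex_of_real m)\<^sup>2))) (at z)"
    by (intro tendsto_mult tendsto_const isCont_tendsto_compose[of _ csqrt]) (auto intro!: tendsto_intros)
  then have "((\<lambda>w. \<i> * csqrt (- (w\<^sup>2 - (complex_of_real m)\<^sup>2))) \<longlongrightarrow> kk m z) (at z)"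
    using eq[OF z] by simp
  then show ?thesis
    by (rule Lim_transform_eventually) (use eventually_off_cut[OF z] eq in \<open>auto elim!: eventually_mono\<close>)
qed

lemma zeta_tendsto:
  assumes z: "z \<notin> cut_set m"
  shows "(zeta m \<longlongrightarrow> zeta m z) (at z)"
proof -
  have "kk m z \<noteq> 0" using kk_zeta(1)[OF z] by auto
  then show ?thesis
    unfolding zeta_def[abs_def] by (intro tendsto_intros kk_tendsto z)
qed

text \<open>In the variable \<open>\<zeta>\<close>, the function \<open>\<zeta> det M\<close> is a quadratic polynomial, and \<open>\<zeta>\<close> is a local
  coordinate at \<open>z\<close>; hence zeros of \<open>det M\<close> have order at most two.\<close>
lemma det_MM_order:
  assumes m: "m \<noteq> 0" and z: "z \<notin> cut_set m" "det (MM m A z) = 0"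
    and A: "\<not> (A $ 1 $ 1 = 0 \<and> A $ 2 $ 2 = 0 \<and> det A = 4)"
  shows "((\<lambda>w. (w - z) ^ 3 / det (MM m A w)) \<longlongrightarrow> 0) (at z)"
proof -
  define \<zeta> where "\<zeta> = zeta m"
  define a where "a = \<i> / 2 * A $ 1 $ 1"
  define c where "c = 1 - det A / 4"
  \<comment> \<open>The derivative of the quadratic at its root \<open>\<zeta> z\<close>: Taylor
    expansion there leaves the factor \<open>a * (\<zeta> w - \<zeta> z) + b\<close>, and b = 0
    means a double root.\<close>
  define b where "b = 2 * a * \<zeta> z + c"
  define e where "e = \<i> / 2 * A $ 2 $ 2"
  have q: "det (MM m A w) * \<zeta> w = a * (\<zeta> w)\<^sup>2 + c * \<zeta> w + e" if "w \<notin> cut_set m" for w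
    unfolding det_MM[OF that] \<zeta>_def a_def c_def e_def using kk_zeta(4)[OF that]
    by (simp add: field_simps power2_eq_square)
  have "a * (\<zeta> z)\<^sup>2 + c * \<zeta> z + e = 0" using q[OF z(1)] z(2) by simp
  then have e: "e = - (a * (\<zeta> z)\<^sup>2 + c * \<zeta> z)" by (rule add_eq_0_iff[THEN iffD1])
  have d: "det (MM m A w) = (\<zeta> w - \<zeta> z) * (a * (\<zeta> w - \<zeta> z) + b) / \<zeta> w" if "w \<notin> cut_set m" for w
  proof -
    have "det (MM m A w) * \<zeta> w = (\<zeta> w - \<zeta> z) * (a * (\<zeta> w - \<zeta> z) + b)"
      unfolding q[OF that] e b_def by (simp add: algebra_simps power2_eq_square)
    then show ?thesis using kk_zeta(4)[OF that] by (simp add: \<zeta>_def field_simps)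
  qed
  have ab: "a \<noteq> 0 \<or> b \<noteq> 0"
  proof (rule ccontr)
    assume "\<not> (a \<noteq> 0 \<or> b \<noteq> 0)"
    then have "a = 0" "c = 0" "e = 0" using e by (auto simp: b_def)
    then show False using A by (auto simp: a_def c_def e_def)
  qed
  define t where "t = (\<zeta> z)\<^sup>2"
  have t: "t * (z - m) = z + m" using zeta_sq[OF z(1)] by (simp add: t_def \<zeta>_def)
  then have t1: "1 - t \<noteq> 0" using m by auto
  \<comment> \<open>The exact form of \<zeta> being a local coordinate: w - z is the increment of
    \<zeta> times a factor with a finite limit. It comes from subtracting the relations \<zeta>^2 (z
    - m) = z + m at w and at z.\<close>
  have lin: "(w - z) = (\<zeta> w - \<zeta> z) * ((\<zeta> w + \<zeta> z) * (w - m) / (1 - t))" if "w \<notin> cut_set m" for w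
  proof -
    have "(\<zeta> w)\<^sup>2 * (w - m) = w + m" using zeta_sq[OF that] by (simp add: \<zeta>_def)
    then have "(\<zeta> w - \<zeta> z) * ((\<zeta> w + \<zeta> z) * (w - m)) = (w + m) - t * (w - m)"
      by (simp add: t_def power2_eq_square algebra_simps)
    also have "\<dots> = (1 - t) * (w - z)" using t by (simp add: algebra_simps)
    finally show ?thesis using t1 by (simp add: field_simps)
  qed
  have \<zeta>lim: "(\<zeta> \<longlongrightarrow> \<zeta> z) (at z)" using zeta_tendsto[OF z(1)] by (simp add: \<zeta>_def)
  define L where "L w = (\<zeta> w + \<zeta> z) * (w - m) / (1 - t)" for w
  have Llim: "(L \<longlongrightarrow> L z) (at z)" unfolding L_def using t1 by (intro tendsto_intros \<zeta>lim)
  have ev: "\<forall>\<^sub>F w in at z. w \<notin> cut_set m \<and> w \<noteq> z"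
    using eventually_off_cut[OF z(1)] eventually_neq_at_within[of z z] by eventually_elim auto
  have neq: "\<zeta> w \<noteq> \<zeta> z" if "w \<notin> cut_set m" "w \<noteq> z" for w
    using zeta_inj[OF m] that z(1) by (auto simp: \<zeta>_def inj_on_def)
  show ?thesis
  proof (cases "b = 0")
    case False
    have "((\<lambda>w. L w * \<zeta> w * (w - z)\<^sup>2 / (a * (\<zeta> w - \<zeta> z) + b)) \<longlongrightarrow>
        L z * \<zeta> z * (z - z)\<^sup>2 / (a * (\<zeta> z - \<zeta> z) + b)) (at z)"
      using False by (intro tendsto_intros Llim \<zeta>lim) auto
    then have "((\<lambda>w. L w * \<zeta> w * (w - z)\<^sup>2 / (a * (\<zeta> w - \<zeta> z) + b)) \<longlongrightarrow> 0) (at z)" by simp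
    moreover have "\<forall>\<^sub>F w in at z. L w * \<zeta> w * (w - z)\<^sup>2 / (a * (\<zeta> w - \<zeta> z) + b) = (w - z) ^ 3 / det (MM m A w)"
      using ev
    proof eventually_elim
      case (elim w)
      have l: "(\<zeta> w - \<zeta> z) * L w = w - z" using lin[of w] elim by (simp add: L_def)
      have "(w - z) ^ 3 = (\<zeta> w - \<zeta> z) * L w * (w - z)\<^sup>2"
        unfolding l by (simp add: power3_eq_cube power2_eq_square)
      then show ?case using d[of w] neq[of w] elim by simp
    qed
    ultimately show ?thesis by (rule Lim_transform_eventually)
  next
    case True
    then have a: "a \<noteq> 0" using ab by simp
    \<comment> \<open>At a double zero two factors of (w - z)^3 cancel the determinant and a single
      factor w - z remains; this is why the third power is taken.\<close>
    have "((\<lambda>w. (L w)\<^sup>2 * \<zeta> w * (w - z) / a) \<longlongrightarrow> (L z)\<^sup>2 * \<zeta> z * (z - z) / a) (at z)"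
      using a by (intro tendsto_intros Llim \<zeta>lim)
    then have "((\<lambda>w. (L w)\<^sup>2 * \<zeta> w * (w - z) / a) \<longlongrightarrow> 0) (at z)" by simp
    moreover have "\<forall>\<^sub>F w in at z. (L w)\<^sup>2 * \<zeta> w * (w - z) / a = (w - z) ^ 3 / det (MM m A w)"
      using ev
    proof eventually_elim
      case (elim w)
      have l: "(\<zeta> w - \<zeta> z) * L w = w - z" using lin[of w] elim by (simp add: L_def)
      have "(w - z) ^ 3 = ((\<zeta> w - \<zeta> z) * L w) * ((\<zeta> w - \<zeta> z) * L w) * (w - z)"
        unfolding l by (simp add: power3_eq_cube)
      then have "(w - z) ^ 3 = (\<zeta> w - \<zeta> z) * (\<zeta> w - \<zeta> z) * ((L w)\<^sup>2 * (w - z))"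
        by (simp add: power2_eq_square mult_ac)
      moreover have "det (MM m A w) = (\<zeta> w - \<zeta> z) * (\<zeta> w - \<zeta> z) * a / \<zeta> w"
        using d[of w] True elim by (simp add: mult_ac)
      ultimately show ?case using neq[of w] elim a by simp
    qed
    ultimately show ?thesis by (rule Lim_transform_eventually)
  qed
qed

text \<open>In each excluded situation the point spectrum contains an open set around z, a
  half-plane or the whole complement of the cut, so z would be a limit point of the spectrum. In
  particular no eigenvalue is isolated when m = 0.\<close>

lemma isolated_nondegenerate:
  assumes z: "z \<in> point_spectrum m A" "\<not> z islimpt spectrum_D m A"
  shows "m \<noteq> 0" "\<not> (A $ 1 $ 1 = 0 \<and> A $ 2 $ 2 = 0 \<and> det A = 4)"
proof -
  have lim: False if "open S" "z \<in> S" "S \<subseteq> point_spectrum m A" for S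
  proof -
    have "z \<in> interior (spectrum_D m A)" using that by (intro interiorI[of S]) (auto simp: spectrum_eq)
    then show False using z(2) interior_limit_point by blast
  qed
  show m: "m \<noteq> 0"
  proof
    assume m: "m = 0"
    have "z \<in> point_spectrum 0 A" using z(1) m by simp
    then consider "Im z > 0" "det A - 4 = 2 * \<i> * trace A" | "Im z < 0" "det A - 4 = - 2 * \<i> * trace A"
      unfolding point_spectrum_0 by blast
    then show False
    proof cases
      case 1
      then have "{w. Im w > 0} \<subseteq> point_spectrum m A" by (auto simp: m point_spectrum_0)
      then show False using lim[OF open_halfspace_Im_gt[of 0]] 1(1) by simp
    next
      case 2
      then have "{w. Im w < 0} \<subseteq> point_spectrum m A" by (auto simp: m point_spectrum_0)
      then show False using lim[OF open_halfspace_Im_lt[of 0]] 2(1) by simp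
    qed
  qed
  show "\<not> (A $ 1 $ 1 = 0 \<and> A $ 2 $ 2 = 0 \<and> det A = 4)"
  proof
    assume "A $ 1 $ 1 = 0 \<and> A $ 2 $ 2 = 0 \<and> det A = 4"
    then have "- cut_set m \<subseteq> point_spectrum m A" by (auto simp: point_spectrum_iff det_MM)
    then show False using lim[OF open_off_cut] z(1) point_spectrum_cut by blast
  qed
qed

text \<open>Continuity of k and \<zeta> at z gives one N valid for all w near z, and with it a
  constant K that does not depend on w.\<close>

lemma res_bound_near:
  assumes z: "z \<notin> cut_set m"
  obtains K where "K \<ge> 0" "\<forall>\<^sub>F w in at z. w \<notin> cut_set m \<and> (det (MM m A w) \<noteq> 0 \<longrightarrow>
    (\<forall>f \<psi>. L2 f \<longrightarrow> dirac_graph m A \<psi> (\<lambda>x. f x + w *s \<psi> x) \<longrightarrow>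
      sqnorm \<psi> \<le> K * (1 + 1 / (norm (det (MM m A w)))\<^sup>2) * sqnorm f))"
proof -
  obtain a where a: "\<And>i j. norm (A $ i $ j) \<le> a" using matrix_entries_bounded[of A] by blast
  note k = kk_zeta[OF z]
  define N where "N = 2 + norm (zeta m z) + norm (1 / zeta m z) + 1 / Im (kk m z)"
  have l: "norm (zeta m z) < N" "norm (1 / zeta m z) < N" "1 / Im (kk m z) < N" and N1: "1 \<le> N"
    using k(1) by (auto simp: N_def intro!: add_nonneg_pos add_pos_nonneg add_increasing add_nonneg_nonneg)
  have "\<forall>\<^sub>F w in at z. norm (zeta m w) < N"
    by (rule order_tendstoD(2)[OF tendsto_norm[OF zeta_tendsto[OF z]] l(1)])
  moreover have "\<forall>\<^sub>F w in at z. norm (1 / zeta m w) < N"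
    by (rule order_tendstoD(2)[OF tendsto_norm[OF tendsto_divide[OF tendsto_const zeta_tendsto[OF z] k(4)]] l(2)])
  moreover have "\<forall>\<^sub>F w in at z. 1 / Im (kk m w) < N"
    using k(1) by (intro order_tendstoD(2)[OF tendsto_divide[OF tendsto_const tendsto_Im[OF kk_tendsto[OF z]]] l(3)]) auto
  moreover note eventually_off_cut[OF z]
  ultimately have ev: "\<forall>\<^sub>F w in at z. w \<notin> cut_set m \<and> (det (MM m A w) \<noteq> 0 \<longrightarrow>
    (\<forall>f \<psi>. L2 f \<longrightarrow> dirac_graph m A \<psi> (\<lambda>x. f x + w *s \<psi> x) \<longrightarrow>
      sqnorm \<psi> \<le> (8 * N ^ 6 + 128 * (1 + a * N)\<^sup>2 * a\<^sup>2 * N ^ 8) *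
        (1 + 1 / (norm (det (MM m A w)))\<^sup>2) * sqnorm f))"
  proof eventually_elim
    case (elim w)
    show ?case
    proof (intro conjI impI allI)
      show w: "w \<notin> cut_set m" by (rule elim)
      fix f \<psi> assume d: "det (MM m A w) \<noteq> 0" and f: "L2 f" and \<psi>: "dirac_graph m A \<psi> (\<lambda>x. f x + w *s \<psi> x)"
      note r = dirac_graph_res_sol[OF w d f]
      have "sqnorm \<psi> = sqnorm (res_sol m A w f)"
        by (rule sqnorm_cong_AE[OF dirac_graph_L2[OF \<psi>] dirac_graph_L2[OF r] dirac_unique[OF w d \<psi> r]])
      then show "sqnorm \<psi> \<le> (8 * N ^ 6 + 128 * (1 + a * N)\<^sup>2 * a\<^sup>2 * N ^ 8) *
          (1 + 1 / (norm (det (MM m A w)))\<^sup>2) * sqnorm f"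
        using res_sol_bound[OF w N1 _ _ _ d f a] elim by simp
    qed
  qed
  have "0 \<le> 8 * N ^ 6 + 128 * (1 + a * N)\<^sup>2 * a\<^sup>2 * N ^ 8" using N1 by simp
  then show thesis using ev by (rule that)
qed

text \<open>A Jordan chain \<open>\<eta>, \<phi>, \<psi>\<close> gives \<open>(D - w)(\<eta> + \<epsilon>\<phi> + \<epsilon>\<^sup>2\<psi>) = -\<epsilon>\<^sup>3\<psi>\<close> with \<open>\<epsilon> = w - z\<close>, while the
  resolvent at \<open>w\<close> grows at most like \<open>\<epsilon>\<^sup>-\<^sup>2\<close>.\<close>
lemma jordan_chain_le_2:
  assumes z: "z \<notin> cut_set m"
    and lim: "((\<lambda>w. (w - z) ^ 3 / det (MM m A w)) \<longlongrightarrow> 0) (at z)"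
    and iso: "\<forall>\<^sub>F w in at z. det (MM m A w) \<noteq> 0"
    and ch: "dirac_graph m A \<eta> (\<lambda>x. z *s \<eta> x)" "dirac_graph m A \<phi> (\<lambda>x. z *s \<phi> x + \<eta> x)"
      "dirac_graph m A \<psi> (\<lambda>x. z *s \<psi> x + \<phi> x)"
  shows "AE x in lborel. \<eta> x = 0"
proof -
  obtain K where K: "K \<ge> 0" "\<forall>\<^sub>F w in at z. w \<notin> cut_set m \<and> (det (MM m A w) \<noteq> 0 \<longrightarrow>
    (\<forall>f \<psi>. L2 f \<longrightarrow> dirac_graph m A \<psi> (\<lambda>x. f x + w *s \<psi> x) \<longrightarrow>
      sqnorm \<psi> \<le> K * (1 + 1 / (norm (det (MM m A w)))\<^sup>2) * sqnorm f))"
    by (rule res_bound_near[OF z])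
  note L = dirac_graph_L2[OF ch(1)] dirac_graph_L2[OF ch(2)] dirac_graph_L2[OF ch(3)]
  \<comment> \<open>The first term is the resolvent bound for the right-hand side -\<epsilon>^3
    \<psi>, with the factor 1 + 1/|det|^2 multiplied out; the others bound the terms \<epsilon>
    \<phi> and \<epsilon>^2 \<psi> that separate the combination from \<eta>. All of them tend to
    zero.\<close>
  define R where "R w = 2 * (K * ((norm (w - z)) ^ 6 + (norm ((w - z) ^ 3 / det (MM m A w)))\<^sup>2) * sqnorm \<psi>)
    + 4 * (norm (w - z))\<^sup>2 * sqnorm \<phi> + 4 * (norm (w - z)) ^ 4 * sqnorm \<psi>" for w
  have ev: "\<forall>\<^sub>F w in at z. sqnorm \<eta> \<le> R w"
    using K(2) iso
  proof eventually_elim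
    case (elim w)
    define \<epsilon> where "\<epsilon> = w - z"
    define \<Psi> where "\<Psi> x = 1 *s (1 *s \<eta> x + \<epsilon> *s \<phi> x) + \<epsilon>\<^sup>2 *s \<psi> x" for x
    define f where "f x = (- (\<epsilon> ^ 3)) *s \<psi> x" for x
    have "dirac_graph m A \<Psi> (\<lambda>x. 1 *s (1 *s (z *s \<eta> x) + \<epsilon> *s (z *s \<phi> x + \<eta> x)) + \<epsilon>\<^sup>2 *s (z *s \<psi> x + \<phi> x))"
      unfolding \<Psi>_def by (intro dirac_graph_lincomb ch)
    moreover have "1 *s (1 *s (z *s \<eta> x) + \<epsilon> *s (z *s \<phi> x + \<eta> x)) + \<epsilon>\<^sup>2 *s (z *s \<psi> x + \<phi> x)
        = f x + w *s \<Psi> x" for x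
    proof -
      have "w = z + \<epsilon>" by (simp add: \<epsilon>_def)
      then show ?thesis
        by (simp add: vec2_eq_iff f_def \<Psi>_def algebra_simps power2_eq_square power3_eq_cube)
    qed
    ultimately have g: "dirac_graph m A \<Psi> (\<lambda>x. f x + w *s \<Psi> x)" by simp
    have "L2 f" unfolding f_def by (rule L2_smult[OF L(3)])
    then have "sqnorm \<Psi> \<le> K * (1 + 1 / (norm (det (MM m A w)))\<^sup>2) * sqnorm f"
      using elim g by blast
    also have "\<dots> = K * ((norm \<epsilon>) ^ 6 + (norm (\<epsilon> ^ 3 / det (MM m A w)))\<^sup>2) * sqnorm \<psi>"
      unfolding f_def sqnorm_smult by (simp add: norm_divide norm_power power_divide algebra_simps flip: power_mult)
    finally have 1: "sqnorm \<Psi> \<le> K * ((norm \<epsilon>) ^ 6 + (norm (\<epsilon> ^ 3 / det (MM m A w)))\<^sup>2) * sqnorm \<psi>" .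
    define \<rho> where "\<rho> x = (- \<epsilon>) *s \<phi> x + (- (\<epsilon>\<^sup>2)) *s \<psi> x" for x
    have \<eta>: "\<eta> x = \<Psi> x + \<rho> x" for x by (simp add: vec2_eq_iff \<Psi>_def \<rho>_def)
    have L\<rho>: "L2 \<rho>" unfolding \<rho>_def by (intro L2_lincomb L)
    have "sqnorm \<eta> \<le> 2 * sqnorm \<Psi> + 2 * sqnorm \<rho>"
      using sqnorm_add_le[of \<Psi> \<rho>] L2_integrable[OF dirac_graph_L2[OF g]] L2_integrable[OF L\<rho>] L2_integrable[OF L(1)]
      unfolding \<eta>[symmetric] by simp
    moreover have "sqnorm \<rho> \<le> 2 * ((norm \<epsilon>)\<^sup>2 * sqnorm \<phi>) + 2 * ((norm \<epsilon>) ^ 4 * sqnorm \<psi>)"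
    proof -
      have "sqnorm \<rho> \<le> 2 * sqnorm (\<lambda>x. (- \<epsilon>) *s \<phi> x) + 2 * sqnorm (\<lambda>x. (- (\<epsilon>\<^sup>2)) *s \<psi> x)"
        unfolding \<rho>_def by (intro sqnorm_add_le L2_integrable L2_smult L2_lincomb L)
      then show ?thesis unfolding sqnorm_smult by (simp add: norm_power flip: power_mult)
    qed
    ultimately show ?case using 1 unfolding R_def \<epsilon>_def by linarith
  qed
  have "(R \<longlongrightarrow> 2 * (K * ((norm (z - z)) ^ 6 + (norm (0::complex))\<^sup>2) * sqnorm \<psi>)
    + 4 * (norm (z - z))\<^sup>2 * sqnorm \<phi> + 4 * (norm (z - z)) ^ 4 * sqnorm \<psi>) (at z)"
    unfolding R_def by (intro tendsto_intros lim)
  then have "(R \<longlongrightarrow> 0) (at z)" by simp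
  then have "sqnorm \<eta> \<le> 0" by (rule tendsto_lowerbound[OF _ ev]) simp
  then show ?thesis using sqnorm_zero_AE[OF L(1)] sqnorm_nonneg[of \<eta>] by linarith
qed

section \<open>Finite-dimensional root spaces modulo null sets\<close>

lemma dirac_graph_AE_zero:
  assumes "L2 \<psi>" "AE x in lborel. \<psi> x = 0" "AE x in lborel. \<phi> x = 0"
  shows "dirac_graph m A \<psi> \<phi>"
proof -
  have "H1_split \<psi> (\<lambda>_. 0) (\<lambda>_. 0)" using assms(1,2) L2_zero by (simp add: H1_split_def)
  moreover have "AE x in lborel. \<phi> x = (mat (- \<i>) ** sigma1) *v 0 + (mat (complex_of_real m) ** sigma3) *v \<psi> x"
    using assms(2,3) by eventually_elim simp
  ultimately show ?thesis
    unfolding dirac_graph_def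
    by (intro exI[of _ "\<lambda>_. 0"] exI[of _ 0] conjI) auto
qed

text \<open>Linear algebra modulo a.e. equality: among the index sets that still span, one of least
  cardinality is independent, because a nontrivial relation would allow one of its members to be
  eliminated.\<close>

lemma ae_cdim_exists:
  fixes b :: "nat \<Rightarrow> real \<Rightarrow> cvec2"
  assumes b: "\<And>i. i < N \<Longrightarrow> b i \<in> V"
    and span: "\<And>v. v \<in> V \<Longrightarrow> \<exists>c. AE x in lborel. v x = (\<Sum>i<N. c i *s b i x)"
  shows "\<exists>n. ae_cdim V n"
proof -
  define P where "P I \<longleftrightarrow> I \<subseteq> {..<N} \<and> (\<forall>v\<in>V. \<exists>c. AE x in lborel. v x = (\<Sum>i\<in>I. c i *s b i x))" for I
  have "P {..<N}" using span by (simp add: P_def)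
  then obtain I where I: "P I" "\<And>J. P J \<Longrightarrow> card I \<le> card J"
    using ex_has_least_nat[of P "{..<N}" card] by blast
  have sub: "I \<subseteq> {..<N}" and fin: "finite I" and sp: "\<And>v. v \<in> V \<Longrightarrow> \<exists>c. AE x in lborel. v x = (\<Sum>i\<in>I. c i *s b i x)"
    using I(1) finite_subset[of I "{..<N}"] by (auto simp: P_def)
  have indep: "c j = 0" if c: "AE x in lborel. (\<Sum>i\<in>I. c i *s b i x) = 0" and j: "j \<in> I" for c j
  proof (rule ccontr)
    assume cj: "c j \<noteq> 0"
    have "P (I - {j})"
      unfolding P_def
    proof (intro conjI ballI)
      show "I - {j} \<subseteq> {..<N}" using sub by blast
      fix v assume "v \<in> V"
      then obtain d where d: "AE x in lborel. v x = (\<Sum>i\<in>I. d i *s b i x)" using sp by blast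
      \<comment> \<open>Subtracting \<open>d j / c j\<close> times the relation cancels the
        coefficient of index j.\<close>
      have "AE x in lborel. v x = (\<Sum>i\<in>I - {j}. (d i - d j / c j * c i) *s b i x)"
        using d c
      proof eventually_elim
        case (elim x)
        have "(\<Sum>i\<in>I - {j}. (d i - d j / c j * c i) *s b i x) = (\<Sum>i\<in>I. (d i - d j / c j * c i) *s b i x)"
          using cj sum.remove[OF fin j, of "\<lambda>i. (d i - d j / c j * c i) *s b i x"] by simp
        also have "\<dots> = (\<Sum>i\<in>I. d i *s b i x - (d j / c j) *s (c i *s b i x))"
          by (rule sum.cong) (simp_all add: vec2_eq_iff algebra_simps)
        also have "\<dots> = (\<Sum>i\<in>I. d i *s b i x) - (d j / c j) *s (\<Sum>i\<in>I. c i *s b i x)"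
          by (simp only: sum_subtractf vec.scale_sum_right)
        finally show ?case using elim by simp
      qed
      then show "\<exists>c. AE x in lborel. v x = (\<Sum>i\<in>I - {j}. c i *s b i x)"
        by (intro exI[of _ "\<lambda>i. d i - d j / c j * c i"])
    qed
    then have "card I \<le> card (I - {j})" by (rule I(2))
    then show False using j fin by (metis card_Diff1_less leD)
  qed
  obtain e where e: "bij_betw e {0..<card I} I" using ex_bij_betw_nat_finite[OF fin] by blast
  have inj: "inj_on e {..<card I}" and im: "e ` {..<card I} = I"
    using e by (auto simp: bij_betw_def lessThan_atLeast0)
  have sum: "(\<Sum>i<card I. g (e i)) = (\<Sum>i\<in>I. g i)" for g :: "nat \<Rightarrow> cvec2"
    using sum.reindex[OF inj, of g] im by (simp add: o_def)
  have "ae_cdim V (card I)"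
    unfolding ae_cdim_def
  proof (intro exI[of _ "\<lambda>i. b (e i)"] conjI allI impI ballI)
    show "b (e i) \<in> V" if "i < card I" for i using that im sub b by auto
    show "c i = 0" if c: "AE x in lborel. (\<Sum>i<card I. c i *s b (e i) x) = 0" and i: "i < card I" for c i
    proof -
      define u where "u j = c (the_inv_into {..<card I} e j)" for j
      have u: "u (e i) = c i" if "i < card I" for i
        using that by (simp add: u_def the_inv_into_f_f[OF inj])
      have "(\<Sum>i<card I. c i *s b (e i) x) = (\<Sum>j\<in>I. u j *s b j x)" for x
        unfolding sum[symmetric] by (rule sum.cong) (auto simp: u)
      then have "u (e i) = 0" using indep[of u "e i"] c i im by auto
      then show ?thesis using u[OF i] by simp
    qed
    show "\<exists>c. AE x in lborel. v x = (\<Sum>i<card I. c i *s b (e i) x)" if v: "v \<in> V" for v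
    proof -
      obtain c where "AE x in lborel. v x = (\<Sum>i\<in>I. c i *s b i x)" using sp[OF v] by blast
      then have "AE x in lborel. v x = (\<Sum>i<card I. c (e i) *s b (e i) x)" by (simp only: sum[symmetric])
      then show ?thesis by (intro exI[of _ "\<lambda>i. c (e i)"])
    qed
  qed
  then show ?thesis by blast
qed

lemma gen_eig_1_iff: "gen_eig m A z (Suc 0) \<psi> \<longleftrightarrow> dirac_graph m A \<psi> (\<lambda>x. z *s \<psi> x)"
proof
  assume "gen_eig m A z (Suc 0) \<psi>"
  then obtain \<omega> where \<omega>: "AE x in lborel. \<omega> x = 0" "dirac_graph m A \<psi> (\<lambda>x. z *s \<psi> x + \<omega> x)" by auto
  have "AE x in lborel. z *s \<psi> x + \<omega> x = z *s \<psi> x" using \<omega>(1) by eventually_elim simp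
  then show "dirac_graph m A \<psi> (\<lambda>x. z *s \<psi> x)" by (rule dirac_graph_cong_AE[OF \<omega>(2)])
next
  assume "dirac_graph m A \<psi> (\<lambda>x. z *s \<psi> x)"
  then show "gen_eig m A z (Suc 0) \<psi>"
    unfolding gen_eig.simps by (intro exI[of _ "\<lambda>_. 0"]) (simp add: L2_zero)
qed

text \<open>By induction the function \<phi> below \<psi> lies at level two, so \<eta>, \<phi>,
  \<psi> form a chain over an eigenfunction \<eta>. The bound on chains gives \<eta> = 0 a.e., which
  lowers \<phi> to level one and \<psi> to level two.\<close>

lemma gen_eig_le_2:
  assumes z: "z \<in> point_spectrum m A" "\<not> z islimpt spectrum_D m A" and "gen_eig m A z k \<psi>"
  shows "gen_eig m A z (Suc (Suc 0)) \<psi>"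
  using assms(3)
proof (induction k arbitrary: \<psi>)
  case 0
  then have \<psi>: "L2 \<psi>" "AE x in lborel. \<psi> x = 0" by auto
  have "AE x in lborel. z *s \<psi> x + \<psi> x = 0" using \<psi>(2) by eventually_elim simp
  then have "dirac_graph m A \<psi> (\<lambda>x. z *s \<psi> x + \<psi> x)" by (rule dirac_graph_AE_zero[OF \<psi>])
  moreover from this 0 have "gen_eig m A z (Suc 0) \<psi>" unfolding gen_eig.simps(2) by blast
  ultimately show ?case unfolding gen_eig.simps(2)[of m A z "Suc 0"] by blast
next
  case (Suc k)
  obtain \<phi> where \<phi>: "gen_eig m A z k \<phi>" "dirac_graph m A \<psi> (\<lambda>x. z *s \<psi> x + \<phi> x)"
    using Suc.prems by auto
  obtain \<eta> where \<eta>: "gen_eig m A z (Suc 0) \<eta>" "dirac_graph m A \<phi> (\<lambda>x. z *s \<phi> x + \<eta> x)"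
    using Suc.IH[OF \<phi>(1)] unfolding gen_eig.simps(2)[of m A z "Suc 0"] by blast
  have \<eta>1: "dirac_graph m A \<eta> (\<lambda>x. z *s \<eta> x)" using \<eta>(1) by (simp only: gen_eig_1_iff)
  have zc: "z \<notin> cut_set m" using z(1) point_spectrum_cut by blast
  note nd = isolated_nondegenerate[OF z]
  have "\<forall>\<^sub>F w in at z. w \<notin> spectrum_D m A"
    using z(2) by (simp add: islimpt_iff_eventually)
  then have iso: "\<forall>\<^sub>F w in at z. det (MM m A w) \<noteq> 0"
    by eventually_elim (auto simp: spectrum_eq point_spectrum_iff)
  have "AE x in lborel. \<eta> x = 0"
    using det_MM_order[OF nd(1) zc _ nd(2)] z(1) point_spectrum_iff[OF zc]
    by (intro jordan_chain_le_2[OF zc _ iso \<eta>1 \<eta>(2) \<phi>(2)]) auto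
  then have "gen_eig m A z 0 \<eta>" using dirac_graph_L2[OF \<eta>1] by simp
  then have "gen_eig m A z (Suc 0) \<phi>" using \<eta>(2) unfolding gen_eig.simps(2) by blast
  then show ?case using \<phi>(2) unfolding gen_eig.simps(2)[of m A z "Suc 0"] by blast
qed

lemma dirac_graph_zero: "dirac_graph m A (\<lambda>_. 0) (\<lambda>_. 0)"
  by (rule dirac_graph_AE_zero[OF L2_zero]) auto

lemma dirac_graph_sum:
  assumes "\<And>i. i < (n::nat) \<Longrightarrow> dirac_graph m A (\<psi> i) (\<phi> i)"
  shows "dirac_graph m A (\<lambda>x. \<Sum>i<n. c i *s \<psi> i x) (\<lambda>x. \<Sum>i<n. c i *s \<phi> i x)"
  using assms
proof (induction n)
  case 0
  then show ?case by (simp add: dirac_graph_zero)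
next
  case (Suc n)
  have "dirac_graph m A (\<lambda>x. 1 *s (\<Sum>i<n. c i *s \<psi> i x) + c n *s \<psi> n x) (\<lambda>x. 1 *s (\<Sum>i<n. c i *s \<phi> i x) + c n *s \<phi> n x)"
    using Suc by (intro dirac_graph_lincomb) auto
  then show ?case by simp
qed

lemma root_space_finite_dimensional:
  assumes z: "z \<in> point_spectrum m A" "\<not> z islimpt spectrum_D m A"
  shows "\<exists>n. ae_cdim (root_space m A z) n"
proof -
  have zc: "z \<notin> cut_set m" using z(1) point_spectrum_cut by blast
  \<comment> \<open>Parametrises the eigenfunctions in the range of D - z, those that start a chain
    of length two. Preimages for a basis of W together with the eigenfunctions span the root
    space.\<close>
  define W where "W = {v. MM m A z *v v = 0 \<and> (\<exists>\<psi>. dirac_graph m A \<psi> (\<lambda>x. z *s \<psi> x + Tsol m z v x))}"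
  have W: "vec.subspace W"
    unfolding vec.subspace_def
  proof (intro conjI ballI allI)
    show "0 \<in> W"
      unfolding W_def using dirac_graph_zero[of m A]
      by (auto simp: Tsol_zero intro!: exI[of _ "\<lambda>_. 0"])
    have lc: "a *s v + b *s w \<in> W" if vw: "v \<in> W" "w \<in> W" for a b v w
    proof -
      obtain \<psi> \<psi>' where g: "dirac_graph m A \<psi> (\<lambda>x. z *s \<psi> x + Tsol m z v x)"
          "dirac_graph m A \<psi>' (\<lambda>x. z *s \<psi>' x + Tsol m z w x)"
        using vw unfolding W_def by blast
      have eq: "a *s (z *s \<psi> x + Tsol m z v x) + b *s (z *s \<psi>' x + Tsol m z w x)
          = z *s (a *s \<psi> x + b *s \<psi>' x) + Tsol m z (a *s v + b *s w) x" for x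
        unfolding Tsol_lincomb by (simp add: vec2_eq_iff algebra_simps)
      have "dirac_graph m A (\<lambda>x. a *s \<psi> x + b *s \<psi>' x)
          (\<lambda>x. z *s (a *s \<psi> x + b *s \<psi>' x) + Tsol m z (a *s v + b *s w) x)"
        using dirac_graph_lincomb[OF g, of a b] unfolding eq .
      moreover have "MM m A z *v (a *s v + b *s w) = 0"
        using vw by (simp add: W_def matrix_vector_mult_lincomb)
      ultimately show ?thesis unfolding W_def by blast
    qed
    show "v + w \<in> W" if "v \<in> W" "w \<in> W" for v w using lc[OF that, of 1 1] by simp
    show "c *s v \<in> W" if "v \<in> W" for c v using lc[OF that that, of c 0] by simp
  qed
  obtain n and b :: "nat \<Rightarrow> cvec2" where b: "\<forall>i<n. b i \<in> W" "\<forall>v\<in>W. \<exists>c. v = (\<Sum>i<n. c i *s b i)"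
    by (rule subspace_basis[OF W]) blast
  obtain p and u :: "nat \<Rightarrow> cvec2" where u: "\<forall>i<p. u i \<in> {v. MM m A z *v v = 0}"
    "\<forall>v\<in>{v. MM m A z *v v = 0}. \<exists>c. v = (\<Sum>i<p. c i *s u i)"
    by (rule subspace_basis[OF subspace_kernel[of "MM m A z"]]) blast
  have "\<forall>i. \<exists>\<psi>. i < n \<longrightarrow> dirac_graph m A \<psi> (\<lambda>x. z *s \<psi> x + Tsol m z (b i) x)"
    using b(1) unfolding W_def by blast
  then obtain \<Psi> where \<Psi>: "\<And>i. i < n \<Longrightarrow> dirac_graph m A (\<Psi> i) (\<lambda>x. z *s \<Psi> i x + Tsol m z (b i) x)"
    by metis
  define B where "B i = (if i < n then \<Psi> i else Tsol m z (u (i - n)))" for i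
  have g1: "gen_eig m A z (Suc 0) (Tsol m z v)" if "MM m A z *v v = 0" for v
    unfolding gen_eig_1_iff by (rule Tsol_eigenfunction[OF zc that])
  show ?thesis
  proof (rule ae_cdim_exists)
    show "B i \<in> root_space m A z" if "i < n + p" for i
    proof (cases "i < n")
      case True
      have "MM m A z *v b i = 0" using b(1) True by (auto simp: W_def)
      then have "gen_eig m A z (Suc (Suc 0)) (\<Psi> i)"
        using g1 \<Psi>[OF True] unfolding gen_eig.simps(2)[of m A z "Suc 0"] by blast
      then have "gen_eig m A z (Suc (Suc 0)) (B i)" using True by (simp only: B_def if_True)
      then show ?thesis unfolding root_space_def by blast
    next
      case False
      then have "B i = Tsol m z (u (i - n))" "MM m A z *v u (i - n) = 0"
        using that u(1) by (auto simp: B_def)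
      then have "gen_eig m A z (Suc 0) (B i)" by (simp only: g1)
      then show ?thesis unfolding root_space_def by blast
    qed
    show "\<exists>c. AE x in lborel. \<psi> x = (\<Sum>i<n + p. c i *s B i x)" if \<psi>: "\<psi> \<in> root_space m A z" for \<psi>
    proof -
      obtain k where "gen_eig m A z k \<psi>" using \<psi> unfolding root_space_def by blast
      then have "gen_eig m A z (Suc (Suc 0)) \<psi>" by (rule gen_eig_le_2[OF z])
      then obtain \<phi> where \<phi>: "gen_eig m A z (Suc 0) \<phi>" "dirac_graph m A \<psi> (\<lambda>x. z *s \<psi> x + \<phi> x)"
        unfolding gen_eig.simps(2)[of m A z "Suc 0"] by blast
      obtain v where v: "MM m A z *v v = 0" "AE x in lborel. \<phi> x = Tsol m z v x"
        using \<phi>(1) unfolding gen_eig_1_iff by (rule eigenfunction_form[OF zc])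
      have g: "dirac_graph m A \<psi> (\<lambda>x. z *s \<psi> x + Tsol m z v x)"
        by (rule dirac_graph_cong_AE[OF \<phi>(2)]) (use v(2) in \<open>auto elim: eventually_mono\<close>)
      then have "v \<in> W" using v(1) unfolding W_def by blast
      then obtain c where c: "v = (\<Sum>i<n. c i *s b i)" using b(2) by blast
      \<comment> \<open>The chosen combination of preimages has the same image under D - z as
        \<psi>, so the difference is an eigenfunction or zero.\<close>
      define \<theta> where "\<theta> x = 1 *s \<psi> x + (-1) *s (\<Sum>i<n. c i *s \<Psi> i x)" for x
      have gs: "dirac_graph m A (\<lambda>x. \<Sum>i<n. c i *s \<Psi> i x) (\<lambda>x. \<Sum>i<n. c i *s (z *s \<Psi> i x + Tsol m z (b i) x))"
        by (rule dirac_graph_sum[OF \<Psi>])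
      have gt: "dirac_graph m A \<theta> (\<lambda>x. 1 *s (z *s \<psi> x + Tsol m z v x) + (-1) *s (\<Sum>i<n. c i *s (z *s \<Psi> i x + Tsol m z (b i) x)))"
        unfolding \<theta>_def by (rule dirac_graph_lincomb[OF g gs])
      have eq: "1 *s (z *s \<psi> x + Tsol m z v x) + (-1) *s (\<Sum>i<n. c i *s (z *s \<Psi> i x + Tsol m z (b i) x)) = z *s \<theta> x" for x
      proof -
        have "(\<Sum>i<n. c i *s (z *s \<Psi> i x + Tsol m z (b i) x))
            = (\<Sum>i<n. z *s (c i *s \<Psi> i x) + c i *s Tsol m z (b i) x)"
          by (rule sum.cong) (simp_all add: vec2_eq_iff algebra_simps)
        also have "\<dots> = z *s (\<Sum>i<n. c i *s \<Psi> i x) + Tsol m z v x"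
          by (simp only: sum.distrib vec.scale_sum_right c Tsol_sum)
        finally show ?thesis by (simp add: \<theta>_def vec2_eq_iff algebra_simps)
      qed
      have "dirac_graph m A \<theta> (\<lambda>x. z *s \<theta> x)" using gt unfolding eq .
      then obtain w where w: "MM m A z *v w = 0" "AE x in lborel. \<theta> x = Tsol m z w x"
        by (rule eigenfunction_form[OF zc])
      obtain d where d: "w = (\<Sum>i<p. d i *s u i)" using u(2) w(1) by blast
      define h where "h i = (if i < n then c i else d (i - n))" for i
      have "(\<Sum>i<n + p. h i *s B i x) = (\<Sum>i<n. c i *s \<Psi> i x) + Tsol m z w x" for x
      proof -
        have "(\<Sum>i<n + p. h i *s B i x) = (\<Sum>i<n. h i *s B i x) + (\<Sum>i<p. h (n + i) *s B (n + i) x)"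
          by (induction p) (simp_all add: add.assoc)
        then show ?thesis by (simp add: h_def B_def d Tsol_sum)
      qed
      moreover have "AE x in lborel. \<psi> x = (\<Sum>i<n. c i *s \<Psi> i x) + Tsol m z w x"
        using w(2) by eventually_elim (simp add: \<theta>_def vec2_eq_iff algebra_simps)
      ultimately show ?thesis by (intro exI[of _ h]) simp
    qed
  qed
qed

theorem theorem3p4:
  fixes m :: real and A :: cmat2
  defines "\<alpha> \<equiv> A $ 1 $ 1" and "\<delta> \<equiv> A $ 2 $ 2"
  shows "(spectrum_D m A = cut_set m \<union> point_spectrum m A) \<and>
    (point_spectrum m A \<inter> cut_set m = {}) \<and>
    (\<forall>z. z \<notin> cut_set m \<longrightarrow> (z \<in> point_spectrum m A \<longleftrightarrow> det (MM m A z) = 0)) \<and>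
    (m = 0 \<and> trace A = 0 \<and> det A = 4 \<longrightarrow> point_spectrum m A = {z. Im z \<noteq> 0}) \<and>
    (\<forall>s \<in> {1, -1::real}. m = 0 \<and> trace A \<noteq> 0 \<and> det A - 4 = complex_of_real s * 2 * \<i> * trace A
           \<longrightarrow> point_spectrum m A = {z. s * Im z > 0}) \<and>
    (m \<noteq> 0 \<and> \<alpha> = 0 \<and> \<delta> = 0 \<and> det A = 4 \<longrightarrow> point_spectrum m A = UNIV - cut_set m) \<and>
    (\<not> (m = 0 \<and> trace A = 0 \<and> det A = 4)
         \<and> \<not> (m = 0 \<and> trace A \<noteq> 0 \<and> (det A - 4 = 2 * \<i> * trace A \<or> det A - 4 = - 2 * \<i> * trace A))
         \<and> \<not> (m \<noteq> 0 \<and> \<alpha> = 0 \<and> \<delta> = 0 \<and> det A = 4)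
         \<longrightarrow> finite (point_spectrum m A) \<and> card (point_spectrum m A) \<le> 2) \<and>
    ((m = 0 \<and> trace A = 0 \<and> det A \<noteq> 4)
         \<or> (m = 0 \<and> trace A \<noteq> 0 \<and> det A - 4 \<noteq> 2 * \<i> * trace A \<and> det A - 4 \<noteq> - 2 * \<i> * trace A)
         \<or> (m \<noteq> 0 \<and> \<alpha> = 0 \<and> \<delta> = 0 \<and> det A \<noteq> 4)
         \<or> (m \<noteq> 0 \<and> \<alpha> = 0 \<and> \<delta> \<noteq> 0 \<and> det A = 4)
         \<longrightarrow> point_spectrum m A = {}) \<and>
    (\<forall>z \<in> point_spectrum m A. \<exists>n \<le> 2.
           ae_cdim (eigenspace_D m A z) n \<and> vec_cdim {v. MM m A z *v v = 0} n) \<and>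
    (\<forall>z \<in> point_spectrum m A. \<not> z islimpt spectrum_D m A
           \<longrightarrow> (\<exists>n. ae_cdim (root_space m A z) n)) \<and>
    (\<forall>z. z \<notin> spectrum_D m A \<longrightarrow> (\<forall>f \<psi>. L2 f \<longrightarrow> dirac_graph m A \<psi> (\<lambda>x. f x + z *s \<psi> x)
           \<longrightarrow> (AE x in lborel. integrable lborel (\<lambda>y. res_kernel m A z x y *v f y)
                 \<and> \<psi> x = (\<integral>y. res_kernel m A z x y *v f y \<partial>lborel))))"
proof (intro conjI)
  have ncut: "z \<notin> cut_set m" if "z \<in> point_spectrum m A" for z
    using that point_spectrum_cut by blast
  have gen: "z \<in> point_spectrum m A \<longleftrightarrow> 1 + \<i> / 2 * (\<alpha> * zeta m z + \<delta> / zeta m z) - det A / 4 = 0"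
    if "z \<notin> cut_set m" for z
    unfolding point_spectrum_iff[OF that] det_MM[OF that] \<alpha>_def \<delta>_def ..
  show "spectrum_D m A = cut_set m \<union> point_spectrum m A" by (rule spectrum_eq)
  show "point_spectrum m A \<inter> cut_set m = {}" by (rule point_spectrum_cut)
  show "\<forall>z. z \<notin> cut_set m \<longrightarrow> (z \<in> point_spectrum m A \<longleftrightarrow> det (MM m A z) = 0)"
    using point_spectrum_iff by blast
  show "m = 0 \<and> trace A = 0 \<and> det A = 4 \<longrightarrow> point_spectrum m A = {z. Im z \<noteq> 0}"
    by (auto simp: set_eq_iff point_spectrum_0)
  show "\<forall>s \<in> {1, -1::real}. m = 0 \<and> trace A \<noteq> 0 \<and> det A - 4 = complex_of_real s * 2 * \<i> * trace A
           \<longrightarrow> point_spectrum m A = {z. s * Im z > 0}"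
    by (auto simp: set_eq_iff point_spectrum_0)
  show "m \<noteq> 0 \<and> \<alpha> = 0 \<and> \<delta> = 0 \<and> det A = 4 \<longrightarrow> point_spectrum m A = UNIV - cut_set m"
    using gen ncut by auto
  \<comment> \<open>Covers both massless cases: for trace zero, the two inequalities reduce to det A
    different from 4.\<close>
  have zero: "point_spectrum m A = {}" if "m = 0" "det A - 4 \<noteq> 2 * \<i> * trace A" "det A - 4 \<noteq> - 2 * \<i> * trace A"
    using that by (auto simp: point_spectrum_0)
  show "\<not> (m = 0 \<and> trace A = 0 \<and> det A = 4)
         \<and> \<not> (m = 0 \<and> trace A \<noteq> 0 \<and> (det A - 4 = 2 * \<i> * trace A \<or> det A - 4 = - 2 * \<i> * trace A))
         \<and> \<not> (m \<noteq> 0 \<and> \<alpha> = 0 \<and> \<delta> = 0 \<and> det A = 4)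
         \<longrightarrow> finite (point_spectrum m A) \<and> card (point_spectrum m A) \<le> 2"
  proof (cases "m = 0")
    case True
    then show ?thesis using zero by (cases "trace A = 0") auto
  next
    case False
    then show ?thesis using point_spectrum_finite[OF False, of A] by (auto simp: \<alpha>_def \<delta>_def)
  qed
  show "(m = 0 \<and> trace A = 0 \<and> det A \<noteq> 4)
         \<or> (m = 0 \<and> trace A \<noteq> 0 \<and> det A - 4 \<noteq> 2 * \<i> * trace A \<and> det A - 4 \<noteq> - 2 * \<i> * trace A)
         \<or> (m \<noteq> 0 \<and> \<alpha> = 0 \<and> \<delta> = 0 \<and> det A \<noteq> 4)
         \<or> (m \<noteq> 0 \<and> \<alpha> = 0 \<and> \<delta> \<noteq> 0 \<and> det A = 4)
         \<longrightarrow> point_spectrum m A = {}" (is "?a \<or> ?b \<or> ?c \<or> ?d \<longrightarrow> _")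
  proof
    assume "?a \<or> ?b \<or> ?c \<or> ?d"
    then consider ?a | ?b | ?c | ?d by blast
    then show "point_spectrum m A = {}"
    proof cases
      \<comment> \<open>Here det M is the nonzero constant 1 - det A / 4.\<close>
      case 3
      then show ?thesis using gen ncut by (auto simp: field_simps)
    next
      \<comment> \<open>Here det M reduces to (i/2) \<delta> / \<zeta>, which never
        vanishes.\<close>
      case 4
      then show ?thesis using gen ncut kk_zeta(4) by fastforce
    qed (use zero in auto)
  qed
  show "\<forall>z \<in> point_spectrum m A. \<exists>n \<le> 2.
           ae_cdim (eigenspace_D m A z) n \<and> vec_cdim {v. MM m A z *v v = 0} n"
    using eigenspace_dimension ncut by blast
  show "\<forall>z \<in> point_spectrum m A. \<not> z islimpt spectrum_D m A \<longrightarrow> (\<exists>n. ae_cdim (root_space m A z) n)"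
    using root_space_finite_dimensional by blast
  show "\<forall>z. z \<notin> spectrum_D m A \<longrightarrow> (\<forall>f \<psi>. L2 f \<longrightarrow> dirac_graph m A \<psi> (\<lambda>x. f x + z *s \<psi> x)
           \<longrightarrow> (AE x in lborel. integrable lborel (\<lambda>y. res_kernel m A z x y *v f y)
                 \<and> \<psi> x = (\<integral>y. res_kernel m A z x y *v f y \<partial>lborel)))"
  proof (intro allI impI)
    fix z f \<psi>
    assume "z \<notin> spectrum_D m A" and f: "L2 f" and \<psi>: "dirac_graph m A \<psi> (\<lambda>x. f x + z *s \<psi> x)"
    then have z: "z \<notin> cut_set m" and d: "det (MM m A z) \<noteq> 0"
      by (auto simp: spectrum_eq point_spectrum_iff)
    have "AE x in lborel. \<psi> x = res_sol m A z f x"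
      by (rule dirac_unique[OF z d \<psi> dirac_graph_res_sol[OF z d f]])
    then show "AE x in lborel. integrable lborel (\<lambda>y. res_kernel m A z x y *v f y)
                 \<and> \<psi> x = (\<integral>y. res_kernel m A z x y *v f y \<partial>lborel)"
      by eventually_elim
        (use res_kernel_integral[OF z f, of A] in \<open>auto simp: has_bochner_integral_iff\<close>)
  qed
qed

end
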